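(* Let $Z=\{p_1,\ldots,p_d\}$ be a finite set of $d$ distinct points in $\mathbb{P}^2=\mathbb{P}^2_{\mathbb{C}}$, with dual line arrangement $\mathcal{A}_Z: f_Z=0$, and for $i=1,\ldots,d$ let $Z_i=Z\setminus\{p_i\}$ with dual line arrangement $\mathcal{A}_{Z_i}:f_{Z_i}=0$. Then $Z$ admits an unexpected curve (of some degree) if and only if $$m(\mathcal{A}_Z)\leq mdr(f_Z)+1<\frac{d}{2}.$$ If these conditions are fulfilled, then $Z$ admits an unexpected curve of degree $j$ if and only if $$mdr(f_Z)<j\leq d-mdr(f_Z)-2.$$ Moreover, under these conditions, every unexpected curve $C_q$ of minimal degree $j=mdr(f_Z)+1$ (for $q$ a generic point of $\mathbb{P}^2$) is irreducible if and only if $mdr(f_Z)=mdr(f_{Z_i})$ for all $i=1,2,\ldots,d$.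
   Context: Work over $\mathbb{C}$, $S=\mathbb{C}[x,y,z]$. Unexpected curves: a finite set $Z\subset\mathbb{P}^2$ admits unexpected curves of degree $j\geq 2$ if, for a generic point $q\in\mathbb{P}^2$ (i.e. for $q$ in a nonempty Zariski open subset), $$h^0(\mathbb{P}^2,\mathcal{O}_{\mathbb{P}^2}(j)\otimes\mathcal{I}(Z+(j-1)q))>\max\left(0,\ h^0(\mathbb{P}^2,\mathcal{O}_{\mathbb{P}^2}(j)\otimes\mathcal{I}(Z))-\binom{j}{2}\right),$$ where $\mathcal{I}(Z)$ is the ideal sheaf of functions vanishing on $Z$ and $\mathcal{I}(Z+(j-1)q)$ is the ideal sheaf of functions vanishing on $Z$ and vanishing to order $j-1$ at $q$. An unexpected curve of degree $j$ (for generic $q$) is then a curve $C_q$ of degree $j$ passing through all points of $Z$ and having multiplicity at least $j-1$ at $q$. Dual arrangement: a point $(a:b:c)\in\mathbb{P}^2$ is dual to the line $ax+by+cz=0$; $\mathcal{A}_Z$ is the arrangement of the $d$ lines dual to the points of $Z$, and $f_Z\in S$ is the product of the corresponding linear forms. For a line arrangement $\mathcal{A}:f=0$, $m(\mathcal{A})$ is the maximal multiplicity of an intersection point of $\mathcal{A}$ (the maximal number of lines of $\mathcal{A}$ through a point), and $mdr(f)$ is the smallest integer $r\geq 0$ such that there is a nontrivial relation $af_x+bf_y+cf_z=0$ with $a,b,c\in S_r$ (homogeneous polynomials of degree $r$, not all zero), where $f_x,f_y,f_z$ are the partial derivatives of $f$. *)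

theory Defs
  imports "HOL-Analysis.Analysis" "HOL-Computational_Algebra.Computational_Algebra"
begin

text \<open>
  The ring $S = C[x,y,z]$ is represented as $C[x][y][z]$: the outermost
  polynomial variable is $z$, the innermost one is $x$.
\<close>

type_synonym S = "complex poly poly poly"

definition scale :: "complex \<Rightarrow> S \<Rightarrow> S" where
  "scale c f = smult [:[:c:]:] f"

lemma vector_space_scale: "vector_space scale"
  by unfold_locales
     (simp_all add: scale_def smult_add_right one_pCons [symmetric]
        flip: smult_add_left)

definition var_x :: S where "var_x = [:[:[:0, 1:]:]:]"
definition var_y :: S where "var_y = [:[:0, 1:]:]"
definition var_z :: S where "var_z = [:0, 1:]"

definition mcoeff :: "S \<Rightarrow> nat \<Rightarrow> nat \<Rightarrow> nat \<Rightarrow> complex" where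
  "mcoeff f i j k = coeff (coeff (coeff f k) j) i"

definition forms :: "nat \<Rightarrow> S set" where
  "forms d = {f. \<forall>i j k. mcoeff f i j k \<noteq> 0 \<longrightarrow> i + j + k = d}"

definition eval_at :: "S \<Rightarrow> complex ^ 3 \<Rightarrow> complex" where
  "eval_at f v = poly (poly (poly f [:[:v $ 3:]:]) [:v $ 2:]) (v $ 1)"

definition deriv_x :: "S \<Rightarrow> S" where "deriv_x = map_poly (map_poly pderiv)"
definition deriv_y :: "S \<Rightarrow> S" where "deriv_y = map_poly pderiv"
definition deriv_z :: "S \<Rightarrow> S" where "deriv_z = pderiv"

lemma mcoeff_var_x: "mcoeff var_x i j k = (if i = 1 \<and> j = 0 \<and> k = 0 then 1 else 0)"
  by (auto simp: mcoeff_def var_x_def coeff_pCons split: nat.splits)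

lemma mcoeff_var_y: "mcoeff var_y i j k = (if i = 0 \<and> j = 1 \<and> k = 0 then 1 else 0)"
  by (auto simp: mcoeff_def var_y_def coeff_pCons split: nat.splits)

lemma mcoeff_var_z: "mcoeff var_z i j k = (if i = 0 \<and> j = 0 \<and> k = 1 then 1 else 0)"
  by (auto simp: mcoeff_def var_z_def coeff_pCons split: nat.splits)

lemma mcoeff_deriv_x: "mcoeff (deriv_x f) i j k = of_nat (Suc i) * mcoeff f (Suc i) j k"
  by (simp add: mcoeff_def deriv_x_def coeff_map_poly coeff_pderiv)

lemma mcoeff_deriv_y: "mcoeff (deriv_y f) i j k = of_nat (Suc j) * mcoeff f i (Suc j) k"
  by (simp add: mcoeff_def deriv_y_def coeff_map_poly coeff_pderiv of_nat_poly del: of_nat_Suc)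

lemma mcoeff_deriv_z: "mcoeff (deriv_z f) i j k = of_nat (Suc k) * mcoeff f i j (Suc k)"
  by (simp add: mcoeff_def deriv_z_def coeff_pderiv of_nat_poly del: of_nat_Suc)

lemma eval_at_vars:
  "eval_at var_x v = v $ 1" "eval_at var_y v = v $ 2" "eval_at var_z v = v $ 3"
  by (simp_all add: eval_at_def var_x_def var_y_def var_z_def)

lemma eval_at_add: "eval_at (f + g) v = eval_at f v + eval_at g v"
  by (simp add: eval_at_def)

lemma eval_at_mult: "eval_at (f * g) v = eval_at f v * eval_at g v"
  by (simp add: eval_at_def)

lemma eval_at_scale: "eval_at (scale c f) v = c * eval_at f v"
  by (simp add: eval_at_def scale_def)

definition proportional :: "complex ^ 3 \<Rightarrow> complex ^ 3 \<Rightarrow> bool" where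
  "proportional u v \<longleftrightarrow> u \<noteq> 0 \<and> v \<noteq> 0 \<and> (\<exists>c. c \<noteq> 0 \<and> v = c *s u)"

quotient_type P2 = "complex ^ 3" / partial: proportional
proof (rule part_equivpI)
  have "proportional (axis 1 1) (axis 1 1)"
    by (auto simp: proportional_def axis_eq_0_iff intro!: exI [of _ 1])
  then show "\<exists>v. proportional v v" by blast
  show "symp proportional"
  proof (rule sympI)
    fix u v assume "proportional u v"
    then obtain c where c: "u \<noteq> 0" "v \<noteq> 0" "c \<noteq> 0" "v = c *s u"
      by (auto simp: proportional_def)
    then have "u = inverse c *s v" by (simp add: vector_smult_assoc)
    with c show "proportional v u"
      unfolding proportional_def by (metis inverse_nonzero_iff_nonzero)
  qed
  show "transp proportional"
    by (rule transpI) (auto simp: proportional_def vector_smult_assoc intro: mult_eq_0_iff)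
qed

text \<open>
  \<open>coords p\<close> is a fixed choice of homogeneous coordinates of $p$.  All notions below
  that mention it are independent of this choice when applied to forms; the product
  of linear forms \<open>dual_form\<close> changes by a nonzero constant factor only.
\<close>

definition coords :: "P2 \<Rightarrow> complex ^ 3" where
  "coords p = rep_P2 p"

lemma coords_nonzero: "coords p \<noteq> 0"
  using Quotient3_rep_reflp [OF Quotient3_P2, of p]
  by (simp add: coords_def proportional_def)

lemma coords_inj: "coords p = coords q \<longleftrightarrow> p = q"
  by (metis coords_def Quotient3_P2 Quotient3_abs_rep)

definition vanishes_at :: "S \<Rightarrow> P2 \<Rightarrow> bool" where
  "vanishes_at f p \<longleftrightarrow> eval_at f (coords p) = 0"

text \<open>
  For a form, the order of vanishing at a point of the plane equals the order of
  vanishing at any point of the punctured line over it in affine 3-space, whence the use of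
  the partial derivatives with respect to the homogeneous coordinates.
\<close>

definition vanishes_to_order :: "nat \<Rightarrow> S \<Rightarrow> P2 \<Rightarrow> bool" where
  "vanishes_to_order m f p \<longleftrightarrow>
     (\<forall>i j k. i + j + k < m \<longrightarrow>
        vanishes_at ((deriv_x ^^ i) ((deriv_y ^^ j) ((deriv_z ^^ k) f))) p)"

definition zariski_closed :: "P2 set \<Rightarrow> bool" where
  "zariski_closed V \<longleftrightarrow>
     (\<exists>T. T \<subseteq> (\<Union>d. forms d) \<and> V = {p. \<forall>f\<in>T. vanishes_at f p})"

definition generically :: "(P2 \<Rightarrow> bool) \<Rightarrow> bool" where
  "generically P \<longleftrightarrow>
     (\<exists>U. zariski_closed (- U) \<and> U \<noteq> {} \<and> (\<forall>q\<in>U. P q))"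

text \<open>
  The global sections of the twist by $j$ of the ideal sheaf of $Z$, respectively of
  $Z + (j-1)q$, as spaces of forms of degree $j$.
\<close>

definition sections_through :: "P2 set \<Rightarrow> nat \<Rightarrow> S set" where
  "sections_through Z j = {f \<in> forms j. \<forall>p\<in>Z. vanishes_at f p}"

definition sections_through_fat :: "P2 set \<Rightarrow> nat \<Rightarrow> P2 \<Rightarrow> S set" where
  "sections_through_fat Z j q =
     {f \<in> sections_through Z j. vanishes_to_order (j - 1) f q}"

definition h0 :: "S set \<Rightarrow> nat" where
  "h0 V = vector_space.dim scale V"

definition admits_unexpected :: "P2 set \<Rightarrow> nat \<Rightarrow> bool" where
  "admits_unexpected Z j \<longleftrightarrow> j \<ge> 2 \<and>
     generically (\<lambda>q. int (h0 (sections_through_fat Z j q)) >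
        max 0 (int (h0 (sections_through Z j)) - int (j choose 2)))"

text \<open>A curve of degree $j$ is given by a nonzero form of degree $j$.\<close>

definition unexpected_curve :: "P2 set \<Rightarrow> nat \<Rightarrow> P2 \<Rightarrow> S \<Rightarrow> bool" where
  "unexpected_curve Z j q C \<longleftrightarrow>
     admits_unexpected Z j \<and> C \<noteq> 0 \<and> C \<in> sections_through_fat Z j q"

definition linear_form :: "P2 \<Rightarrow> S" where
  "linear_form p =
     scale (coords p $ 1) var_x + scale (coords p $ 2) var_y + scale (coords p $ 3) var_z"

definition dual_line :: "P2 \<Rightarrow> P2 set" where
  "dual_line p = {q. vanishes_at (linear_form p) q}"

definition dual_arrangement :: "P2 set \<Rightarrow> P2 set set" where
  "dual_arrangement Z = dual_line ` Z"

definition dual_form :: "P2 set \<Rightarrow> S" where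
  "dual_form Z = (\<Prod>p\<in>Z. linear_form p)"

definition max_multiplicity :: "P2 set set \<Rightarrow> nat" where
  "max_multiplicity A = (MAX q. card {L \<in> A. q \<in> L})"

definition mdr :: "S \<Rightarrow> nat" where
  "mdr f = (LEAST r. \<exists>a\<in>forms r. \<exists>b\<in>forms r. \<exists>c\<in>forms r.
     \<not> (a = 0 \<and> b = 0 \<and> c = 0) \<and>
     a * deriv_x f + b * deriv_y f + c * deriv_z f = 0)"

end

theory Submission
  imports Defs "HOL-Computational_Algebra.Field_as_Ring"
begin

text \<open>
  A curve of degree $j$ with a point $q$ of multiplicity $j - 1$ has an equation
  $U(t,s) + y N(t,s) = 0$, where $t, s$ are linear forms vanishing at $q$ and $U, N$ are binary
  forms.  By duality such a curve through $Z$ is a section, over the line dual to $q$, of the bundle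
  of logarithmic vector fields modulo the Euler field: a vector field $\theta$ of degree $a$ gives
  the curve $\theta(p \times q) \cdot p = 0$ of degree $a + 1$.  Let $a$ be the least number for
  which such a curve of degree $a + 1$ exists for generic $q$; then $a \leq mdr(f_Z)$, and we put
  $b = d - 1 - a \geq a$.

  If $2a + 2 < d$, then $a = mdr(f_Z)$.  Indeed, the direction of the vector field attached to $q$,
  taken at a point $v$ of the line dual to $q$, does not depend on the line: its derivative with
  respect to the lines through $v$ is measured by a binary form of degree $2a + 2$ that
  vanishes at the $d$ points where the line meets the arrangement.  Hence the generic curves come
  from one logarithmic vector field on the plane.

  Let $R_j(q) \supseteq R_j$ be the spaces of linear relations between the evaluations at the points
  of $Z$ on the curves of degree $j$ with multiplicity $j - 1$ at $q$, respectively on all forms of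
  degree $j$.  Comparing dimensions, $Z$ admits an unexpected curve of degree $j$ if and only if, for
  generic $q$, such a curve exists (that is, $j > a$) and $R_j(q) \neq R_j$.  For $j \geq b$ already
  $R_j(q) = 0$.  For $a \leq j < b$ the space $R_j(q)$ consists of the multiples of one relation $w$ by
  binary forms in $t, s$.  If $R_j(q) = R_j$ for some $a < j < b$, then multiplication by $y$ also maps
  $R_j(q)$ to $R_{j-1}(q)$, and this puts the support of $w$, which has more than $b$ points, on a line.
  Conversely, if $a + 2$ points of $Z$ are collinear, the generic curve contains their line, all but at most
  $a$ points of $Z$ lie on it, and $R_j(q) = R_j$.

  Finally, a reducible curve $U + yN = 0$ of degree $a + 1$ contains a line through $q$; by
  minimality of $a$ that line passes through a point $p$ of $Z$, and the rest is a curve of the same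
  kind for $Z \setminus \{p\}$.
\<close>

section \<open>Linear algebra\<close>

text \<open>Genericity enters through one chart: the center (m : -1 : c) is dual to the line y = m x
  + c z, and all linear systems have coefficients in C[m][c]. Elimination over this ring leaves no
  third case between a curve at almost all centers and none at almost all centers, and finitely many
  exceptional polynomials can be multiplied. The bound 2a + 2 is the degree of a Wronskian. Along
  the line the vector field is (u, v), with u of degree a + 1 and v - m u of degree a in x, and
  differentiation in m at fixed (x, y) raises the degree in x by at most one. The obstacle in
  passing from lines to the plane is a common factor of u and v that depends on m: where it vanishes
  along a line of the arrangement, nothing is known about the reduced field. The condition in the
  theorem is on r = mdr, whereas the geometry needs it for a. Since a \<le> r, the inequality 2r + 2
  < d implies 2a + 2 < d; conversely 2a + 2 < d forces a = r. So the two inequalities are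
  equivalent.\<close>

text \<open>
  Over a polynomial ring the first alternative is a family of solutions depending polynomially on the
  parameters, and the second one excludes solutions at all parameters where $\delta \neq 0$.
\<close>

lemma kernel_or_left_inverse:
  fixes M :: "'k \<Rightarrow> 'r \<Rightarrow> 'a::idom"
  assumes "finite K" "finite I"
  shows "(\<exists>w. (\<exists>k\<in>K. w k \<noteq> 0) \<and> (\<forall>i\<in>I. (\<Sum>k\<in>K. w k * M k i) = 0)) \<or>
         (\<exists>N \<delta>. \<delta> \<noteq> 0 \<and> (\<forall>k\<in>K. \<forall>l\<in>K. (\<Sum>i\<in>I. N k i * M l i) = (if k = l then \<delta> else 0)))"
  using assms(1)
proof (induction K rule: finite_induct)
  case empty
  show ?case by (rule disjI2, rule exI, rule exI[of _ 1]) simp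
next
  case (insert n K)
  from insert.IH show ?case
  proof (elim disjE exE conjE)
    fix w assume w: "\<exists>k\<in>K. w k \<noteq> 0" "\<forall>i\<in>I. (\<Sum>k\<in>K. w k * M k i) = 0"
    define w' where "w' = w(n := 0)"
    have "(\<Sum>k\<in>insert n K. w' k * M k i) = (\<Sum>k\<in>K. w k * M k i)" for i
      using insert.hyps by (auto simp: w'_def intro!: sum.cong)
    moreover have "\<exists>k\<in>insert n K. w' k \<noteq> 0"
      using w(1) insert.hyps unfolding w'_def by (metis fun_upd_other insertCI)
    ultimately show ?thesis using w(2) by (intro disjI1 exI[of _ w']) auto
  next
    fix N \<delta> assume \<delta>: "\<delta> \<noteq> (0::'a)"
      and N: "\<forall>k\<in>K. \<forall>l\<in>K. (\<Sum>i\<in>I. N k i * M l i) = (if k = l then \<delta> else 0)"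
    \<comment> \<open>If row \<open>n\<close> depends on the rows in \<open>K\<close>, then
      \<open>P k\<close> is \<open>\<delta>\<close> times its coefficient at row \<open>k\<close>.
      The remainder \<open>rs\<close> is scaled by \<open>\<delta>\<close> as well, so that no
      division occurs.\<close>
    define P where "P k = (\<Sum>i\<in>I. N k i * M n i)" for k
    define rs where "rs i = \<delta> * M n i - (\<Sum>k\<in>K. P k * M k i)" for i
    show ?thesis
    proof (cases "\<forall>i\<in>I. rs i = 0")
      case True
      define w where "w k = (if k = n then \<delta> else - P k)" for k
      have "(\<Sum>k\<in>K. w k * M k i) = (\<Sum>k\<in>K. - (P k * M k i))" for i
        using insert.hyps by (intro sum.cong) (auto simp: w_def)
      then have "(\<Sum>k\<in>insert n K. w k * M k i) = rs i" for i
        using insert.hyps by (simp add: rs_def w_def sum_negf)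
      moreover have "\<exists>k\<in>insert n K. w k \<noteq> 0" using \<delta> by (auto simp: w_def)
      ultimately show ?thesis using True by (intro disjI1 exI[of _ w]) auto
    next
      case False
      then obtain i0 where i0: "i0 \<in> I" "rs i0 \<noteq> 0" by auto
      define \<rho> where "\<rho> = rs i0"
      \<comment> \<open>A functional that reads off entry \<open>i0\<close> of the remainder of a
        row: it kills the rows in \<open>K\<close> and takes the value \<open>\<rho>\<close> on row
        \<open>n\<close>.\<close>
      define \<phi> where "\<phi> i = (if i = i0 then \<delta> else 0) - (\<Sum>k\<in>K. M k i0 * N k i)" for i
      have \<phi>: "(\<Sum>i\<in>I. \<phi> i * M l i) = \<delta> * M l i0 - (\<Sum>k\<in>K. M k i0 * (\<Sum>i\<in>I. N k i * M l i))" for l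
      proof -
        have "(\<Sum>i\<in>I. \<phi> i * M l i) = (\<Sum>i\<in>I. (if i = i0 then \<delta> * M l i else 0))
              - (\<Sum>i\<in>I. \<Sum>k\<in>K. M k i0 * (N k i * M l i))"
          unfolding \<phi>_def sum_subtractf[symmetric]
          by (intro sum.cong) (auto simp: algebra_simps sum_distrib_left sum_distrib_right)
        also have "(\<Sum>i\<in>I. \<Sum>k\<in>K. M k i0 * (N k i * M l i)) = (\<Sum>k\<in>K. M k i0 * (\<Sum>i\<in>I. N k i * M l i))"
          by (subst sum.swap) (simp add: sum_distrib_left)
        also have "(\<Sum>i\<in>I. (if i = i0 then \<delta> * M l i else 0)) = \<delta> * M l i0"
          using i0 assms(2) by simp
        finally show ?thesis .
      qed
      have \<phi>K: "(\<Sum>i\<in>I. \<phi> i * M l i) = 0" if "l \<in> K" for l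
      proof -
        have "(\<Sum>k\<in>K. M k i0 * (\<Sum>i\<in>I. N k i * M l i)) = (\<Sum>k\<in>K. if k = l then M k i0 * \<delta> else 0)"
          using N that by (intro sum.cong) auto
        then show ?thesis using that insert.hyps by (simp add: \<phi> mult.commute)
      qed
      have \<phi>n: "(\<Sum>i\<in>I. \<phi> i * M n i) = \<rho>"
        by (simp add: \<phi> \<rho>_def rs_def P_def mult.commute)
      \<comment> \<open>\<open>\<phi>\<close> detects row \<open>n\<close>, and subtracting
        \<open>P k * \<phi>\<close> makes the old functionals vanish there. The scaling gives all
        diagonal values the common value \<open>\<rho> * \<delta>\<close>.\<close>
      define N' where "N' k i = (if k = n then \<delta> * \<phi> i else \<rho> * N k i - P k * \<phi> i)" for k i
      have N'n: "(\<Sum>i\<in>I. N' n i * M l i) = \<delta> * (\<Sum>i\<in>I. \<phi> i * M l i)" for l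
        by (simp add: N'_def sum_distrib_left mult.assoc)
      have N'k: "(\<Sum>i\<in>I. N' k i * M l i) =
          \<rho> * (\<Sum>i\<in>I. N k i * M l i) - P k * (\<Sum>i\<in>I. \<phi> i * M l i)" if "k \<noteq> n" for k l
        using that by (simp add: N'_def sum_distrib_left mult.assoc left_diff_distrib sum_subtractf)
      have "(\<Sum>i\<in>I. N' k i * M l i) = (if k = l then \<rho> * \<delta> else 0)"
        if "k \<in> insert n K" "l \<in> insert n K" for k l
      proof (cases "k = n")
        case True
        then show ?thesis using that insert.hyps by (auto simp: N'n \<phi>n \<phi>K)
      next
        case False
        then have "k \<in> K" using that by auto
        show ?thesis
        proof (cases "l = n")
          case True
          then show ?thesis using False N'k[OF False, of l] by (simp add: \<phi>n P_def)
        next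
          case l: False
          then have "l \<in> K" using that by auto
          with \<open>k \<in> K\<close> N \<phi>K show ?thesis by (simp add: N'k[OF False])
        qed
      qed
      moreover have "\<rho> * \<delta> \<noteq> 0" using \<delta> i0 by (simp add: \<rho>_def)
      ultimately show ?thesis by (intro disjI2 exI[of _ N'] exI[of _ "\<rho> * \<delta>"]) blast
    qed
  qed
qed

text \<open>Elimination without division: equation \<open>i0\<close> is solved for the unknown
  \<open>k0\<close>, and the other entries are cross-multiplied with the pivot. The cross-multiplied
  entries at \<open>i0\<close> are zero, so one identity covers equation \<open>i0\<close> and the
  remaining ones.\<close>

lemma nontrivial_kernel:
  fixes M :: "'k \<Rightarrow> 'r \<Rightarrow> 'a::idom"
  assumes "finite I" "finite K" "card I < card K"
  shows "\<exists>w. (\<exists>k\<in>K. w k \<noteq> 0) \<and> (\<forall>i\<in>I. (\<Sum>k\<in>K. w k * M k i) = 0)"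
  using assms
proof (induction I arbitrary: K M rule: finite_induct)
  case empty
  then have "K \<noteq> {}" by auto
  then show ?case by (intro exI[of _ "\<lambda>_. 1"]) auto
next
  case (insert i0 I)
  show ?case
  proof (cases "\<forall>k\<in>K. M k i0 = 0")
    case True
    from insert have "card I < card K" by simp
    from insert.IH[OF insert.prems(1) this, of M] obtain w
      where "\<exists>k\<in>K. w k \<noteq> 0" "\<forall>i\<in>I. (\<Sum>k\<in>K. w k * M k i) = 0" by blast
    with True show ?thesis by (intro exI[of _ w]) auto
  next
    case False
    then obtain k0 where k0: "k0 \<in> K" "M k0 i0 \<noteq> 0" by auto
    let ?\<rho> = "M k0 i0"
    let ?M = "\<lambda>k i. ?\<rho> * M k i - M k i0 * M k0 i"
    have "card I < card (K - {k0})" using insert k0 by (simp add: card_Diff_singleton)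
    from insert.IH[OF _ this, of ?M] insert.prems obtain w
      where w: "\<exists>k\<in>K - {k0}. w k \<noteq> 0" "\<forall>i\<in>I. (\<Sum>k\<in>K - {k0}. w k * ?M k i) = 0" by auto
    define w' where "w' k = (if k = k0 then - (\<Sum>k\<in>K - {k0}. w k * M k i0) else ?\<rho> * w k)" for k
    have eq: "(\<Sum>k\<in>K. w' k * M k i) = (\<Sum>k\<in>K - {k0}. w k * ?M k i)" for i
    proof -
      have "(\<Sum>k\<in>K. w' k * M k i) = w' k0 * M k0 i + (\<Sum>k\<in>K - {k0}. w' k * M k i)"
        using k0 insert.prems by (simp add: sum.remove)
      also have "(\<Sum>k\<in>K - {k0}. w' k * M k i) = (\<Sum>k\<in>K - {k0}. w k * (?\<rho> * M k i))"
        by (intro sum.cong) (auto simp: w'_def mult_ac)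
      also have "w' k0 * M k0 i = - (\<Sum>k\<in>K - {k0}. w k * (M k i0 * M k0 i))"
        unfolding w'_def sum_distrib_left[symmetric] by (simp add: sum_distrib_right mult.assoc)
      finally show ?thesis by (simp add: right_diff_distrib sum_subtractf)
    qed
    show ?thesis
    proof (intro exI[of _ w'] conjI ballI)
      show "\<exists>k\<in>K. w' k \<noteq> 0" using w(1) k0 by (auto simp: w'_def)
      fix i assume "i \<in> insert i0 I"
      then show "(\<Sum>k\<in>K. w' k * M k i) = 0" unfolding eq using w(2) by auto
    qed
  qed
qed

section \<open>Linear functionals, their common kernels and dimension\<close>

definition functional :: "('a::field \<Rightarrow> 'b::ab_group_add \<Rightarrow> 'b) \<Rightarrow> ('b \<Rightarrow> 'a) \<Rightarrow> bool" where
  "functional sc \<phi> \<longleftrightarrow> (\<forall>x y. \<phi> (x + y) = \<phi> x + \<phi> y) \<and> (\<forall>c x. \<phi> (sc c x) = c * \<phi> x)"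

lemma functional_sum_scaled:
  assumes "\<And>i. i \<in> I \<Longrightarrow> functional sc (\<phi> i)"
  shows "functional sc (\<lambda>x. \<Sum>i\<in>I. c i * \<phi> i x)"
  using assms unfolding functional_def
  by (auto simp: sum.distrib[symmetric] sum_distrib_left algebra_simps intro!: sum.cong)

context vector_space
begin

lemma functional_diff:
  assumes "functional scale \<phi>"
  shows "\<phi> (x - y) = \<phi> x - \<phi> y" "\<phi> 0 = 0" "\<phi> (x + y) = \<phi> x + \<phi> y" "\<phi> (scale c x) = c * \<phi> x"
proof -
  show add: "\<phi> (x + y) = \<phi> x + \<phi> y" for x y using assms by (simp add: functional_def)
  show "\<phi> (scale c x) = c * \<phi> x" using assms by (simp add: functional_def)
  have "\<phi> 0 + 0 = \<phi> 0 + \<phi> 0" using add[of 0 0] by simp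
  then show "\<phi> 0 = 0" by (simp only: add_left_cancel)
  show "\<phi> (x - y) = \<phi> x - \<phi> y" using add[of "x - y" y] by simp
qed

lemma subspace_common_kernel:
  assumes "subspace V" "\<And>i. i \<in> I \<Longrightarrow> functional scale (\<phi> i)"
  shows "subspace {x \<in> V. \<forall>i\<in>I. \<phi> i x = 0}"
  using assms
  by (auto simp: subspace_def functional_diff(2) functional_diff(3,4)[OF assms(2)])

text \<open>A vector \<open>v\<close> killed by the other functionals and normalized at
  \<open>\<phi> i\<close> splits off one functional: \<open>\<psi>\<close> minus
  \<open>\<psi> v\<close> times \<open>\<phi> i\<close> vanishes on the common kernel of the others.
  Below, this converts dependencies between jets into relations between evaluations, and
  back.\<close>

lemma common_kernel_combination:
  assumes "finite I" "subspace V" "\<And>i. i \<in> I \<Longrightarrow> functional scale (\<phi> i)" "functional scale \<psi>"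
    and "\<And>x. x \<in> V \<Longrightarrow> \<forall>i\<in>I. \<phi> i x = 0 \<Longrightarrow> \<psi> x = 0"
  shows "\<exists>c. \<forall>x\<in>V. \<psi> x = (\<Sum>i\<in>I. c i * \<phi> i x)"
  using assms(1,3-5)
proof (induction I arbitrary: \<psi> rule: finite_induct)
  case empty
  then show ?case by auto
next
  case (insert i I)
  have lin: "\<And>j. j \<in> I \<Longrightarrow> functional scale (\<phi> j)" using insert.prems(1) by auto
  have lini: "functional scale (\<phi> i)" using insert.prems(1) by auto
  show ?case
  proof (cases "\<forall>x\<in>V. (\<forall>j\<in>I. \<phi> j x = 0) \<longrightarrow> \<phi> i x = 0")
    case True
    then have "\<exists>c. \<forall>x\<in>V. \<psi> x = (\<Sum>i\<in>I. c i * \<phi> i x)"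
      using insert.prems(3) by (intro insert.IH lin insert.prems(2)) auto
    then obtain c where c: "\<forall>x\<in>V. \<psi> x = (\<Sum>i\<in>I. c i * \<phi> i x)" by blast
    have "(\<Sum>j\<in>I. (c(i := 0)) j * \<phi> j x) = (\<Sum>j\<in>I. c j * \<phi> j x)" for x
      using insert.hyps by (intro sum.cong) auto
    then show ?thesis using c insert.hyps by (intro exI[of _ "c(i := 0)"]) simp
  next
    case False
    then obtain v0 where v0: "v0 \<in> V" "\<forall>j\<in>I. \<phi> j v0 = 0" "\<phi> i v0 \<noteq> 0" by auto
    define v where "v = scale (inverse (\<phi> i v0)) v0"
    have v: "v \<in> V" "\<forall>j\<in>I. \<phi> j v = 0" "\<phi> i v = 1"
      using v0 lin lini assms(2) by (auto simp: v_def functional_diff(4) subspace_scale)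
    define \<psi>' where "\<psi>' x = \<psi> x - \<psi> v * \<phi> i x" for x
    have lin': "functional scale \<psi>'"
      using insert.prems(2) lini unfolding \<psi>'_def functional_def by (auto simp: algebra_simps)
    have "\<psi>' x = 0" if x: "x \<in> V" "\<forall>j\<in>I. \<phi> j x = 0" for x
    proof -
      let ?y = "x - scale (\<phi> i x) v"
      have "?y \<in> V" using x v assms(2) by (simp add: subspace_diff subspace_scale)
      moreover have "\<forall>j\<in>insert i I. \<phi> j ?y = 0"
        using x v lin lini by (auto simp: functional_diff)
      ultimately have "\<psi> ?y = 0" using insert.prems(3) by blast
      then show ?thesis using insert.prems(2) by (simp add: \<psi>'_def functional_diff mult.commute)
    qed
    then have "\<exists>c. \<forall>x\<in>V. \<psi>' x = (\<Sum>i\<in>I. c i * \<phi> i x)"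
      by (intro insert.IH lin lin') auto
    then obtain c where c: "\<forall>x\<in>V. \<psi>' x = (\<Sum>i\<in>I. c i * \<phi> i x)" by blast
    have "(\<Sum>j\<in>I. (c(i := \<psi> v)) j * \<phi> j x) = (\<Sum>j\<in>I. c j * \<phi> j x)" for x
      using insert.hyps by (intro sum.cong) auto
    then show ?thesis using c insert.hyps
      by (intro exI[of _ "c(i := \<psi> v)"]) (auto simp: \<psi>'_def diff_eq_eq)
  qed
qed

lemma dim_functional_kernel:
  assumes V: "subspace V" "V \<subseteq> span S" "finite S" and lin: "functional scale \<phi>"
    and v: "v \<in> V" "\<phi> v \<noteq> 0"
  shows "dim V = Suc (dim {x \<in> V. \<phi> x = 0})"
proof -
  let ?W = "{x \<in> V. \<phi> x = 0}"
  have W: "subspace ?W"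
    using subspace_common_kernel[OF V(1), of "{()}" "\<lambda>_. \<phi>"] lin by simp
  obtain B where B: "B \<subseteq> ?W" "independent B" "?W \<subseteq> span B" "card B = dim ?W"
    using basis_exists[of ?W] by blast
  have fin: "finite B" using independent_span_bound[OF V(3) B(2)] B(1) V(2) by blast
  have sp: "span B \<subseteq> ?W" using span_minimal[OF B(1) W] .
  have ind: "independent (insert v B)" using B(2) sp v by (intro independent_insertI) auto
  have "v \<notin> B" using B(1) v by auto
  have "V \<subseteq> span (insert v B)"
  proof
    fix x assume x: "x \<in> V"
    let ?y = "x - scale (\<phi> x / \<phi> v) v"
    have "?y \<in> ?W" using x v V(1) lin by (simp add: functional_diff subspace_diff subspace_scale)
    then have "?y \<in> span B" using B(3) by auto
    then show "x \<in> span (insert v B)" by (auto simp: span_insert)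
  qed
  moreover have "insert v B \<subseteq> V" using B(1) v by auto
  ultimately have "dim V = card (insert v B)" using ind by (intro dim_unique[of "insert v B"]) auto
  then show ?thesis using fin \<open>v \<notin> B\<close> B(4) by simp
qed

lemma dim_common_kernel_le:
  assumes V: "subspace V" "V \<subseteq> span S" "finite S" and I: "finite I"
    and lin: "\<And>i. i \<in> I \<Longrightarrow> functional scale (\<phi> i)"
  shows "dim V \<le> dim {x \<in> V. \<forall>i\<in>I. \<phi> i x = 0} + card I"
  using I lin
proof (induction I rule: finite_induct)
  case empty
  then show ?case by simp
next
  case (insert i I)
  let ?W = "{x \<in> V. \<forall>j\<in>I. \<phi> j x = 0}"
  have eq: "{x \<in> V. \<forall>j\<in>insert i I. \<phi> j x = 0} = {x \<in> ?W. \<phi> i x = 0}" by auto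
  have W: "subspace ?W"
    by (rule subspace_common_kernel[OF V(1)]) (simp add: insert.prems)
  have W2: "?W \<subseteq> span S" using V(2) by blast
  have "dim ?W \<le> Suc (dim {x \<in> ?W. \<phi> i x = 0})"
  proof (cases "\<exists>v\<in>?W. \<phi> i v \<noteq> 0")
    case True
    then obtain v where "v \<in> ?W" "\<phi> i v \<noteq> 0" by blast
    then have "dim ?W = Suc (dim {x \<in> ?W. \<phi> i x = 0})"
      using insert.prems by (intro dim_functional_kernel[OF W W2 V(3)]) auto
    then show ?thesis by (rule eq_refl)
  next
    case False
    then have "{x \<in> ?W. \<phi> i x = 0} = ?W" by auto
    then show ?thesis by simp
  qed
  then show ?case using insert unfolding eq by simp
qed

text \<open>The codimension of the common kernel is the rank of the functionals on \<open>V\<close>.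
  For the jets at the center, on the forms through \<open>Z\<close>, the failure of the expected
  dimension becomes a linear dependency.\<close>

lemma dim_common_kernel_less_iff:
  assumes V: "subspace V" "V \<subseteq> span S" "finite S" and I: "finite I"
    and lin: "\<And>i. i \<in> I \<Longrightarrow> functional scale (\<phi> i)"
  shows "dim V < dim {x \<in> V. \<forall>i\<in>I. \<phi> i x = 0} + card I \<longleftrightarrow>
    (\<exists>c. (\<exists>i\<in>I. c i \<noteq> 0) \<and> (\<forall>x\<in>V. (\<Sum>i\<in>I. c i * \<phi> i x) = 0))"
proof
  assume "\<exists>c. (\<exists>i\<in>I. c i \<noteq> 0) \<and> (\<forall>x\<in>V. (\<Sum>i\<in>I. c i * \<phi> i x) = 0)"
  then obtain c i where c: "i \<in> I" "c i \<noteq> 0" "\<forall>x\<in>V. (\<Sum>i\<in>I. c i * \<phi> i x) = 0" by blast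
  \<comment> \<open>On \<open>V\<close> a functional with nonzero coefficient is a combination of
    the others, so leaving it out does not enlarge the kernel.\<close>
  have "\<phi> i x = 0" if "x \<in> V" "\<forall>j\<in>I - {i}. \<phi> j x = 0" for x
  proof -
    have "(\<Sum>i\<in>I. c i * \<phi> i x) = c i * \<phi> i x + (\<Sum>j\<in>I - {i}. c j * \<phi> j x)"
      using I c(1) by (rule sum.remove)
    also have "(\<Sum>j\<in>I - {i}. c j * \<phi> j x) = 0" using that by (intro sum.neutral) auto
    finally show ?thesis using c that by auto
  qed
  then have eq: "{x \<in> V. \<forall>i\<in>I. \<phi> i x = 0} = {x \<in> V. \<forall>j\<in>I - {i}. \<phi> j x = 0}" by blast
  have "dim V \<le> dim {x \<in> V. \<forall>j\<in>I - {i}. \<phi> j x = 0} + card (I - {i})"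
    using I lin by (intro dim_common_kernel_le[OF V]) auto
  moreover have "card (I - {i}) < card I" using I c(1) by (meson card_Diff1_less)
  ultimately show "dim V < dim {x \<in> V. \<forall>i\<in>I. \<phi> i x = 0} + card I" unfolding eq by linarith
next
  show "dim V < dim {x \<in> V. \<forall>i\<in>I. \<phi> i x = 0} + card I \<Longrightarrow>
    \<exists>c. (\<exists>i\<in>I. c i \<noteq> 0) \<and> (\<forall>x\<in>V. (\<Sum>i\<in>I. c i * \<phi> i x) = 0)"
    using I lin
  proof (induction I rule: finite_induct)
    case empty
    then show ?case by simp
  next
    case (insert i I)
    let ?W = "{x \<in> V. \<forall>j\<in>I. \<phi> j x = 0}"
    have linI: "\<And>j. j \<in> I \<Longrightarrow> functional scale (\<phi> j)" using insert.prems by auto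
    have eq: "{x \<in> V. \<forall>j\<in>insert i I. \<phi> j x = 0} = {x \<in> ?W. \<phi> i x = 0}" by auto
    have W: "subspace ?W" "?W \<subseteq> span S"
      using subspace_common_kernel[OF V(1) linI] V(2) by auto
    show ?case
    proof (cases "dim V < dim ?W + card I")
      case True
      then obtain c where c: "\<exists>i\<in>I. c i \<noteq> 0" "\<forall>x\<in>V. (\<Sum>i\<in>I. c i * \<phi> i x) = 0"
        using insert.IH linI by blast
      have "(\<Sum>j\<in>I. (c(i := 0)) j * \<phi> j x) = (\<Sum>j\<in>I. c j * \<phi> j x)" for x
        using insert.hyps by (intro sum.cong) auto
      moreover obtain i1 where "i1 \<in> I" "c i1 \<noteq> 0" using c(1) by blast
      ultimately have "\<exists>j\<in>insert i I. (c(i := 0)) j \<noteq> 0"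
        "\<forall>x\<in>V. (\<Sum>j\<in>insert i I. (c(i := 0)) j * \<phi> j x) = 0"
        using c(2) insert.hyps by (auto intro!: bexI[of _ i1])
      then show ?thesis by blast
    next
      case False
      \<comment> \<open>The functionals in \<open>I\<close> already lower the dimension by
        \<open>card I\<close>; if \<open>\<phi> i\<close> were nonzero on their kernel, it would
        lower it once more, against the assumed inequality.\<close>
      have "\<phi> i x = 0" if "x \<in> V" "\<forall>j\<in>I. \<phi> j x = 0" for x
      proof (rule ccontr)
        assume "\<phi> i x \<noteq> 0"
        then have "dim ?W = Suc (dim {x \<in> ?W. \<phi> i x = 0})"
          using that insert.prems by (intro dim_functional_kernel[OF W V(3)]) auto
        then show False using False insert.prems(1) insert.hyps unfolding eq by simp
      qed
      then have "\<exists>c. \<forall>x\<in>V. \<phi> i x = (\<Sum>j\<in>I. c j * \<phi> j x)"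
        using insert by (intro common_kernel_combination V(1)) auto
      then obtain c where c: "\<forall>x\<in>V. \<phi> i x = (\<Sum>j\<in>I. c j * \<phi> j x)" by blast
      have "(\<Sum>j\<in>I. (c(i := -1)) j * \<phi> j x) = (\<Sum>j\<in>I. c j * \<phi> j x)" for x
        using insert.hyps by (intro sum.cong) auto
      then show ?thesis using c insert.hyps by (intro exI[of _ "c(i := -1)"]) auto
    qed
  qed
qed

text \<open>The finite spanning set excludes the infinite-dimensional case, where \<open>dim\<close>
  is 0 by default.\<close>

lemma dim_eq_0_subset:
  assumes "V \<subseteq> span S" "finite S"
  shows "dim V = 0 \<longleftrightarrow> V \<subseteq> {0}"
proof
  assume "dim V = 0"
  obtain B where B: "B \<subseteq> V" "independent B" "V \<subseteq> span B" "card B = dim V"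
    using basis_exists[of V] by blast
  have "finite B" using independent_span_bound[OF assms(2) B(2)] B(1) assms(1) by blast
  then show "V \<subseteq> {0}" using B \<open>dim V = 0\<close> by auto
next
  assume "V \<subseteq> {0}"
  then have "dim V \<le> card ({}::'b set)" by (intro dim_le_card) auto
  then show "dim V = 0" by simp
qed

end

section \<open>Curves with a fat point, projected from that point\<close>

text \<open>
  The value at $(t,s)$ of the binary form of degree $n$ whose dehomogenization at $s = 1$ is $G$.  The
  coefficients of $G$ beyond $n$ are ignored, so $G$ is meant to have degree at most $n$.
\<close>

definition bin_form :: "nat \<Rightarrow> complex poly \<Rightarrow> complex \<Rightarrow> complex \<Rightarrow> complex" where
  "bin_form n G t s = (\<Sum>i\<le>n. coeff G i * t ^ i * s ^ (n - i))"

lemma bin_form_0 [simp]: "bin_form n 0 t s = 0"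
  by (simp add: bin_form_def)

lemma bin_form_add: "bin_form n (G + H) t s = bin_form n G t s + bin_form n H t s"
  by (simp add: bin_form_def algebra_simps sum.distrib)

lemma bin_form_smult: "bin_form n (smult c G) t s = c * bin_form n G t s"
  by (simp add: bin_form_def sum_distrib_left mult_ac)

lemma bin_form_diff: "bin_form n (G - H) t s = bin_form n G t s - bin_form n H t s"
  by (simp add: bin_form_def left_diff_distrib sum_subtractf)

lemma poly_eq_sum_le:
  fixes G :: "'a::comm_semiring_1 poly"
  assumes "degree G \<le> n"
  shows "poly G x = (\<Sum>i\<le>n. coeff G i * x ^ i)"
proof -
  have "(\<Sum>i\<le>degree G. coeff G i * x ^ i) = (\<Sum>i\<le>n. coeff G i * x ^ i)"
    using assms by (intro sum.mono_neutral_left) (auto simp: coeff_eq_0)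
  then show ?thesis by (simp add: poly_altdef)
qed

lemma bin_form_eq_poly:
  assumes "s \<noteq> 0" "degree G \<le> n"
  shows "bin_form n G t s = s ^ n * poly G (t / s)"
  unfolding bin_form_def poly_eq_sum_le[OF assms(2)] sum_distrib_left
proof (intro sum.cong refl)
  fix i assume "i \<in> {..n}"
  then have "s ^ n = s ^ i * s ^ (n - i)" by (simp flip: power_add)
  then show "coeff G i * t ^ i * s ^ (n - i) = s ^ n * (coeff G i * (t / s) ^ i)"
    using assms(1) by (simp add: power_divide)
qed

lemma bin_form_at_infinity: "bin_form n G t 0 = coeff G n * t ^ n"
proof -
  have "bin_form n G t 0 = (\<Sum>i\<le>n. if i = n then coeff G n * t ^ n else 0)"
    unfolding bin_form_def by (intro sum.cong) auto
  then show ?thesis by simp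
qed

lemma bin_form_linear_mult:
  assumes "degree G \<le> n"
  shows "bin_form (Suc n) ([:b, a:] * G) t s = (a * t + b * s) * bin_form n G t s"
proof (cases "s = 0")
  case True
  have "coeff ([:b, a:] * G) (Suc n) = a * coeff G n"
    using assms by (simp add: coeff_eq_0)
  then show ?thesis by (simp add: True bin_form_at_infinity)
next
  case False
  have "degree ([:b, a:] * G) \<le> Suc n"
    by (rule order.trans[OF degree_mult_le]) (use assms in auto)
  then show ?thesis using assms False
    by (simp only: bin_form_eq_poly[OF False]) (simp add: field_simps)
qed

lemma bin_form_Suc: "degree G \<le> n \<Longrightarrow> bin_form (Suc n) G t s = s * bin_form n G t s"
  using bin_form_linear_mult[of G n 1 0 t s] by simp

lemma bin_form_add_degree:
  assumes "degree G \<le> n"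
  shows "bin_form (n + k) G t s = s ^ k * bin_form n G t s"
proof (induction k)
  case (Suc k)
  have "degree G \<le> n + k" using assms by simp
  then show ?case by (simp add: bin_form_Suc Suc)
qed simp

lemma bin_form_pCons_0: "degree G \<le> n \<Longrightarrow> bin_form (Suc n) (pCons 0 G) t s = t * bin_form n G t s"
  using bin_form_linear_mult[of G n 0 1 t s] by simp

lemma bin_form_monom_mult:
  assumes "degree G \<le> n"
  shows "bin_form (k + n) (monom 1 k * G) t s = t ^ k * bin_form n G t s"
proof (induction k)
  case (Suc k)
  have "degree (monom 1 k * G) \<le> k + n"
    by (rule order.trans[OF degree_mult_le]) (use assms in \<open>auto simp: degree_monom_eq\<close>)
  moreover have "monom 1 (Suc k) * G = pCons 0 (monom 1 k * G)"
    by (simp add: monom_Suc)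
  ultimately show ?case by (simp add: bin_form_pCons_0 Suc)
qed (simp add: one_pCons[symmetric] monom_0)

text \<open>The factor is s0 t - t0 s, dehomogenized at s = 1. For a root at infinity, s0 = 0, it is
  the constant -t0, and the root shows only as a drop of the degree of \<open>G\<close>.\<close>

lemma bin_form_root_factor:
  assumes "degree G \<le> Suc n" "bin_form (Suc n) G t0 s0 = 0" "t0 \<noteq> 0 \<or> s0 \<noteq> 0"
  shows "\<exists>H. G = [:- t0, s0:] * H \<and> degree H \<le> n"
proof (cases "s0 = 0")
  case True
  then have "coeff G (Suc n) = 0" "t0 \<noteq> 0" using assms by (auto simp: bin_form_at_infinity)
  then have "degree G \<le> n" using assms(1)
    by (metis degree_0 le_SucE le_numeral_extra(3) leading_coeff_0_iff zero_le)
  then show ?thesis using True \<open>t0 \<noteq> 0\<close> by (intro exI[of _ "smult (- inverse t0) G"]) simp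
next
  case False
  then have "poly G (t0 / s0) = 0" using assms by (simp add: bin_form_eq_poly)
  then obtain K where K: "G = [:- (t0 / s0), 1:] * K" by (auto simp: poly_eq_0_iff_dvd dvd_def)
  have "degree K \<le> n"
  proof (cases "K = 0")
    case False
    then have "degree G = Suc (degree K)" unfolding K by (subst degree_mult_eq) auto
    then show ?thesis using assms(1) by simp
  qed simp
  moreover have "G = [:- t0, s0:] * smult (inverse s0) K"
    using False by (simp add: K field_simps)
  ultimately show ?thesis by (metis degree_smult_le order.trans)
qed

section \<open>Coefficients of a curve with a fat point\<close>

definition fat_index :: "nat \<Rightarrow> (nat + nat) set" where
  "fat_index j = {..j} <+> {..<j}"

text \<open>Over a general ring, because the same monomials are used with complex values and with
  polynomials in the parameters (m, c) of the center.\<close>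

definition fat_monomial :: "nat \<Rightarrow> 'a::comm_ring_1 \<Rightarrow> 'a \<Rightarrow> 'a \<Rightarrow> nat + nat \<Rightarrow> 'a" where
  "fat_monomial j t s y k =
     (case k of Inl i \<Rightarrow> t ^ i * s ^ (j - i) | Inr i \<Rightarrow> y * t ^ i * s ^ (j - 1 - i))"

lemma finite_fat_index [simp]: "finite (fat_index j)"
  by (simp add: fat_index_def)

lemma fat_index_simps [simp]: "Inl i \<in> fat_index j \<longleftrightarrow> i \<le> j" "Inr i \<in> fat_index j \<longleftrightarrow> i < j"
  by (auto simp: fat_index_def)

lemma card_fat_index: "card (fat_index j) = 2 * j + 1"
  by (simp add: fat_index_def card_Plus)

lemma sum_fat_index:
  "(\<Sum>k\<in>fat_index j. f k) = (\<Sum>i\<le>j. f (Inl i)) + (\<Sum>i<j. f (Inr i))"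
  by (simp add: fat_index_def sum.Plus)

text \<open>
  The equation of a curve of degree $j$ with multiplicity $j - 1$ at the common zero of $t$ and $s$.
  For $j = 0$ the truncated $j - 1$ is harmless, since then $N = 0$ is required in \<open>fat_curve\<close>.
\<close>

definition fat_value :: "nat \<Rightarrow> complex poly \<Rightarrow> complex poly \<Rightarrow> complex \<Rightarrow> complex \<Rightarrow> complex \<Rightarrow> complex" where
  "fat_value j U N t s y = bin_form j U t s + y * bin_form (j - 1) N t s"

definition fat_curve ::
  "'p set \<Rightarrow> ('p \<Rightarrow> complex) \<Rightarrow> ('p \<Rightarrow> complex) \<Rightarrow> ('p \<Rightarrow> complex) \<Rightarrow> nat \<Rightarrow> complex poly \<Rightarrow> complex poly \<Rightarrow> bool" where
  "fat_curve Z t s y j U N \<longleftrightarrow> degree U \<le> j \<and> (N = 0 \<or> degree N < j) \<and>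
     (\<forall>p\<in>Z. fat_value j U N (t p) (s p) (y p) = 0)"

definition no_fat_curve :: "'p set \<Rightarrow> ('p \<Rightarrow> complex) \<Rightarrow> ('p \<Rightarrow> complex) \<Rightarrow> ('p \<Rightarrow> complex) \<Rightarrow> nat \<Rightarrow> bool" where
  "no_fat_curve Z t s y j \<longleftrightarrow> (\<forall>U N. fat_curve Z t s y j U N \<longrightarrow> U = 0 \<and> N = 0)"

lemma coeff_sum_monom:
  fixes f :: "nat \<Rightarrow> 'a::comm_monoid_add"
  assumes "finite A"
  shows "coeff (\<Sum>i\<in>A. monom (f i) i) k = (if k \<in> A then f k else 0)"
  using assms by (simp add: coeff_sum)

lemma fat_value_coeffs:
  assumes "degree U \<le> j" "N = 0 \<or> degree N < j"
  shows "fat_value j U N t s y =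
    (\<Sum>k\<in>fat_index j. (case k of Inl i \<Rightarrow> coeff U i | Inr i \<Rightarrow> coeff N i) * fat_monomial j t s y k)"
proof -
  have "bin_form (j - 1) N t s = (\<Sum>i<j. coeff N i * t ^ i * s ^ (j - 1 - i))"
  proof (cases j)
    case 0
    then show ?thesis using assms by simp
  next
    case (Suc j')
    then show ?thesis by (simp add: bin_form_def lessThan_Suc_atMost)
  qed
  then show ?thesis
    by (simp add: fat_value_def sum_fat_index fat_monomial_def bin_form_def sum_distrib_left mult_ac)
qed

lemma no_fat_curve_iff:
  "no_fat_curve Z t s y j \<longleftrightarrow>
    (\<forall>w. (\<forall>p\<in>Z. (\<Sum>k\<in>fat_index j. w k * fat_monomial j (t p) (s p) (y p) k) = 0) \<longrightarrow>
         (\<forall>k\<in>fat_index j. w k = 0))"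
proof
  assume nf: "no_fat_curve Z t s y j"
  show "\<forall>w. (\<forall>p\<in>Z. (\<Sum>k\<in>fat_index j. w k * fat_monomial j (t p) (s p) (y p) k) = 0) \<longrightarrow>
         (\<forall>k\<in>fat_index j. w k = 0)"
  proof (intro allI impI ballI)
    fix w k assume w: "\<forall>p\<in>Z. (\<Sum>k\<in>fat_index j. w k * fat_monomial j (t p) (s p) (y p) k) = 0"
      and k: "k \<in> fat_index j"
    define U where "U = (\<Sum>i\<in>{..j}. monom (w (Inl i)) i)"
    define N where "N = (\<Sum>i\<in>{..<j}. monom (w (Inr i)) i)"
    have cU: "coeff U i = (if i \<le> j then w (Inl i) else 0)" for i
      unfolding U_def by (subst coeff_sum_monom) auto
    have cN: "coeff N i = (if i < j then w (Inr i) else 0)" for i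
      unfolding N_def by (subst coeff_sum_monom) auto
    have dU: "degree U \<le> j" by (rule degree_le) (simp add: cU)
    have dN: "N = 0 \<or> degree N < j"
    proof (cases j)
      case 0
      then show ?thesis by (simp add: N_def)
    next
      case (Suc j')
      then have "degree N \<le> j'" by (intro degree_le) (simp add: cN)
      then show ?thesis using Suc by simp
    qed
    have "(\<Sum>k\<in>fat_index j. (case k of Inl i \<Rightarrow> coeff U i | Inr i \<Rightarrow> coeff N i) * fat_monomial j t' s' y' k)
        = (\<Sum>k\<in>fat_index j. w k * fat_monomial j t' s' y' k)" for t' s' y'
      by (intro sum.cong) (auto simp: fat_index_def cU cN)
    then have "fat_curve Z t s y j U N"
      using w dU dN by (simp add: fat_curve_def fat_value_coeffs)
    then have "U = 0" "N = 0" using nf by (auto simp: no_fat_curve_def)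
    with cU cN k show "w k = 0"
      by (auto simp: fat_index_def) (metis coeff_0, metis coeff_0)
  qed
next
  assume R: "\<forall>w. (\<forall>p\<in>Z. (\<Sum>k\<in>fat_index j. w k * fat_monomial j (t p) (s p) (y p) k) = 0) \<longrightarrow>
         (\<forall>k\<in>fat_index j. w k = 0)"
  show "no_fat_curve Z t s y j" unfolding no_fat_curve_def
  proof (intro allI impI)
    fix U N assume f: "fat_curve Z t s y j U N"
    let ?w = "\<lambda>k. case k of Inl i \<Rightarrow> coeff U i | Inr i \<Rightarrow> coeff N i"
    have d: "degree U \<le> j" "N = 0 \<or> degree N < j" and
      v: "\<forall>p\<in>Z. fat_value j U N (t p) (s p) (y p) = 0" using f by (auto simp: fat_curve_def)
    have w0: "\<forall>k\<in>fat_index j. ?w k = 0"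
      using R[THEN spec, of ?w] v unfolding fat_value_coeffs[OF d] by blast
    have "\<forall>i\<le>j. coeff U i = 0" "\<forall>i<j. coeff N i = 0"
      using w0[rule_format, of "Inl _"] w0[rule_format, of "Inr _"] by auto
    then have U: "\<And>i. i \<le> j \<Longrightarrow> coeff U i = 0" and N: "\<And>i. i < j \<Longrightarrow> coeff N i = 0"
      by auto
    have "U = 0" using f U[of "degree U"] by (auto simp: fat_curve_def)
    moreover have "N = 0" using f N[of "degree N"] by (auto simp: fat_curve_def)
    ultimately show "U = 0 \<and> N = 0" by simp
  qed
qed

text \<open>There are 2j + 1 coefficients and one linear condition for each point. At j = a this
  gives 2a + 1 \<le> d, that is a \<le> b.\<close>

lemma no_fat_curve_card:
  assumes "finite Z" "no_fat_curve Z t s y j"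
  shows "2 * j + 1 \<le> card Z"
proof (rule ccontr)
  assume "\<not> 2 * j + 1 \<le> card Z"
  then have "card Z < card (fat_index j)" by (simp add: card_fat_index)
  from nontrivial_kernel[OF assms(1) finite_fat_index this, of "\<lambda>k p. fat_monomial j (t p) (s p) (y p) k"]
  show False using assms(2) unfolding no_fat_curve_iff by blast
qed

text \<open>The line s = 0 through the center is added to the curve; dehomogenization at s = 1 hides
  this factor, so \<open>U\<close> and \<open>N\<close> stay the same.\<close>

lemma fat_curve_Suc:
  assumes "fat_curve Z t s y j U N"
  shows "fat_curve Z t s y (Suc j) U N"
proof -
  have "fat_value (Suc j) U N t' s' y' = s' * fat_value j U N t' s' y'" for t' s' y'
  proof (cases j)
    case 0
    then show ?thesis using assms by (simp add: fat_value_def fat_curve_def bin_form_Suc)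
  next
    case (Suc j')
    then have "degree N \<le> j'" using assms by (auto simp: fat_curve_def)
    then show ?thesis using assms Suc
      by (simp add: fat_value_def fat_curve_def bin_form_Suc algebra_simps)
  qed
  then show ?thesis using assms by (auto simp: fat_curve_def)
qed

lemma no_fat_curve_mono:
  assumes "no_fat_curve Z t s y j" "i \<le> j"
  shows "no_fat_curve Z t s y i"
  using assms(2,1)
proof (induction rule: inc_induct)
  case (step n)
  then show ?case unfolding no_fat_curve_def by (meson fat_curve_Suc)
qed

section \<open>Relations between evaluations at the projected points\<close>

text \<open>(t : s) is the image under projection from the center: \<open>nonzero\<close> says that
  the center is not in \<open>Z\<close>, and \<open>inj\<close> that it lies on no line through two
  points of \<open>Z\<close>.\<close>

locale projected_points =
  fixes Z :: "'p set" and t s y :: "'p \<Rightarrow> complex"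
  assumes finite_Z: "finite Z"
    and inj: "p \<in> Z \<Longrightarrow> p' \<in> Z \<Longrightarrow> p \<noteq> p' \<Longrightarrow> t p * s p' \<noteq> t p' * s p"
    and nonzero: "p \<in> Z \<Longrightarrow> t p \<noteq> 0 \<or> s p \<noteq> 0"
begin

lemma bin_form_many_zeros:
  assumes A: "A \<subseteq> Z" "n < card A" and G: "degree G \<le> n"
    and zero: "\<And>p. p \<in> A \<Longrightarrow> bin_form n G (t p) (s p) = 0"
  shows "G = 0"
proof -
  have finA: "finite A" using A(1) finite_Z by (rule finite_subset)
  have main: "G = 0" if B: "B \<subseteq> A" "m < card B" "degree G \<le> m" "\<And>p. p \<in> B \<Longrightarrow> s p \<noteq> 0" for B m
  proof (rule ccontr)
    assume "G \<noteq> 0"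
    have injB: "inj_on (\<lambda>p. t p / s p) B"
    proof (rule inj_onI, rule ccontr)
      fix p p' assume "p \<in> B" "p' \<in> B" "t p / s p = t p' / s p'" "p \<noteq> p'"
      with inj[of p p'] A(1) B show False by (auto simp: field_simps subset_iff)
    qed
    have "(\<lambda>p. t p / s p) ` B \<subseteq> {x. poly G x = 0}"
    proof safe
      fix p assume "p \<in> B"
      then show "poly G (t p / s p) = 0"
        using zero[of p] B(1,4) bin_form_eq_poly[of "s p" G n "t p"] G by auto
    qed
    then have "card B \<le> card {x. poly G x = 0}"
      using card_image[OF injB] poly_roots_finite[OF \<open>G \<noteq> 0\<close>] card_mono by metis
    also have "\<dots> \<le> degree G" using \<open>G \<noteq> 0\<close> by (rule card_poly_roots_bound)
    finally show False using B by linarith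
  qed
  show ?thesis
  proof (cases "\<exists>p\<in>A. s p = 0")
    case False
    then show ?thesis using main[of A n] A G by auto
  next
    case True
    \<comment> \<open>By injectivity there is only one point with s = 0. The zero there removes the
      coefficient of degree \<open>n\<close>, which compensates for the loss of this point.\<close>
    then obtain p0 where p0: "p0 \<in> A" "s p0 = 0" by auto
    then have "t p0 \<noteq> 0" using nonzero A(1) by auto
    then have c: "coeff G n = 0" using zero[OF p0(1)] p0(2) by (simp add: bin_form_at_infinity)
    show ?thesis
    proof (cases n)
      case 0
      then show ?thesis using c G by (metis le_zero_eq leading_coeff_0_iff)
    next
      case (Suc m)
      then have "degree G \<le> m" using c G
        by (metis degree_0 le_SucE leading_coeff_0_iff zero_le)
      moreover have "m < card (A - {p0})" using A p0 Suc finA by (simp add: card_Diff_singleton)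
      moreover have "s p \<noteq> 0" if "p \<in> A - {p0}" for p
        using inj[of p p0] that p0 A(1) by auto
      ultimately show ?thesis using main[of "A - {p0}" m] by blast
    qed
  qed
qed

text \<open>
  Linear relations between the evaluations at the points of $Z$, on binary forms in $t, s$, on curves
  with multiplicity $j - 1$ at the center of projection, and on all forms of degree $j$.
\<close>

definition brel :: "nat \<Rightarrow> ('p \<Rightarrow> complex) \<Rightarrow> bool" where
  "brel j c \<longleftrightarrow> (\<forall>i k. i + k = j \<longrightarrow> (\<Sum>p\<in>Z. c p * (t p ^ i * s p ^ k)) = 0)"

definition fat_rel :: "nat \<Rightarrow> ('p \<Rightarrow> complex) \<Rightarrow> bool" where
  "fat_rel j c \<longleftrightarrow> brel j c \<and> (\<forall>n. j = Suc n \<longrightarrow> brel n (\<lambda>p. y p * c p))"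

definition full_rel :: "nat \<Rightarrow> ('p \<Rightarrow> complex) \<Rightarrow> bool" where
  "full_rel j c \<longleftrightarrow>
    (\<forall>i k e. i + k + e = j \<longrightarrow> (\<Sum>p\<in>Z. c p * (t p ^ i * s p ^ k * y p ^ e)) = 0)"

lemma brel_cong: "(\<And>p. p \<in> Z \<Longrightarrow> c p = c' p) \<Longrightarrow> brel j c \<longleftrightarrow> brel j c'"
  unfolding brel_def by (metis (no_types, lifting) sum.cong)

lemma fat_rel_monomial:
  "fat_rel j c \<longleftrightarrow> (\<forall>k\<in>fat_index j. (\<Sum>p\<in>Z. c p * fat_monomial j (t p) (s p) (y p) k) = 0)"
  (is "?L \<longleftrightarrow> ?R")
proof
  assume L: ?L
  show ?R
  proof
    fix k assume "k \<in> fat_index j"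
    then consider i where "k = Inl i" "i \<le> j" | i where "k = Inr i" "i < j"
      by (auto simp: fat_index_def)
    then show "(\<Sum>p\<in>Z. c p * fat_monomial j (t p) (s p) (y p) k) = 0"
    proof cases
      case 1
      then show ?thesis using L by (simp add: fat_rel_def brel_def fat_monomial_def)
    next
      case 2
      then obtain n where n: "j = Suc n" by (cases j) auto
      then have "(\<Sum>p\<in>Z. (y p * c p) * (t p ^ i * s p ^ (n - i))) = 0"
        using L 2 by (simp add: fat_rel_def brel_def)
      then show ?thesis using 2 n by (simp add: fat_monomial_def mult_ac)
    qed
  qed
next
  assume R: ?R
  show ?L unfolding fat_rel_def brel_def
  proof (intro conjI allI impI)
    fix i k assume "i + k = j"
    then show "(\<Sum>p\<in>Z. c p * (t p ^ i * s p ^ k)) = 0"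
      using R[rule_format, of "Inl i"] by (auto simp: fat_monomial_def)
  next
    fix n i k assume "j = Suc n" "i + k = n"
    then show "(\<Sum>p\<in>Z. y p * c p * (t p ^ i * s p ^ k)) = 0"
      using R[rule_format, of "Inr i"] by (auto simp: fat_monomial_def mult_ac)
  qed
qed

lemma brel_linear:
  assumes "brel (Suc j) c"
  shows "brel j (\<lambda>p. (a * t p + b * s p) * c p)"
  unfolding brel_def
proof (intro allI impI)
  fix i k assume ik: "i + k = j"
  have "(\<Sum>p\<in>Z. (a * t p + b * s p) * c p * (t p ^ i * s p ^ k)) =
     a * (\<Sum>p\<in>Z. c p * (t p ^ Suc i * s p ^ k)) + b * (\<Sum>p\<in>Z. c p * (t p ^ i * s p ^ Suc k))"
    by (simp add: sum_distrib_left sum.distrib[symmetric] algebra_simps)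
  also have "(\<Sum>p\<in>Z. c p * (t p ^ Suc i * s p ^ k)) = 0"
    using assms[unfolded brel_def, rule_format, of "Suc i" k] ik by simp
  also have "(\<Sum>p\<in>Z. c p * (t p ^ i * s p ^ Suc k)) = 0"
    using assms[unfolded brel_def, rule_format, of i "Suc k"] ik by simp
  finally show "(\<Sum>p\<in>Z. (a * t p + b * s p) * c p * (t p ^ i * s p ^ k)) = 0" by simp
qed

lemma brel_monomial_mult:
  assumes "brel (n + (i + k)) c"
  shows "brel n (\<lambda>p. t p ^ i * s p ^ k * c p)"
  unfolding brel_def
proof (intro allI impI)
  fix i' k' assume "i' + k' = n"
  then have "(i' + i) + (k' + k) = n + (i + k)" by simp
  then have "(\<Sum>p\<in>Z. c p * (t p ^ (i' + i) * s p ^ (k' + k))) = 0"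
    using assms unfolding brel_def by blast
  then show "(\<Sum>p\<in>Z. t p ^ i * s p ^ k * c p * (t p ^ i' * s p ^ k')) = 0"
    by (simp add: power_add mult_ac)
qed

lemma brel_hom_mult:
  assumes "brel (n + m) c"
  shows "brel n (\<lambda>p. bin_form m G (t p) (s p) * c p)"
  unfolding brel_def
proof (intro allI impI)
  fix i k assume ik: "i + k = n"
  have "(\<Sum>p\<in>Z. bin_form m G (t p) (s p) * c p * (t p ^ i * s p ^ k)) =
    (\<Sum>p\<in>Z. \<Sum>l\<le>m. coeff G l * (t p ^ l * s p ^ (m - l) * c p * (t p ^ i * s p ^ k)))"
    by (simp add: bin_form_def sum_distrib_right sum_distrib_left mult_ac)
  also have "\<dots> = (\<Sum>l\<le>m. coeff G l * (\<Sum>p\<in>Z. t p ^ l * s p ^ (m - l) * c p * (t p ^ i * s p ^ k)))"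
    by (subst sum.swap) (simp add: sum_distrib_left)
  also have "\<dots> = 0"
  proof (intro sum.neutral ballI)
    fix l assume "l \<in> {..m}"
    then have "n + (l + (m - l)) = n + m" by simp
    then have "brel n (\<lambda>p. t p ^ l * s p ^ (m - l) * c p)"
      using assms brel_monomial_mult[of n l "m - l" c] by simp
    then show "coeff G l * (\<Sum>p\<in>Z. t p ^ l * s p ^ (m - l) * c p * (t p ^ i * s p ^ k)) = 0"
      using ik unfolding brel_def by simp
  qed
  finally show "(\<Sum>p\<in>Z. bin_form m G (t p) (s p) * c p * (t p ^ i * s p ^ k)) = 0" .
qed

text \<open>At most j + 1 distinct points impose independent conditions on binary forms of degree
  \<open>j\<close>. Each step multiplies by the linear form vanishing at another point
  \<open>p1\<close> of the support: the degree drops by one, the support loses \<open>p1\<close> and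
  keeps \<open>p0\<close>.\<close>

lemma brel_support:
  assumes "brel j c" "p0 \<in> Z" "c p0 \<noteq> 0"
  shows "j + 2 \<le> card {p \<in> Z. c p \<noteq> 0}"
  using assms
proof (induction j arbitrary: c)
  case 0
  show ?case
  proof (rule ccontr)
    assume "\<not> ?case"
    then have "card {p \<in> Z. c p \<noteq> 0} \<le> Suc 0" by simp
    then have "{p \<in> Z. c p \<noteq> 0} \<subseteq> {p0}" using 0 finite_Z by (auto simp: card_le_Suc0_iff_eq)
    then have "(\<Sum>p\<in>Z. c p) = (\<Sum>p\<in>{p0}. c p)"
      using 0 finite_Z by (intro sum.mono_neutral_right) auto
    then show False using 0 by (auto simp: brel_def)
  qed
next
  case (Suc j)
  show ?case
  proof (cases "\<exists>p1\<in>Z. p1 \<noteq> p0 \<and> c p1 \<noteq> 0")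
    case True
    then obtain p1 where p1: "p1 \<in> Z" "p1 \<noteq> p0" "c p1 \<noteq> 0" by auto
    let ?c = "\<lambda>p. (s p1 * t p + (- t p1) * s p) * c p"
    have "?c p0 \<noteq> 0" using inj[of p0 p1] p1 Suc.prems by (auto simp: mult.commute)
    then have "j + 2 \<le> card {p \<in> Z. ?c p \<noteq> 0}"
      using Suc.IH[OF brel_linear[OF Suc.prems(1)] Suc.prems(2)] by blast
    also have "\<dots> \<le> card ({p \<in> Z. c p \<noteq> 0} - {p1})"
      using finite_Z by (intro card_mono) (auto simp: mult.commute)
    also have "\<dots> = card {p \<in> Z. c p \<noteq> 0} - 1" using p1 by (intro card_Diff_singleton) auto
    finally show ?thesis by linarith
  next
    case False
    then have "(\<Sum>p\<in>Z. c p * (t p ^ i * s p ^ k)) = (\<Sum>p\<in>{p0}. c p * (t p ^ i * s p ^ k))" for i k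
      using finite_Z Suc.prems by (intro sum.mono_neutral_right) auto
    then have eq: "(\<Sum>p\<in>Z. c p * (t p ^ i * s p ^ k)) = c p0 * (t p0 ^ i * s p0 ^ k)" for i k by simp
    have "c p0 * (t p0 ^ Suc j * s p0 ^ 0) = 0" "c p0 * (t p0 ^ 0 * s p0 ^ Suc j) = 0"
      unfolding eq[symmetric]
      using Suc.prems(1)[unfolded brel_def, rule_format, of "Suc j" 0]
        Suc.prems(1)[unfolded brel_def, rule_format, of 0 "Suc j"] by auto
    then show ?thesis using nonzero[of p0] Suc.prems by auto
  qed
qed

lemma fat_rel_monomial_mult:
  assumes "fat_rel (n + (i + k)) c"
  shows "fat_rel n (\<lambda>p. t p ^ i * s p ^ k * c p)"
  unfolding fat_rel_def
proof (intro conjI allI impI)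
  show "brel n (\<lambda>p. t p ^ i * s p ^ k * c p)"
    using assms brel_monomial_mult by (auto simp: fat_rel_def)
  fix m assume "n = Suc m"
  then have "brel (m + (i + k)) (\<lambda>p. y p * c p)" using assms by (auto simp: fat_rel_def)
  from brel_monomial_mult[OF this] show "brel m (\<lambda>p. y p * (t p ^ i * s p ^ k * c p))"
    by (simp add: mult_ac)
qed

lemma full_rel_imp_fat_rel:
  assumes "full_rel j c"
  shows "fat_rel j c"
  unfolding fat_rel_def brel_def
proof (intro conjI allI impI)
  fix i k assume "i + k = j"
  then have "i + k + 0 = j" by simp
  then show "(\<Sum>p\<in>Z. c p * (t p ^ i * s p ^ k)) = 0"
    using assms unfolding full_rel_def by fastforce
next
  fix n i k assume "j = Suc n" "i + k = n"
  then have "i + k + 1 = j" by simp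
  then have "(\<Sum>p\<in>Z. c p * (t p ^ i * s p ^ k * y p ^ 1)) = 0"
    using assms unfolding full_rel_def by blast
  then show "(\<Sum>p\<in>Z. y p * c p * (t p ^ i * s p ^ k)) = 0" by (simp add: mult_ac)
qed

lemma full_rel_mult_y:
  assumes "full_rel (Suc j) c"
  shows "full_rel j (\<lambda>p. y p * c p)"
  unfolding full_rel_def
proof (intro allI impI)
  fix i k e assume "i + k + e = j"
  then have "i + k + Suc e = Suc j" by simp
  then have "(\<Sum>p\<in>Z. c p * (t p ^ i * s p ^ k * y p ^ Suc e)) = 0"
    using assms unfolding full_rel_def by blast
  then show "(\<Sum>p\<in>Z. y p * c p * (t p ^ i * s p ^ k * y p ^ e)) = 0" by (simp add: mult_ac)
qed

text \<open>Without curves of degree \<open>a\<close> the 2a + 1 monomials are independent on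
  \<open>Z\<close>, so the relations of degree \<open>a\<close> form a space of dimension
  \<open>card Z - (2 * a + 1)\<close>, which is less than the number n + 1 of the given
  ones.\<close>

lemma fat_rel_dependent:
  assumes nf: "no_fat_curve Z t s y a" and c: "\<And>l. l \<le> n \<Longrightarrow> fat_rel a (c l)"
    and card: "card Z < n + 1 + (2 * a + 1)"
  shows "\<exists>w. (\<exists>l\<le>n. w l \<noteq> 0) \<and> (\<forall>p\<in>Z. (\<Sum>l\<le>n. w l * c l p) = 0)"
proof -
  define M where "M k p = fat_monomial a (t p) (s p) (y p) k" for k p
  obtain L \<delta> where \<delta>: "\<delta> \<noteq> 0"
    and L: "\<And>k l. k \<in> fat_index a \<Longrightarrow> l \<in> fat_index a \<Longrightarrow>
      (\<Sum>p\<in>Z. L k p * M l p) = (if k = l then \<delta> else 0)"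
  proof -
    have "\<not> (\<exists>w. (\<exists>k\<in>fat_index a. w k \<noteq> 0) \<and> (\<forall>p\<in>Z. (\<Sum>k\<in>fat_index a. w k * M k p) = 0))"
      using nf unfolding no_fat_curve_iff M_def by blast
    then show thesis
      using kernel_or_left_inverse[OF finite_fat_index[of a] finite_Z, of M] that by blast
  qed
  \<comment> \<open>The rows of \<open>L\<close> are dual to the monomials up to
    \<open>\<delta>\<close>; together with the relations they are more vectors than there are
    points. Pairing a dependency with the monomials, which the relations annihilate, shows that the
    rows of \<open>L\<close> do not take part in it.\<close>
  let ?K = "fat_index a <+> {..n}"
  define M' where "M' k p = (case k of Inl k \<Rightarrow> L k p | Inr l \<Rightarrow> c l p)" for k p
  have "card Z < card ?K" using card by (simp add: card_Plus card_fat_index)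
  from nontrivial_kernel[OF finite_Z _ this, of M'] obtain w
    where w: "\<exists>k\<in>?K. w k \<noteq> 0" "\<forall>p\<in>Z. (\<Sum>k\<in>?K. w k * M' k p) = 0" by auto
  have sum: "(\<Sum>k\<in>?K. w k * M' k p) =
      (\<Sum>k\<in>fat_index a. w (Inl k) * L k p) + (\<Sum>l\<le>n. w (Inr l) * c l p)" for p
    by (simp add: sum.Plus M'_def)
  have w0: "w (Inl k) = 0" if k: "k \<in> fat_index a" for k
  proof -
    have "0 = (\<Sum>p\<in>Z. (\<Sum>k\<in>?K. w k * M' k p) * M k p)" using w(2) by simp
    also have "\<dots> = (\<Sum>p\<in>Z. \<Sum>k'\<in>fat_index a. w (Inl k') * (L k' p * M k p)) +
        (\<Sum>p\<in>Z. \<Sum>l\<le>n. w (Inr l) * (c l p * M k p))"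
      by (simp add: sum distrib_right sum.distrib sum_distrib_right mult.assoc)
    also have "\<dots> = (\<Sum>k'\<in>fat_index a. w (Inl k') * (\<Sum>p\<in>Z. L k' p * M k p)) +
        (\<Sum>l\<le>n. w (Inr l) * (\<Sum>p\<in>Z. c l p * M k p))"
      by (subst (1 2) sum.swap) (simp add: sum_distrib_left)
    also have "(\<Sum>l\<le>n. w (Inr l) * (\<Sum>p\<in>Z. c l p * M k p)) = 0"
      using c k by (intro sum.neutral) (auto simp: fat_rel_monomial M_def)
    also have "(\<Sum>k'\<in>fat_index a. w (Inl k') * (\<Sum>p\<in>Z. L k' p * M k p)) =
        (\<Sum>k'\<in>fat_index a. if k' = k then w (Inl k') * \<delta> else 0)"
      using L k by (intro sum.cong) auto
    finally show ?thesis using \<delta> k by simp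
  qed
  then have "(\<Sum>k\<in>fat_index a. w (Inl k) * L k p) = 0" for p by (intro sum.neutral) auto
  then have "\<forall>p\<in>Z. (\<Sum>l\<le>n. w (Inr l) * c l p) = 0" using w(2) by (simp add: sum)
  moreover have "\<exists>l\<le>n. w (Inr l) \<noteq> 0" using w(1) w0 by auto
  ultimately show ?thesis by (intro exI[of _ "\<lambda>l. w (Inr l)"]) blast
qed

lemma bin_form_of_coeffs:
  "bin_form n (\<Sum>l\<in>{..n}. monom (w l) l) t' s' = (\<Sum>l\<le>n. w l * (t' ^ l * s' ^ (n - l)))"
  unfolding bin_form_def by (intro sum.cong) (auto simp: coeff_sum_monom)

lemma degree_of_coeffs: "degree (\<Sum>l\<in>{..n::nat}. monom (w l :: complex) l) \<le> n"
  by (rule degree_le) (simp add: coeff_sum_monom)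

lemma of_coeffs_nonzero: "l \<le> n \<Longrightarrow> w l \<noteq> 0 \<Longrightarrow> (\<Sum>l\<in>{..n::nat}. monom (w l :: complex) l) \<noteq> 0"
  by (metis atMost_iff coeff_0 coeff_sum_monom finite_atMost)

text \<open>The products of \<open>c\<close> with the j - a + 1 monomials of degree j - a lie in a
  space of dimension b - a. A dependency between them is a binary form of degree j - a vanishing on
  the support of \<open>c\<close>, which has at least j + 2 points.\<close>

lemma fat_rel_trivial:
  assumes nf: "no_fat_curve Z t s y a" and card: "card Z = a + b + 1" and ab: "a \<le> b" "b \<le> j"
    and c: "fat_rel j c" and p: "p \<in> Z"
  shows "c p = 0"
proof (rule ccontr)
  assume "c p \<noteq> 0"
  let ?n = "j - a"
  have "fat_rel a (\<lambda>p. t p ^ l * s p ^ (?n - l) * c p)" if "l \<le> ?n" for l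
    using that c ab by (intro fat_rel_monomial_mult) simp
  moreover have "card Z < ?n + 1 + (2 * a + 1)" using card ab by simp
  ultimately obtain w where w: "\<exists>l\<le>?n. w l \<noteq> 0"
      "\<forall>p\<in>Z. (\<Sum>l\<le>?n. w l * (t p ^ l * s p ^ (?n - l) * c p)) = 0"
    using fat_rel_dependent[OF nf, of ?n "\<lambda>l p. t p ^ l * s p ^ (?n - l) * c p"] by blast
  define G where "G = (\<Sum>l\<in>{..?n}. monom (w l) l)"
  have "bin_form ?n G (t p) (s p) * c p = 0" if "p \<in> Z" for p
    using w(2) that by (simp add: G_def bin_form_of_coeffs sum_distrib_right mult.assoc)
  moreover have "?n < card {p \<in> Z. c p \<noteq> 0}"
    using brel_support[of j c p] c p \<open>c p \<noteq> 0\<close> by (simp add: fat_rel_def)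
  moreover have "degree G \<le> ?n" unfolding G_def by (rule degree_of_coeffs)
  ultimately have "G = 0" by (intro bin_form_many_zeros[of "{p \<in> Z. c p \<noteq> 0}" ?n]) auto
  then show False using w(1) of_coeffs_nonzero unfolding G_def by blast
qed

text \<open>
  These are the weights $\prod_{p' \neq p} (t_p s_{p'} - t_{p'} s_p)^{-1}$ of the residue theorem on
  the projective line.
\<close>

lemma exists_residue_weights:
  assumes "2 \<le> card Z"
  shows "\<exists>\<pi>. brel (card Z - 2) \<pi> \<and> (\<forall>p\<in>Z. \<pi> p \<noteq> 0)"
proof -
  let ?n = "card Z - 2"
  have "card {..?n} < card Z" using assms by simp
  from nontrivial_kernel[OF _ finite_Z this, of "\<lambda>p i. t p ^ i * s p ^ (?n - i)"] obtain \<pi>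
    where \<pi>: "\<exists>p\<in>Z. \<pi> p \<noteq> 0" "\<forall>i\<le>?n. (\<Sum>p\<in>Z. \<pi> p * (t p ^ i * s p ^ (?n - i))) = 0" by auto
  have b: "brel ?n \<pi>" unfolding brel_def
  proof (intro allI impI)
    fix i k assume "i + k = ?n"
    then have "i \<le> ?n" "k = ?n - i" by auto
    then show "(\<Sum>p\<in>Z. \<pi> p * (t p ^ i * s p ^ k)) = 0" using \<pi>(2) by blast
  qed
  obtain p where "p \<in> Z" "\<pi> p \<noteq> 0" using \<pi>(1) by blast
  \<comment> \<open>With d points, a nonzero relation of degree d - 2 needs all of them as its
    support.\<close>
  then have "card Z \<le> card {p \<in> Z. \<pi> p \<noteq> 0}" using brel_support[OF b] assms by fastforce
  then have "{p \<in> Z. \<pi> p \<noteq> 0} = Z" using finite_Z by (intro card_seteq) auto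
  then show ?thesis using b by blast
qed

text \<open>
  Otherwise, with $w$ a relation of degree $b - 1$ obtained from the residue weights, each product
  $y t^k s^{n-1-k} w$ is a relation of degree $a$, hence of the form $G_k(t,s) w$ by
  \<open>fat_rel_dependent\<close>.  Comparing consecutive $k$ shows that $y$ is a linear form in $t, s$ on
  the support of $w$.
\<close>

lemma fat_rel_not_full_rel:
  assumes nf: "no_fat_curve Z t s y a" and card: "card Z = a + b + 1"
    and UN: "fat_curve Z t s y (Suc a) U N" "U \<noteq> 0 \<or> N \<noteq> 0"
    and j: "a < j" "j < b"
    and line: "\<And>l1 l2. card {p \<in> Z. y p = l1 * t p + l2 * s p} \<le> a + 1"
  shows "\<exists>c. fat_rel j c \<and> \<not> full_rel j c"
proof (rule ccontr)
  assume "\<nexists>c. fat_rel j c \<and> \<not> full_rel j c"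
  then have full: "fat_rel j c \<Longrightarrow> full_rel j c" for c by blast
  have dU: "degree U \<le> Suc a" and dN: "degree N \<le> a"
    and val: "\<And>p. p \<in> Z \<Longrightarrow> bin_form (Suc a) U (t p) (s p) + y p * bin_form a N (t p) (s p) = 0"
    using UN(1) by (auto simp: fat_curve_def fat_value_def)
  have "2 \<le> card Z" using card j by simp
  then obtain \<pi> where "brel (card Z - 2) \<pi>" "\<forall>p\<in>Z. \<pi> p \<noteq> 0"
    using exists_residue_weights by blast
  then have \<pi>: "brel (a + b - 1) \<pi>" "\<forall>p\<in>Z. \<pi> p \<noteq> 0" by (simp_all add: card)
  \<comment> \<open>Multiplication by N, of degree a, lowers the degree from a + b - 1 to b - 1. On
    \<open>Z\<close> the curve gives y N = -U, of degree a + 1, so y w is a relation too, of degree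
    b - 2.\<close>
  define w where "w p = bin_form a N (t p) (s p) * \<pi> p" for p
  have "fat_rel (b - 1) w" unfolding fat_rel_def
  proof (intro conjI allI impI)
    have "b - 1 + a = a + b - 1" using j by simp
    then show "brel (b - 1) w" unfolding w_def by (intro brel_hom_mult) (use \<pi> in simp)
    fix n assume n: "b - 1 = Suc n"
    then have "n + Suc a = a + b - 1" by simp
    then have "brel n (\<lambda>p. bin_form (Suc a) (- U) (t p) (s p) * \<pi> p)"
      by (intro brel_hom_mult) (use \<pi> in simp)
    moreover have "bin_form (Suc a) (- U) (t p) (s p) * \<pi> p = y p * w p" if "p \<in> Z" for p
      using val[OF that] by (simp add: w_def bin_form_def sum_negf add_eq_0_iff)
    ultimately show "brel n (\<lambda>p. y p * w p)" using brel_cong by (metis (no_types, lifting))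
  qed
  have "\<exists>p\<in>Z. w p \<noteq> 0"
  proof (rule ccontr)
    assume "\<not> ?thesis"
    then have N0: "bin_form a N (t p) (s p) = 0" if "p \<in> Z" for p using \<pi> that by (auto simp: w_def)
    then have "N = 0" using card j dN by (intro bin_form_many_zeros[of Z a]) auto
    moreover have "U = 0" using card j dU N0 val by (intro bin_form_many_zeros[of Z "Suc a"]) auto
    ultimately show False using UN(2) by simp
  qed
  define D where "D = {p \<in> Z. w p \<noteq> 0}"
  have D: "D \<subseteq> Z" "b + 1 \<le> card D"
    using \<open>\<exists>p\<in>Z. w p \<noteq> 0\<close> \<open>fat_rel (b - 1) w\<close> brel_support[of "b - 1" w] j
    by (auto simp: D_def fat_rel_def)
  define n where "n = b - 1 - a"
  have n: "0 < n" "b = a + n + 1" using j by (auto simp: n_def)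
  have frw: "fat_rel a (\<lambda>p. t p ^ l * s p ^ (n - l) * w p)" if "l \<le> n" for l
    using that n \<open>fat_rel (b - 1) w\<close> by (intro fat_rel_monomial_mult) simp
  have fry: "fat_rel a (\<lambda>p. y p * t p ^ k * s p ^ (n - 1 - k) * w p)" if k: "k \<le> n - 1" for k
  proof -
    \<comment> \<open>The monomial is split in two: a factor of degree n1 brings w down to degree j,
      where the assumption allows multiplication by y, and the remaining factor of degree n2 leads
      from j - 1 to a.\<close>
    define n1 where "n1 = b - 1 - j"
    define n2 where "n2 = j - 1 - a"
    have n12: "n - 1 = n1 + n2" "b - 1 = j + n1" "j = Suc (a + n2)" using j n by (auto simp: n1_def n2_def)
    define k1 where "k1 = min k n1"
    define k2 where "k2 = k - k1"
    have kk: "k1 \<le> n1" "k2 \<le> n2" "k = k1 + k2" using k n12 by (auto simp: k1_def k2_def)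
    let ?c = "\<lambda>p. t p ^ k1 * s p ^ (n1 - k1) * w p"
    have "fat_rel j ?c"
      using kk n12 \<open>fat_rel (b - 1) w\<close> by (intro fat_rel_monomial_mult) simp
    then have "full_rel (Suc (a + n2)) ?c" using full n12 by simp
    then have "fat_rel (a + (k2 + (n2 - k2))) (\<lambda>p. y p * ?c p)"
      using kk full_rel_mult_y full_rel_imp_fat_rel by simp
    from fat_rel_monomial_mult[OF this]
    have "fat_rel a (\<lambda>p. t p ^ k2 * s p ^ (n2 - k2) * (y p * ?c p))" .
    moreover have "n - 1 - k = (n2 - k2) + (n1 - k1)" using kk n12 by simp
    then have "s p ^ (n - 1 - k) = s p ^ (n2 - k2) * s p ^ (n1 - k1)" for p
      by (simp only: power_add)
    then have "(\<lambda>p. y p * t p ^ k * s p ^ (n - 1 - k) * w p) =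
        (\<lambda>p. t p ^ k2 * s p ^ (n2 - k2) * (y p * ?c p))"
      by (intro ext) (simp only: kk(3) power_add mult_ac)
    ultimately show ?thesis by simp
  qed
  have "\<exists>G. degree G \<le> n \<and> (\<forall>p\<in>D. y p * t p ^ k * s p ^ (n - 1 - k) = bin_form n G (t p) (s p))"
    if k: "k \<le> n - 1" for k
  proof -
    define c where "c l p = (if l \<le> n then t p ^ l * s p ^ (n - l) * w p
       else y p * t p ^ k * s p ^ (n - 1 - k) * w p)" for l p
    have cn: "fat_rel a (c l)" if "l \<le> Suc n" for l
    proof (cases "l \<le> n")
      case True
      then have "c l = (\<lambda>p. t p ^ l * s p ^ (n - l) * w p)" by (simp add: c_def fun_eq_iff)
      then show ?thesis using frw[OF True] by simp
    next
      case False
      then have "c l = (\<lambda>p. y p * t p ^ k * s p ^ (n - 1 - k) * w p)" by (simp add: c_def fun_eq_iff)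
      then show ?thesis using fry[OF k] by simp
    qed
    \<comment> \<open>The relations of degree a have dimension b - a = n + 1, and \<open>c\<close>
      lists n + 2 of them.\<close>
    have "card Z < Suc n + 1 + (2 * a + 1)" using card n by simp
    from fat_rel_dependent[of a "Suc n" c, OF nf cn this] obtain v
      where v: "\<exists>l\<le>Suc n. v l \<noteq> 0" "\<forall>p\<in>Z. (\<Sum>l\<le>Suc n. v l * c l p) = 0" by blast
    define G where "G = (\<Sum>l\<in>{..n}. monom (v l) l)"
    have G: "degree G \<le> n" unfolding G_def by (rule degree_of_coeffs)
    have eq: "bin_form n G (t p) (s p) + v (Suc n) * (y p * t p ^ k * s p ^ (n - 1 - k)) = 0"
      if p: "p \<in> D" for p
    proof -
      have 1: "(\<Sum>l\<le>n. v l * c l p) = bin_form n G (t p) (s p) * w p"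
        unfolding G_def bin_form_of_coeffs sum_distrib_right
        by (intro sum.cong) (auto simp: c_def mult.assoc)
      have 2: "(\<Sum>l\<le>n. v l * c l p) + v (Suc n) * c (Suc n) p = 0" using v(2) p D(1) by auto
      have "c (Suc n) p = y p * t p ^ k * s p ^ (n - 1 - k) * w p" by (simp add: c_def)
      then have "(bin_form n G (t p) (s p) + v (Suc n) * (y p * t p ^ k * s p ^ (n - 1 - k))) * w p = 0"
        using 2 unfolding 1 by (simp only: distrib_right mult.assoc)
      then show ?thesis using p by (simp add: D_def)
    qed
    \<comment> \<open>Otherwise \<open>G\<close>, of degree at most n, would vanish at the more than
      n points of \<open>D\<close>.\<close>
    have "v (Suc n) \<noteq> 0"
    proof
      assume v0: "v (Suc n) = 0"
      then have "G = 0" using eq D n G by (intro bin_form_many_zeros[of D n]) auto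
      then show False using v(1) v0 of_coeffs_nonzero[of _ n v] unfolding G_def
        by (metis le_SucE)
    qed
    then have "y p * t p ^ k * s p ^ (n - 1 - k) = bin_form n (smult (- inverse (v (Suc n))) G) (t p) (s p)"
      if "p \<in> D" for p
    proof -
      have "y p * t p ^ k * s p ^ (n - 1 - k) = - inverse (v (Suc n)) * bin_form n G (t p) (s p)"
        using eq[OF that] \<open>v (Suc n) \<noteq> 0\<close> by (simp add: field_simps add_eq_0_iff)
      then show ?thesis by (simp only: bin_form_smult)
    qed
    moreover have "degree (smult (- inverse (v (Suc n))) G) \<le> n"
      using G degree_smult_le order.trans by blast
    ultimately show ?thesis by blast
  qed
  then obtain G where G: "\<And>k. k \<le> n - 1 \<Longrightarrow> degree (G k) \<le> n"
    and Gy: "\<And>k p. k \<le> n - 1 \<Longrightarrow> p \<in> D \<Longrightarrow> y p * t p ^ k * s p ^ (n - 1 - k) = bin_form n (G k) (t p) (s p)"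
    by metis
  have step: "G (Suc k) = pCons 0 (G k)" if k: "Suc k \<le> n - 1" for k
  proof -
    let ?H = "[:0, 1:] * G k - [:1:] * G (Suc k)"
    have d: "degree (G k) \<le> n" "degree (G (Suc k)) \<le> n" using G k by auto
    \<comment> \<open>The forms t G_k and s G_(k+1), of degree n + 1, agree on \<open>D\<close>,
      which has at least b + 1 = a + n + 2 points.\<close>
    have "?H = 0"
    proof (rule bin_form_many_zeros[of D "Suc n"])
      show "Suc n < card D" using D n j by simp
      have "degree (pCons 0 (G k)) \<le> Suc n" using d(1) by (simp add: degree_pCons_eq_if)
      then show "degree ?H \<le> Suc n" using d by (intro degree_diff_le) auto
      fix p assume p: "p \<in> D"
      have "n - 1 - k = Suc (n - 1 - Suc k)" using k by simp
      then have "y p * t p ^ Suc k * s p ^ (n - 1 - Suc k) * s p = t p * (y p * t p ^ k * s p ^ (n - 1 - k))"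
        by simp
      then have "bin_form n (G (Suc k)) (t p) (s p) * s p = t p * bin_form n (G k) (t p) (s p)"
        unfolding Gy[OF k p] Gy[OF Suc_leD[OF k] p] .
      moreover have "bin_form (Suc n) ?H (t p) (s p) =
          t p * bin_form n (G k) (t p) (s p) - s p * bin_form n (G (Suc k)) (t p) (s p)"
        using bin_form_pCons_0[OF d(1), of "t p" "s p"] bin_form_Suc[OF d(2), of "t p" "s p"]
        by (simp add: bin_form_def left_diff_distrib sum_subtractf)
      ultimately show "bin_form (Suc n) ?H (t p) (s p) = 0" by (simp add: mult.commute)
    qed (use D in auto)
    then show ?thesis by simp
  qed
  have Gk: "G k = monom 1 k * G 0" if "k \<le> n - 1" for k
    using that by (induction k) (simp_all add: step monom_Suc one_pCons[symmetric] monom_0)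
  \<comment> \<open>\<open>G (n - 1)\<close> is \<open>G 0\<close> times the power n - 1 of the
    variable and still has degree at most n; this makes \<open>G 0\<close> linear.\<close>
  have d0: "degree (G 0) \<le> 1"
  proof (cases "G 0 = 0")
    case False
    then have "degree (G (n - 1)) = (n - 1) + degree (G 0)"
      by (subst Gk) (auto simp: degree_mult_eq degree_monom_eq)
    then show ?thesis using G[of "n - 1"] n by simp
  qed simp
  have on_line: "y p = coeff (G 0) 1 * t p + coeff (G 0) 0 * s p" if p: "p \<in> D" for p
  proof -
    have h1: "bin_form 1 (G 0) (t p) (s p) = coeff (G 0) 1 * t p + coeff (G 0) 0 * s p"
      by (simp add: bin_form_def algebra_simps)
    have "y p * s p ^ (n - 1) = s p ^ (n - 1) * bin_form 1 (G 0) (t p) (s p)"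
      using Gy[of 0 p] bin_form_add_degree[OF d0, of "n - 1" "t p" "s p"] n p by simp
    moreover have "y p * t p ^ (n - 1) = t p ^ (n - 1) * bin_form 1 (G 0) (t p) (s p)"
      using Gy[of "n - 1" p] bin_form_monom_mult[OF d0, of "n - 1" "t p" "s p"] n p Gk[of "n - 1"] by simp
    ultimately show ?thesis using nonzero[of p] p D(1) h1 by auto
  qed
  have "card D \<le> card {p \<in> Z. y p = coeff (G 0) 1 * t p + coeff (G 0) 0 * s p}"
    using on_line D(1) finite_Z by (intro card_mono) auto
  then show False using line[of "coeff (G 0) 1" "coeff (G 0) 0"] D(2) n by simp
qed

text \<open>On the line y = l1 t + l2 s the equation is a binary form of degree a + 1 with a + 2
  zeros, so the curve is this line together with N = 0, and at most a points of \<open>Z\<close> lie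
  off the line. The relation y - (l1 t + l2 s) times \<open>c\<close>, of degree j - 1, would need j
  + 1 > a such points in its support, so it vanishes. Hence every power of y against
  \<open>c\<close> reduces to binary forms in t, s.\<close>

lemma fat_rel_imp_full_rel_on_line:
  assumes UN: "fat_curve Z t s y (Suc a) U N" "U \<noteq> 0 \<or> N \<noteq> 0"
    and j: "a < j" and line: "a + 2 \<le> card {p \<in> Z. y p = l1 * t p + l2 * s p}"
    and c: "fat_rel j c"
  shows "full_rel j c"
proof -
  define A where "A = {p \<in> Z. y p = l1 * t p + l2 * s p}"
  have A: "A \<subseteq> Z" "a + 2 \<le> card A" using line by (auto simp: A_def)
  have dU: "degree U \<le> Suc a" and dN: "degree N \<le> a"
    and val: "\<And>p. p \<in> Z \<Longrightarrow> bin_form (Suc a) U (t p) (s p) + y p * bin_form a N (t p) (s p) = 0"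
    using UN(1) by (auto simp: fat_curve_def fat_value_def)
  have homH: "bin_form (Suc a) (U + [:l2, l1:] * N) (t p) (s p) =
      bin_form (Suc a) U (t p) (s p) + (l1 * t p + l2 * s p) * bin_form a N (t p) (s p)" for p
    by (simp only: bin_form_add bin_form_linear_mult[OF dN])
  have H: "U + [:l2, l1:] * N = 0"
  proof (rule bin_form_many_zeros[of A "Suc a"])
    have "degree ([:l2, l1:] * N) \<le> Suc a"
      by (rule order.trans[OF degree_mult_le]) (use dN in auto)
    then show "degree (U + [:l2, l1:] * N) \<le> Suc a" using dU by (intro degree_add_le)
    fix p assume "p \<in> A"
    then show "bin_form (Suc a) (U + [:l2, l1:] * N) (t p) (s p) = 0"
      using val[of p] unfolding homH by (auto simp: A_def)
  qed (use A in auto)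
  then have "N \<noteq> 0" using UN(2) by auto
  have "bin_form a N (t p) (s p) = 0" if "p \<in> Z - A" for p
  proof -
    have "bin_form (Suc a) U (t p) (s p) + (l1 * t p + l2 * s p) * bin_form a N (t p) (s p) = 0"
      unfolding homH[symmetric] H by simp
    moreover have "(y p - (l1 * t p + l2 * s p)) * bin_form a N (t p) (s p) =
        (bin_form (Suc a) U (t p) (s p) + y p * bin_form a N (t p) (s p)) -
        (bin_form (Suc a) U (t p) (s p) + (l1 * t p + l2 * s p) * bin_form a N (t p) (s p))"
      by (simp add: algebra_simps)
    ultimately have "(y p - (l1 * t p + l2 * s p)) * bin_form a N (t p) (s p) = 0"
      using val[of p] that by simp
    then show ?thesis using that by (auto simp: A_def)
  qed
  then have cardZA: "card (Z - A) \<le> a"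
    using bin_form_many_zeros[of "Z - A" a N] dN \<open>N \<noteq> 0\<close> by (meson Diff_subset not_le)
  obtain n where n: "j = Suc n" using j by (cases j) auto
  let ?c = "\<lambda>p. (y p - (l1 * t p + l2 * s p)) * c p"
  have b: "brel n ?c" unfolding brel_def
  proof (intro allI impI)
    fix i k assume ik: "i + k = n"
    have "brel n (\<lambda>p. y p * c p)" "brel n (\<lambda>p. (l1 * t p + l2 * s p) * c p)"
      using c n brel_linear by (auto simp: fat_rel_def)
    then show "(\<Sum>p\<in>Z. ?c p * (t p ^ i * s p ^ k)) = 0"
      using ik by (simp add: brel_def left_diff_distrib sum_subtractf)
  qed
  have "?c p = 0" if "p \<in> Z" for p
  proof (rule ccontr)
    assume "?c p \<noteq> 0"
    then have "n + 2 \<le> card {p \<in> Z. ?c p \<noteq> 0}" using brel_support[OF b that] by blast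
    also have "\<dots> \<le> card (Z - A)" using finite_Z by (intro card_mono) (auto simp: A_def)
    finally show False using cardZA n j by simp
  qed
  then have on_line: "y p * c p = (l1 * t p + l2 * s p) * c p" if "p \<in> Z" for p
    using that by (auto simp: algebra_simps)
  have "(\<Sum>p\<in>Z. c p * (t p ^ i * s p ^ k * y p ^ e)) = 0" if "i + k + e = j" for i k e
    using that
  proof (induction e arbitrary: i k)
    case 0
    then show ?case using c by (auto simp: fat_rel_def brel_def)
  next
    case (Suc e)
    have "(\<Sum>p\<in>Z. c p * (t p ^ i * s p ^ k * y p ^ Suc e)) =
      (\<Sum>p\<in>Z. (y p * c p) * (t p ^ i * s p ^ k * y p ^ e))" by (simp add: mult_ac)
    also have "\<dots> = (\<Sum>p\<in>Z. ((l1 * t p + l2 * s p) * c p) * (t p ^ i * s p ^ k * y p ^ e))"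
      by (intro sum.cong) (simp_all add: on_line)
    also have "\<dots> = l1 * (\<Sum>p\<in>Z. c p * (t p ^ Suc i * s p ^ k * y p ^ e)) +
        l2 * (\<Sum>p\<in>Z. c p * (t p ^ i * s p ^ Suc k * y p ^ e))"
      by (simp add: sum_distrib_left sum.distrib[symmetric] algebra_simps)
    also have "\<dots> = 0" using Suc.IH[of "Suc i" k] Suc.IH[of i "Suc k"] Suc.prems by simp
    finally show ?case .
  qed
  then show ?thesis by (simp add: full_rel_def)
qed

text \<open>A common root of \<open>U\<close> and \<open>N\<close> is a line through the center
  contained in the curve. Dividing by its equation leaves a curve of degree a through the points of
  \<open>Z\<close> off that line, and by injectivity of the projection at most one point lies on
  it.\<close>

lemma fat_curve_common_root:
  assumes UN: "fat_curve Z t s y (Suc a) U N" "U \<noteq> 0 \<or> N \<noteq> 0"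
    and root: "bin_form (Suc a) U t0 s0 = 0" "bin_form a N t0 s0 = 0" "t0 \<noteq> 0 \<or> s0 \<noteq> 0"
  shows "\<not> no_fat_curve Z t s y a \<or> (\<exists>p\<in>Z. \<not> no_fat_curve (Z - {p}) t s y a)"
proof -
  have dU: "degree U \<le> Suc a" and dN: "degree N \<le> a"
    and val: "\<And>p. p \<in> Z \<Longrightarrow> bin_form (Suc a) U (t p) (s p) + y p * bin_form a N (t p) (s p) = 0"
    using UN(1) by (auto simp: fat_curve_def fat_value_def)
  obtain U' where U': "U = [:- t0, s0:] * U'" "degree U' \<le> a"
    using bin_form_root_factor[OF dU root(1,3)] by blast
  have "\<exists>N'. N = [:- t0, s0:] * N' \<and> (N' = 0 \<or> degree N' < a) \<and>
      (\<forall>t' s'. bin_form a N t' s' = (s0 * t' - t0 * s') * bin_form (a - 1) N' t' s')"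
  proof (cases a)
    case 0
    then have "N = 0" using dN root(2) by (auto simp: bin_form_def intro: poly_eqI)
       (metis le_zero_eq leading_coeff_0_iff)
    then show ?thesis by (intro exI[of _ 0]) simp
  next
    case (Suc n)
    then obtain N' where "N = [:- t0, s0:] * N'" "degree N' \<le> n"
      using bin_form_root_factor[of N n t0 s0] dN root by blast
    then show ?thesis using Suc
      by (intro exI[of _ N']) (auto simp del: mult_pCons_left simp add: bin_form_linear_mult)
  qed
  then obtain N' where N': "N = [:- t0, s0:] * N'" "N' = 0 \<or> degree N' < a"
      "\<And>t' s'. bin_form a N t' s' = (s0 * t' - t0 * s') * bin_form (a - 1) N' t' s'" by blast
  have homU: "bin_form (Suc a) U t' s' = (s0 * t' - t0 * s') * bin_form a U' t' s'" for t' s'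
    unfolding U'(1) by (subst bin_form_linear_mult[OF U'(2)]) simp
  have nz: "U' \<noteq> 0 \<or> N' \<noteq> 0" using UN(2) U'(1) N'(1) by auto
  have zero: "fat_value a U' N' (t p) (s p) (y p) = 0" if "p \<in> Z" "s0 * t p \<noteq> t0 * s p" for p
  proof -
    have "(s0 * t p - t0 * s p) * fat_value a U' N' (t p) (s p) (y p) = 0"
      using val[OF that(1)] by (simp add: homU N'(3) fat_value_def algebra_simps)
    then show ?thesis using that by simp
  qed
  show ?thesis
  proof (cases "\<exists>p\<in>Z. s0 * t p = t0 * s p")
    case False
    then have "fat_curve Z t s y a U' N'" using zero U' N' by (auto simp: fat_curve_def)
    then show ?thesis using nz by (auto simp: no_fat_curve_def)
  next
    case True
    then obtain p0 where p0: "p0 \<in> Z" "s0 * t p0 = t0 * s p0" by blast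
    have "s0 * t p \<noteq> t0 * s p" if p: "p \<in> Z - {p0}" for p
    proof
      assume *: "s0 * t p = t0 * s p"
      have "s0 * (t p * s p0 - t p0 * s p) = 0" "t0 * (t p * s p0 - t p0 * s p) = 0"
      proof -
        have "s0 * (t p * s p0 - t p0 * s p) = s p0 * (s0 * t p) - s p * (s0 * t p0)"
          by (simp add: algebra_simps)
        also have "\<dots> = s p0 * (t0 * s p) - s p * (t0 * s p0)" by (simp only: * p0(2))
        also have "\<dots> = 0" by (simp add: algebra_simps)
        finally show "s0 * (t p * s p0 - t p0 * s p) = 0" .
        have "t0 * (t p * s p0 - t p0 * s p) = t p * (t0 * s p0) - t p0 * (t0 * s p)"
          by (simp add: algebra_simps)
        also have "\<dots> = t p * (s0 * t p0) - t p0 * (s0 * t p)" by (simp only: * p0(2))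
        also have "\<dots> = 0" by (simp add: algebra_simps)
        finally show "t0 * (t p * s p0 - t p0 * s p) = 0" .
      qed
      then show False using root(3) inj[of p p0] p p0 by auto
    qed
    then have "fat_curve (Z - {p0}) t s y a U' N'" using zero U' N' by (auto simp: fat_curve_def)
    then show ?thesis using nz p0 by (auto simp: no_fat_curve_def)
  qed
qed

end

section \<open>Forms, derivatives and Taylor expansion\<close>

lemma poly_poly_eq_0:
  fixes g :: "complex poly poly"
  assumes "\<And>a b. poly (poly g [:b:]) a = 0"
  shows "g = 0"
proof (rule ccontr)
  assume "g \<noteq> 0"
  then have fin: "finite {x. poly g x = 0}" by (rule poly_roots_finite)
  have "poly g [:b:] = 0" for b
    using assms poly_all_0_iff_0[of "poly g [:b:]"] by simp
  then have "range (\<lambda>b. [:b:]) \<subseteq> {x. poly g x = 0}" by auto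
  then have "finite (range (\<lambda>b::complex. [:b:]))" using fin by (rule finite_subset)
  moreover have "inj (\<lambda>b::complex. [:b:])" by (auto intro: injI)
  ultimately show False using finite_imageD infinite_UNIV_char_0 by blast
qed

lemma eval_at_eq_0:
  assumes "\<And>v. eval_at f v = 0"
  shows "f = 0"
proof (rule ccontr)
  assume "f \<noteq> 0"
  then have fin: "finite {x. poly f x = 0}" by (rule poly_roots_finite)
  have "poly f [:[:c:]:] = 0" for c
  proof (rule poly_poly_eq_0)
    fix a b
    show "poly (poly (poly f [:[:c:]:]) [:b:]) a = 0"
      using assms[of "vector [a, b, c]"] by (simp add: eval_at_def)
  qed
  then have "range (\<lambda>c. [:[:c:]:]) \<subseteq> {x. poly f x = 0}" by auto
  then have "finite (range (\<lambda>c::complex. [:[:c:]:]))" using fin by (rule finite_subset)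
  moreover have "inj (\<lambda>c::complex. [:[:c:]:])" by (auto intro: injI)
  ultimately show False using finite_imageD infinite_UNIV_char_0 by blast
qed

lemma eval_at_diff: "eval_at (f - g) v = eval_at f v - eval_at g v"
  by (simp add: eval_at_def)

lemma eval_at_minus: "eval_at (- f) v = - eval_at f v"
  by (simp add: eval_at_def)

lemma eval_at_0: "eval_at 0 v = 0"
  by (simp add: eval_at_def)

lemma eval_at_1: "eval_at 1 v = 1"
  by (simp add: eval_at_def)

lemma eval_at_power: "eval_at (f ^ n) v = eval_at f v ^ n"
  by (induction n) (simp_all add: eval_at_mult eval_at_1)

lemma eval_at_sum: "eval_at (\<Sum>x\<in>A. f x) v = (\<Sum>x\<in>A. eval_at (f x) v)"
  by (induction A rule: infinite_finite_induct) (simp_all add: eval_at_add eval_at_0)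

lemma eval_at_prod: "eval_at (\<Prod>x\<in>A. f x) v = (\<Prod>x\<in>A. eval_at (f x) v)"
  by (induction A rule: infinite_finite_induct) (simp_all add: eval_at_mult eval_at_1)

lemmas eval_at_simps = eval_at_vars eval_at_add eval_at_mult eval_at_scale eval_at_diff
  eval_at_minus eval_at_0 eval_at_1 eval_at_power eval_at_sum eval_at_prod

lemma eval_at_ext:
  assumes "\<And>v. eval_at f v = eval_at g v"
  shows "f = g"
  using eval_at_eq_0[of "f - g"] assms by (simp add: eval_at_diff)

lemma mcoeff_ext:
  assumes "\<And>i j k. mcoeff f i j k = mcoeff g i j k"
  shows "f = g"
  using assms unfolding mcoeff_def by (intro poly_eqI) auto

lemma mcoeff_simps:
  "mcoeff 0 i j k = 0"
  "mcoeff (f + g) i j k = mcoeff f i j k + mcoeff g i j k"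
  "mcoeff (f - g) i j k = mcoeff f i j k - mcoeff g i j k"
  "mcoeff (- f) i j k = - mcoeff f i j k"
  "mcoeff (scale c f) i j k = c * mcoeff f i j k"
  by (simp_all add: mcoeff_def scale_def)

lemma mcoeff_sum: "mcoeff (\<Sum>x\<in>A. f x) i j k = (\<Sum>x\<in>A. mcoeff (f x) i j k)"
  by (induction A rule: infinite_finite_induct) (simp_all add: mcoeff_simps)

definition mono3 :: "complex \<Rightarrow> nat \<times> nat \<times> nat \<Rightarrow> S" where
  "mono3 c x = monom (monom (monom c (fst x)) (fst (snd x))) (snd (snd x))"

lemma mcoeff_mono3: "mcoeff (mono3 c x) i j k = (if x = (i, j, k) then c else 0)"
  by (cases x) (auto simp: mcoeff_def mono3_def)

lemma eval_at_mono3: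
  "eval_at (mono3 c x) v = c * v $ 1 ^ fst x * v $ 2 ^ fst (snd x) * v $ 3 ^ snd (snd x)"
proof -
  have 1: "[:[:a:]:] ^ n = [:[:a ^ n:]:]" "[:a:] ^ n = [:a ^ n:]" for a :: complex and n
    by (induction n) (simp_all add: one_pCons mult.commute)
  show ?thesis by (simp add: eval_at_def mono3_def poly_monom 1)
qed

definition exponents :: "S \<Rightarrow> (nat \<times> nat \<times> nat) set" where
  "exponents f = {(i, j, k). mcoeff f i j k \<noteq> 0}"

lemma finite_exponents: "finite (exponents f)"
proof -
  have "exponents f \<subseteq> (\<Union>k\<in>{..degree f}. \<Union>j\<in>{..degree (coeff f k)}.
      \<Union>i\<in>{..degree (coeff (coeff f k) j)}. {(i, j, k)})"
    by (auto simp: exponents_def mcoeff_def intro: le_degree) (metis coeff_0 le_degree)+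
  then show ?thesis by (rule finite_subset) auto
qed

lemma expand_monomials: "f = (\<Sum>x\<in>exponents f. mono3 (mcoeff f (fst x) (fst (snd x)) (snd (snd x))) x)"
proof (rule mcoeff_ext)
  fix i j k
  have "(\<Sum>x\<in>exponents f. mcoeff (mono3 (mcoeff f (fst x) (fst (snd x)) (snd (snd x))) x) i j k) =
      (\<Sum>x\<in>exponents f. if x = (i, j, k) then mcoeff f i j k else 0)"
    by (intro sum.cong) (auto simp: mcoeff_mono3)
  also have "\<dots> = mcoeff f i j k"
    using finite_exponents[of f] by (simp add: exponents_def)
  finally show "mcoeff f i j k =
      mcoeff (\<Sum>x\<in>exponents f. mono3 (mcoeff f (fst x) (fst (snd x)) (snd (snd x))) x) i j k"
    by (simp add: mcoeff_sum)
qed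

lemma eval_at_expand:
  "eval_at f v = (\<Sum>x\<in>exponents f. mcoeff f (fst x) (fst (snd x)) (snd (snd x)) *
      v $ 1 ^ fst x * v $ 2 ^ fst (snd x) * v $ 3 ^ snd (snd x))"
  by (subst (1) expand_monomials) (simp add: eval_at_sum eval_at_mono3)

lemma forms_exponents: "f \<in> forms n \<Longrightarrow> x \<in> exponents f \<Longrightarrow> fst x + fst (snd x) + snd (snd x) = n"
  by (auto simp: forms_def exponents_def)

lemma eval_at_form_scaled:
  assumes "f \<in> forms n"
  shows "eval_at f (t *s v) = t ^ n * eval_at f v"
  unfolding eval_at_expand[of f] sum_distrib_left
proof (intro sum.cong refl)
  fix x assume "x \<in> exponents f"
  then have "n = fst x + fst (snd x) + snd (snd x)" using forms_exponents[OF assms] by simp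
  then have "t ^ n = t ^ fst x * t ^ fst (snd x) * t ^ snd (snd x)" by (simp add: power_add)
  then show "mcoeff f (fst x) (fst (snd x)) (snd (snd x)) * (t *s v) $ 1 ^ fst x *
      (t *s v) $ 2 ^ fst (snd x) * (t *s v) $ 3 ^ snd (snd x) = t ^ n *
      (mcoeff f (fst x) (fst (snd x)) (snd (snd x)) * v $ 1 ^ fst x * v $ 2 ^ fst (snd x) *
       v $ 3 ^ snd (snd x))"
    by (simp add: power_mult_distrib mult_ac)
qed

text \<open>The substitution v -> 2v. The powers of 2 being distinct, the forms of degree n are
  exactly the eigenvectors for 2^n. As the substitution is multiplicative, products and factors of
  forms need no computation with the coefficients of a product.\<close>

definition dilate :: "S \<Rightarrow> S" where
  "dilate f = (\<Sum>x\<in>exponents f. mono3 (2 ^ (fst x + fst (snd x) + snd (snd x)) *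
      mcoeff f (fst x) (fst (snd x)) (snd (snd x))) x)"

lemma eval_at_dilate: "eval_at (dilate f) v = eval_at f (2 *s v)"
  unfolding eval_at_expand[of f "2 *s v"]
  by (simp add: dilate_def eval_at_sum eval_at_mono3 power_add power_mult_distrib mult_ac)

lemma mcoeff_dilate: "mcoeff (dilate f) i j k = 2 ^ (i + j + k) * mcoeff f i j k"
proof -
  have "mcoeff (dilate f) i j k =
      (\<Sum>x\<in>exponents f. if x = (i, j, k) then 2 ^ (i + j + k) * mcoeff f i j k else 0)"
    unfolding dilate_def mcoeff_sum by (intro sum.cong) (auto simp: mcoeff_mono3)
  also have "\<dots> = 2 ^ (i + j + k) * mcoeff f i j k"
    using finite_exponents[of f] by (simp add: exponents_def)
  finally show ?thesis .
qed

lemma forms_iff_dilate: "f \<in> forms n \<longleftrightarrow> dilate f = scale (2 ^ n) f"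
proof
  assume "f \<in> forms n"
  then show "dilate f = scale (2 ^ n) f"
    by (intro mcoeff_ext) (auto simp: mcoeff_dilate mcoeff_simps forms_def)
next
  assume eq: "dilate f = scale (2 ^ n) f"
  have "i + j + k = n" if "mcoeff f i j k \<noteq> 0" for i j k
  proof -
    have "(2::complex) ^ (i + j + k) = 2 ^ n"
      using arg_cong[OF eq, of "\<lambda>g. mcoeff g i j k"] that by (simp add: mcoeff_dilate mcoeff_simps)
    then have "(of_nat (2 ^ (i + j + k)) :: complex) = of_nat (2 ^ n)" by simp
    then have "(2::nat) ^ (i + j + k) = 2 ^ n" by (simp only: of_nat_eq_iff)
    then show ?thesis by (metis power_inject_exp one_less_numeral_iff semiring_norm(76))
  qed
  then show "f \<in> forms n" by (auto simp: forms_def)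
qed

lemma dilate_mult: "dilate (f * g) = dilate f * dilate g"
  by (rule eval_at_ext) (simp add: eval_at_dilate eval_at_simps)

lemma forms_mult:
  assumes "f \<in> forms m" "g \<in> forms n"
  shows "f * g \<in> forms (m + n)"
proof -
  have "dilate (f * g) = scale (2 ^ m) f * scale (2 ^ n) g"
    using assms by (simp add: forms_iff_dilate dilate_mult)
  also have "\<dots> = scale (2 ^ (m + n)) (f * g)"
    by (rule eval_at_ext) (simp add: eval_at_simps power_add)
  finally show ?thesis by (simp add: forms_iff_dilate)
qed

lemma forms_0 [simp]: "0 \<in> forms n"
  by (simp add: forms_def mcoeff_simps)

lemma forms_add: "f \<in> forms n \<Longrightarrow> g \<in> forms n \<Longrightarrow> f + g \<in> forms n"
  by (auto simp: forms_def mcoeff_simps) (metis add_0)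

lemma forms_scale: "f \<in> forms n \<Longrightarrow> scale c f \<in> forms n"
  by (auto simp: forms_def mcoeff_simps)

lemma forms_minus: "f \<in> forms n \<Longrightarrow> - f \<in> forms n"
  by (auto simp: forms_def mcoeff_simps)

lemma forms_diff: "f \<in> forms n \<Longrightarrow> g \<in> forms n \<Longrightarrow> f - g \<in> forms n"
  using forms_add[of f n "- g"] forms_minus by simp

lemma forms_sum: "(\<And>x. x \<in> A \<Longrightarrow> f x \<in> forms n) \<Longrightarrow> (\<Sum>x\<in>A. f x) \<in> forms n"
  by (induction A rule: infinite_finite_induct) (auto intro: forms_add)

lemma forms_1: "1 \<in> forms 0"
  unfolding forms_iff_dilate by (rule eval_at_ext) (simp add: eval_at_dilate eval_at_simps)

lemma forms_vars: "var_x \<in> forms 1" "var_y \<in> forms 1" "var_z \<in> forms 1"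
  by (auto simp: forms_def mcoeff_var_x mcoeff_var_y mcoeff_var_z split: if_splits)

lemma forms_power: "f \<in> forms m \<Longrightarrow> f ^ n \<in> forms (n * m)"
  by (induction n) (auto intro: forms_1 forms_mult)

lemma forms_linear_power: "f \<in> forms 1 \<Longrightarrow> f ^ n \<in> forms n"
  using forms_power[of f 1 n] by simp

lemma forms_prod:
  assumes "finite A" "\<And>x. x \<in> A \<Longrightarrow> f x \<in> forms 1"
  shows "(\<Prod>x\<in>A. f x) \<in> forms (card A)"
  using assms
proof (induction A rule: finite_induct)
  case empty
  then show ?case by (simp add: forms_1)
next
  case (insert x A)
  then show ?case using forms_mult[of "f x" 1 "prod f A" "card A"] by simp
qed

text \<open>Dilation sends \<open>l\<close> to 2 l, and the nonzero \<open>l\<close> cancels from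
  the eigenvector equation of \<open>l * g\<close>.\<close>

lemma forms_factor:
  assumes "l * g \<in> forms (Suc n)" "l \<in> forms 1" "l \<noteq> 0"
  shows "g \<in> forms n"
proof -
  have "l * (scale 2 (dilate g)) = dilate (l * g)"
    using assms(2) by (simp add: dilate_mult forms_iff_dilate scale_def)
  also have "\<dots> = scale (2 ^ Suc n) (l * g)" using assms(1) by (simp add: forms_iff_dilate)
  also have "\<dots> = l * scale (2 ^ Suc n) g" by (simp add: scale_def)
  finally have "scale 2 (dilate g) = scale (2 ^ Suc n) g" using assms(3) by simp
  then have "scale (inverse 2) (scale 2 (dilate g)) = scale (inverse 2) (scale (2 ^ Suc n) g)" by simp
  then have "dilate g = scale (2 ^ n) g"
    by (intro mcoeff_ext) (metis (no_types, lifting) mcoeff_simps(5) mult.assoc mult.left_neutral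
        left_inverse power_Suc zero_neq_numeral)
  then show ?thesis by (simp add: forms_iff_dilate)
qed

lemma line_polynomial: "\<exists>P. \<forall>e. eval_at f (v + e *s w) = poly P e"
proof -
  let ?P = "\<Sum>x\<in>exponents f. smult (mcoeff f (fst x) (fst (snd x)) (snd (snd x)))
      ([:v $ 1, w $ 1:] ^ fst x * [:v $ 2, w $ 2:] ^ fst (snd x) * [:v $ 3, w $ 3:] ^ snd (snd x))"
  have "eval_at f (v + e *s w) = poly ?P e" for e
    unfolding eval_at_expand[of f] poly_sum by (simp add: mult_ac)
  then show ?thesis by blast
qed

text \<open>Zariski density on a line: it carries a vanishing statement to points that a
  nonvanishing condition has excluded.\<close>

lemma eval_at_0_by_density:
  assumes "finite F" "\<And>e. e \<notin> F \<Longrightarrow> eval_at f (v + e *s w) = 0"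
  shows "eval_at f v = 0"
proof -
  obtain P where P: "\<And>e. eval_at f (v + e *s w) = poly P e" using line_polynomial by blast
  have "P = 0"
  proof (rule ccontr)
    assume "P \<noteq> 0"
    then have "finite ({e. poly P e = 0} \<union> F)" using assms(1) poly_roots_finite by auto
    moreover have "{e. poly P e = 0} \<union> F = UNIV" using assms(2) P by auto
    ultimately show False using infinite_UNIV_char_0 by metis
  qed
  then show ?thesis using P[of 0] by simp
qed

lemma finite_zeros_on_line:
  assumes "eval_at f (v + e0 *s w) \<noteq> 0"
  shows "finite {e. eval_at f (v + e *s w) = 0}"
proof -
  obtain P where P: "\<And>e. eval_at f (v + e *s w) = poly P e" using line_polynomial by blast
  then have "P \<noteq> 0" using assms by auto
  then show ?thesis using poly_roots_finite P by simp
qed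

lemma map_poly_derivation_mult:
  fixes D :: "'a::comm_ring_1 \<Rightarrow> 'a"
  assumes add: "\<And>a b. D (a + b) = D a + D b" and mult: "\<And>a b. D (a * b) = D a * b + a * D b"
  shows "map_poly D (f * g) = map_poly D f * g + f * map_poly D g"
proof (rule poly_eqI)
  fix n
  have D0: "D 0 = 0" using add[of 0 0] by simp
  have Dsum: "D (\<Sum>x\<in>A. h x) = (\<Sum>x\<in>A. D (h x))" for h :: "nat \<Rightarrow> 'a" and A
    by (induction A rule: infinite_finite_induct) (simp_all add: D0 add)
  show "coeff (map_poly D (f * g)) n = coeff (map_poly D f * g + f * map_poly D g) n"
    by (simp add: coeff_map_poly D0 coeff_mult Dsum mult sum.distrib)
qed

lemma map_poly_pderiv_add: "map_poly pderiv (f + g) = map_poly pderiv f + map_poly pderiv g"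
  for f g :: "complex poly poly"
  by (rule poly_eqI) (simp add: coeff_map_poly pderiv_add)

lemma deriv_mult:
  "deriv_x (f * g) = deriv_x f * g + f * deriv_x g"
  "deriv_y (f * g) = deriv_y f * g + f * deriv_y g"
  "deriv_z (f * g) = deriv_z f * g + f * deriv_z g"
proof -
  have 1: "pderiv (a * b) = pderiv a * b + a * pderiv b" for a b :: "'a::idom poly"
    by (simp add: pderiv_mult mult.commute)
  have 2: "map_poly pderiv (a * b) = map_poly pderiv a * b + a * map_poly pderiv b"
    for a b :: "'a::idom poly poly"
    by (rule map_poly_derivation_mult) (simp_all add: pderiv_add 1)
  show "deriv_x (f * g) = deriv_x f * g + f * deriv_x g" unfolding deriv_x_def
    by (rule map_poly_derivation_mult) (simp_all add: map_poly_pderiv_add 2)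
  show "deriv_y (f * g) = deriv_y f * g + f * deriv_y g" unfolding deriv_y_def by (rule 2)
  show "deriv_z (f * g) = deriv_z f * g + f * deriv_z g" unfolding deriv_z_def by (rule 1)
qed

lemma deriv_linear:
  "deriv_x (f + g) = deriv_x f + deriv_x g" "deriv_y (f + g) = deriv_y f + deriv_y g"
  "deriv_z (f + g) = deriv_z f + deriv_z g"
  "deriv_x (scale c f) = scale c (deriv_x f)" "deriv_y (scale c f) = scale c (deriv_y f)"
  "deriv_z (scale c f) = scale c (deriv_z f)"
  "deriv_x 0 = 0" "deriv_y 0 = 0" "deriv_z 0 = 0"
  by (rule mcoeff_ext, simp add: mcoeff_deriv_x mcoeff_deriv_y mcoeff_deriv_z mcoeff_simps
        algebra_simps)+

lemma deriv_vars:
  "deriv_x var_x = 1" "deriv_x var_y = 0" "deriv_x var_z = 0"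
  "deriv_y var_x = 0" "deriv_y var_y = 1" "deriv_y var_z = 0"
  "deriv_z var_x = 0" "deriv_z var_y = 0" "deriv_z var_z = 1"
  by (simp_all add: deriv_x_def deriv_y_def deriv_z_def var_x_def var_y_def var_z_def
      map_poly_pCons pderiv_pCons one_pCons)

lemma deriv_1: "deriv_x 1 = 0" "deriv_y 1 = 0" "deriv_z 1 = 0"
  by (simp_all add: deriv_x_def deriv_y_def deriv_z_def one_pCons map_poly_pCons)

lemma deriv_commute:
  "deriv_x (deriv_y f) = deriv_y (deriv_x f)" "deriv_x (deriv_z f) = deriv_z (deriv_x f)"
  "deriv_y (deriv_z f) = deriv_z (deriv_y f)"
  by (rule mcoeff_ext, simp add: mcoeff_deriv_x mcoeff_deriv_y mcoeff_deriv_z mult.left_commute)+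

lemma forms_deriv:
  assumes "f \<in> forms n"
  shows "deriv_x f \<in> forms (n - 1)" "deriv_y f \<in> forms (n - 1)" "deriv_z f \<in> forms (n - 1)"
  using assms by (fastforce simp: forms_def mcoeff_deriv_x mcoeff_deriv_y mcoeff_deriv_z)+

lemma forms_0_deriv: "f \<in> forms 0 \<Longrightarrow> deriv_x f = 0" "f \<in> forms 0 \<Longrightarrow> deriv_z f = 0"
  by (rule mcoeff_ext, force simp: forms_def mcoeff_deriv_x mcoeff_deriv_z mcoeff_simps)+

lemma forms_higher_deriv_z: "f \<in> forms n \<Longrightarrow> (deriv_z ^^ k) f \<in> forms (n - k)"
proof (induction k)
  case (Suc k)
  then show ?case using forms_deriv(3)[of "(deriv_z ^^ k) f" "n - k"] by simp
qed simp

lemma forms_higher_deriv_x: "f \<in> forms n \<Longrightarrow> (deriv_x ^^ k) f \<in> forms (n - k)"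
proof (induction k)
  case (Suc k)
  then show ?case using forms_deriv(1)[of "(deriv_x ^^ k) f" "n - k"] by simp
qed simp

lemma higher_deriv_0: "(deriv_x ^^ k) 0 = 0" "(deriv_y ^^ k) 0 = 0" "(deriv_z ^^ k) 0 = 0"
  by (induction k) (simp_all add: deriv_linear)

lemma higher_deriv_eq_0:
  assumes "f \<in> forms n" "n < k"
  shows "(deriv_x ^^ k) f = 0" "(deriv_z ^^ k) f = 0"
proof -
  obtain l where k: "k = l + Suc n" using assms(2) by (metis Suc_leI le_add_diff_inverse2)
  have "(deriv_x ^^ n) f \<in> forms 0" "(deriv_z ^^ n) f \<in> forms 0"
    using forms_higher_deriv_x[OF assms(1), of n] forms_higher_deriv_z[OF assms(1), of n] by simp_all
  then have "(deriv_x ^^ Suc n) f = 0" "(deriv_z ^^ Suc n) f = 0" by (simp_all add: forms_0_deriv)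
  then show "(deriv_x ^^ k) f = 0" "(deriv_z ^^ k) f = 0"
    unfolding k funpow_add by (simp_all add: higher_deriv_0 del: funpow.simps)
qed

section \<open>Taylor expansion in x and z\<close>

lemma taylor_poly:
  fixes p :: "complex poly"
  assumes "\<And>i. n < i \<Longrightarrow> (pderiv ^^ i) p = 0"
  shows "poly p (a + h) = (\<Sum>i\<le>n. poly ((pderiv ^^ i) p) a / fact i * h ^ i)"
proof -
  define q where "q = pcompose p [:a, 1:]"
  have der: "(pderiv ^^ i) q = pcompose ((pderiv ^^ i) p) [:a, 1:]" for i
    by (induction i) (simp_all add: q_def pderiv_pcompose pderiv_pCons)
  have c: "coeff q i = poly ((pderiv ^^ i) p) a / fact i" for i
  proof -
    have "coeff ((pderiv ^^ i) q) 0 = fact i * coeff q i"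
      by (simp add: coeff_higher_pderiv pochhammer_fact)
    moreover have "coeff ((pderiv ^^ i) q) 0 = poly ((pderiv ^^ i) p) a"
      unfolding der poly_0_coeff_0[symmetric] by (simp add: poly_pcompose)
    ultimately show ?thesis by simp
  qed
  have "degree q \<le> n" by (rule degree_le) (simp add: c assms)
  then have "poly q h = (\<Sum>i\<le>n. coeff q i * h ^ i)" by (rule poly_eq_sum_le)
  then show ?thesis by (simp add: q_def poly_pcompose c[unfolded q_def])
qed

definition slice_x :: "S \<Rightarrow> complex \<Rightarrow> complex \<Rightarrow> complex poly" where
  "slice_x f b c = poly (poly f [:[:c:]:]) [:b:]"

definition slice_z :: "S \<Rightarrow> complex \<Rightarrow> complex \<Rightarrow> complex poly" where
  "slice_z f a b = map_poly (\<lambda>h. poly (poly h [:b:]) a) f"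

lemma slice_0: "slice_x 0 b c = 0" "slice_z 0 a b = 0"
  by (simp_all add: slice_x_def slice_z_def)

lemma poly_slice_x: "poly (slice_x f b c) a = eval_at f (vector [a, b, c])"
  by (simp add: slice_x_def eval_at_def)

lemma poly_slice_z: "poly (slice_z f a b) c = eval_at f (vector [a, b, c])"
proof -
  have "poly (map_poly (\<lambda>h. poly (poly h [:b:]) a) f) c = poly (poly (poly f [:[:c:]:]) [:b:]) a"
    by (induction f) (simp_all add: map_poly_pCons)
  then show ?thesis by (simp add: slice_z_def eval_at_def)
qed

lemma pderiv_slice_x: "pderiv (slice_x f b c) = slice_x (deriv_x f) b c"
proof -
  have 1: "poly (map_poly pderiv g) [:b:] = pderiv (poly g [:b:])" for g :: "complex poly poly"
    by (induction g) (simp_all add: map_poly_pCons pderiv_add pderiv_smult)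
  have 2: "map_poly pderiv (smult [:c:] g) = smult [:c:] (map_poly pderiv g)" for g :: "complex poly poly"
    by (rule poly_eqI) (simp add: coeff_map_poly pderiv_smult)
  have "poly (map_poly (map_poly pderiv) f) [:[:c:]:] = map_poly pderiv (poly f [:[:c:]:])"
    by (induction f) (simp_all add: map_poly_pCons map_poly_pderiv_add 2)
  then show ?thesis by (simp add: slice_x_def deriv_x_def 1)
qed

lemma pderiv_slice_z: "pderiv (slice_z f a b) = slice_z (deriv_z f) a b"
  unfolding slice_z_def deriv_z_def
  by (rule poly_eqI) (simp add: coeff_map_poly coeff_pderiv of_nat_poly del: of_nat_Suc)

lemma higher_pderiv_slice:
  "(pderiv ^^ i) (slice_x f b c) = slice_x ((deriv_x ^^ i) f) b c"
  "(pderiv ^^ i) (slice_z f a b) = slice_z ((deriv_z ^^ i) f) a b"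
  by (induction i) (simp_all add: pderiv_slice_x pderiv_slice_z)

text \<open>The centers have y \<noteq> 0, so x and z serve as local coordinates and y is kept
  fixed. Derivatives of order beyond the degree vanish, whence the finite ranges.\<close>

lemma taylor_xz:
  assumes "f \<in> forms n"
  shows "eval_at f (vector [a1 + h1, b, a3 + h3]) =
    (\<Sum>k\<le>n. \<Sum>i\<le>n. eval_at ((deriv_x ^^ i) ((deriv_z ^^ k) f)) (vector [a1, b, a3]) /
        (fact i * fact k) * h1 ^ i * h3 ^ k)"
proof -
  have "eval_at f (vector [a1 + h1, b, a3 + h3]) =
      (\<Sum>k\<le>n. poly ((pderiv ^^ k) (slice_z f (a1 + h1) b)) a3 / fact k * h3 ^ k)"
    unfolding poly_slice_z[symmetric]
    by (rule taylor_poly) (simp add: higher_pderiv_slice higher_deriv_eq_0[OF assms] slice_0)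
  also have "\<dots> = (\<Sum>k\<le>n. eval_at ((deriv_z ^^ k) f) (vector [a1 + h1, b, a3]) / fact k * h3 ^ k)"
    by (simp add: higher_pderiv_slice poly_slice_z)
  also have "\<dots> = (\<Sum>k\<le>n. (\<Sum>i\<le>n. eval_at ((deriv_x ^^ i) ((deriv_z ^^ k) f)) (vector [a1, b, a3]) /
        fact i * h1 ^ i) / fact k * h3 ^ k)"
  proof (intro sum.cong refl)
    fix k
    let ?g = "(deriv_z ^^ k) f"
    have "?g \<in> forms (n - k)" using assms by (rule forms_higher_deriv_z)
    then have "eval_at ?g (vector [a1 + h1, b, a3]) =
        (\<Sum>i\<le>n. poly ((pderiv ^^ i) (slice_x ?g b a3)) a1 / fact i * h1 ^ i)"
      unfolding poly_slice_x[symmetric]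
      by (intro taylor_poly) (simp add: higher_pderiv_slice higher_deriv_eq_0[of ?g "n - k"] slice_0)
    then show "eval_at ?g (vector [a1 + h1, b, a3]) / fact k * h3 ^ k =
      (\<Sum>i\<le>n. eval_at ((deriv_x ^^ i) ?g) (vector [a1, b, a3]) / fact i * h1 ^ i) / fact k * h3 ^ k"
      by (simp add: higher_pderiv_slice poly_slice_x)
  qed
  finally show ?thesis by (simp add: sum_divide_distrib sum_distrib_right)
qed

section \<open>Order of vanishing\<close>

lemma vanishes_to_order_0: "vanishes_to_order 0 f q"
  by (simp add: vanishes_to_order_def)

lemma higher_deriv_linear:
  "(deriv_x ^^ i) (f + g) = (deriv_x ^^ i) f + (deriv_x ^^ i) g"
  "(deriv_y ^^ i) (f + g) = (deriv_y ^^ i) f + (deriv_y ^^ i) g"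
  "(deriv_z ^^ i) (f + g) = (deriv_z ^^ i) f + (deriv_z ^^ i) g"
  "(deriv_x ^^ i) (scale c f) = scale c ((deriv_x ^^ i) f)"
  "(deriv_y ^^ i) (scale c f) = scale c ((deriv_y ^^ i) f)"
  "(deriv_z ^^ i) (scale c f) = scale c ((deriv_z ^^ i) f)"
  by (induction i) (simp_all add: deriv_linear)

lemma vanishes_to_order_add:
  "vanishes_to_order n f q \<Longrightarrow> vanishes_to_order n g q \<Longrightarrow> vanishes_to_order n (f + g) q"
  by (simp add: vanishes_to_order_def vanishes_at_def higher_deriv_linear eval_at_simps)

lemma vanishes_to_order_scale:
  "vanishes_to_order n f q \<Longrightarrow> vanishes_to_order n (scale c f) q"
  by (simp add: vanishes_to_order_def vanishes_at_def higher_deriv_linear eval_at_simps)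

lemma vanishes_to_order_zero: "vanishes_to_order n 0 q"
  by (simp add: vanishes_to_order_def vanishes_at_def higher_deriv_0 eval_at_simps)

lemma vanishes_to_order_sum:
  "(\<And>x. x \<in> A \<Longrightarrow> vanishes_to_order n (f x) q) \<Longrightarrow> vanishes_to_order n (\<Sum>x\<in>A. f x) q"
  by (induction A rule: infinite_finite_induct)
     (auto intro: vanishes_to_order_add vanishes_to_order_zero)

lemma higher_deriv_commute:
  "(deriv_y ^^ j) (deriv_x f) = deriv_x ((deriv_y ^^ j) f)"
  "(deriv_z ^^ j) (deriv_x f) = deriv_x ((deriv_z ^^ j) f)"
  "(deriv_z ^^ j) (deriv_y f) = deriv_y ((deriv_z ^^ j) f)"
  by (induction j) (simp_all add: deriv_commute)

lemma vanishes_to_order_SucI: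
  assumes "vanishes_at f q" "vanishes_to_order n (deriv_x f) q" "vanishes_to_order n (deriv_y f) q"
    "vanishes_to_order n (deriv_z f) q"
  shows "vanishes_to_order (Suc n) f q"
  unfolding vanishes_to_order_def
proof (intro allI impI)
  fix i j k assume ijk: "i + j + k < Suc n"
  consider i' where "i = Suc i'" | j' where "i = 0" "j = Suc j'" | k' where "i = 0" "j = 0" "k = Suc k'"
    | "i = 0" "j = 0" "k = 0"
    by (metis not0_implies_Suc)
  then show "vanishes_at ((deriv_x ^^ i) ((deriv_y ^^ j) ((deriv_z ^^ k) f))) q"
  proof cases
    case 1
    then show ?thesis using assms(2) ijk unfolding vanishes_to_order_def
      by (auto simp: higher_deriv_commute funpow_swap1)
  next
    case 2
    then have "vanishes_at ((deriv_x ^^ 0) ((deriv_y ^^ j') ((deriv_z ^^ k) (deriv_y f)))) q"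
      using assms(3) ijk unfolding vanishes_to_order_def by (metis add_Suc add_0 not_less_eq)
    then show ?thesis using 2 by (simp add: higher_deriv_commute funpow_swap1)
  next
    case 3
    then have "vanishes_at ((deriv_x ^^ 0) ((deriv_y ^^ 0) ((deriv_z ^^ k') (deriv_z f)))) q"
      using assms(4) ijk unfolding vanishes_to_order_def by (metis add_0 not_less_eq)
    then show ?thesis using 3 by (simp add: funpow_swap1)
  next
    case 4
    then show ?thesis using assms(1) by simp
  qed
qed

lemma vanishes_to_order_SucD:
  assumes "vanishes_to_order (Suc n) f q"
  shows "vanishes_to_order n (deriv_x f) q" "vanishes_to_order n (deriv_y f) q"
    "vanishes_to_order n (deriv_z f) q" "vanishes_to_order n f q" "vanishes_at f q"
proof -
  have *: "vanishes_at ((deriv_x ^^ i) ((deriv_y ^^ j) ((deriv_z ^^ k) f))) q"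
    if "i + j + k < Suc n" for i j k
    using assms that unfolding vanishes_to_order_def by blast
  show "vanishes_to_order n (deriv_x f) q" unfolding vanishes_to_order_def
    using *[of "Suc _"] by (simp add: higher_deriv_commute funpow_swap1)
  show "vanishes_to_order n (deriv_y f) q" unfolding vanishes_to_order_def
    using *[of _ "Suc _"] by (simp add: higher_deriv_commute funpow_swap1)
  show "vanishes_to_order n (deriv_z f) q" unfolding vanishes_to_order_def
    using *[of _ _ "Suc _"] by (simp add: funpow_swap1)
  show "vanishes_to_order n f q" unfolding vanishes_to_order_def using * by simp
  show "vanishes_at f q" using *[of 0 0 0] by simp
qed

text \<open>The linear form is given by its coefficients because the induction uses that its partial
  derivatives are constants: a derivative of \<open>l * f\<close> is a constant times
  \<open>f\<close> plus \<open>l\<close> times a derivative of \<open>f\<close>.\<close>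

lemma vanishes_to_order_linear_mult:
  assumes l: "l = scale a var_x + scale b var_y + scale c var_z" "vanishes_at l q"
    and f: "vanishes_to_order n f q"
  shows "vanishes_to_order (Suc n) (l * f) q"
  using f
proof (induction n arbitrary: f)
  case 0
  show ?case using l(2)
    by (intro vanishes_to_order_SucI vanishes_to_order_0) (simp add: vanishes_at_def eval_at_simps)
next
  case (Suc n)
  have dl: "deriv_x l = scale a 1" "deriv_y l = scale b 1" "deriv_z l = scale c 1"
    unfolding l(1) by (simp_all add: deriv_linear deriv_vars) (simp_all add: scale_def)
  have s: "scale a 1 * f = scale a f" for a by (simp add: scale_def)
  note D = vanishes_to_order_SucD[OF Suc.prems]
  show ?case
    unfolding deriv_mult dl s
    by (rule vanishes_to_order_SucI)
       (simp_all add: deriv_mult dl s vanishes_at_def[of "l * f"] eval_at_mult l(2)[unfolded vanishes_at_def]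
         vanishes_to_order_add vanishes_to_order_scale Suc.prems Suc.IH D)
qed

section \<open>Conditions imposed by a fat point and by a finite set\<close>

text \<open>
  Linear forms vanishing at the center $(m : -1 : c)$.  The signs are chosen such that $(t,s)$ are also
  the first and third coordinates of the point where the line dual to the center meets the line dual
  to $v$.
\<close>

definition t_of :: "complex \<Rightarrow> complex ^ 3 \<Rightarrow> complex" where "t_of c v = - (v $ 3 + v $ 2 * c)"
definition s_of :: "complex \<Rightarrow> complex ^ 3 \<Rightarrow> complex" where "s_of m v = v $ 1 + v $ 2 * m"

text \<open>The zero coefficients here and in \<open>s_form\<close> are kept so that both
  definitions match the shape of the linear form in
  \<open>vanishes_to_order_linear_mult\<close>.\<close>

definition t_form :: "complex \<Rightarrow> S" where
  "t_form c = scale 0 var_x + scale (- c) var_y + scale (- 1) var_z"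
definition s_form :: "complex \<Rightarrow> S" where
  "s_form m = scale 1 var_x + scale m var_y + scale 0 var_z"

text \<open>The center (m : -1 : c) is dual to the line y = m x + c z, so the chart omits the
  centers dual to the vertical lines and the line at infinity.\<close>

definition in_chart :: "P2 \<Rightarrow> complex \<Rightarrow> complex \<Rightarrow> bool" where
  "in_chart q m c \<longleftrightarrow> coords q $ 2 \<noteq> 0 \<and> coords q $ 1 = - m * coords q $ 2 \<and>
     coords q $ 3 = - c * coords q $ 2"

lemma eval_at_t_form: "eval_at (t_form c) v = t_of c v"
  by (simp add: t_form_def t_of_def eval_at_simps)

lemma eval_at_s_form: "eval_at (s_form m) v = s_of m v"
  by (simp add: s_form_def s_of_def eval_at_simps)

lemma t_s_form_in_forms: "t_form c \<in> forms 1" "s_form m \<in> forms 1"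
  unfolding t_form_def s_form_def by (intro forms_add forms_scale forms_vars)+

lemma t_s_of_center:
  assumes "in_chart q m c"
  shows "t_of c (coords q) = 0" "s_of m (coords q) = 0"
  using assms by (simp_all add: t_of_def s_of_def in_chart_def)

text \<open>The coefficient of t^k s^i y^(n-i-k). The sign comes from z + c y = -t, the power of the
  second coordinate from rescaling the derivatives, forms of degree n - i - k, to the representative
  \<open>coords q\<close>.\<close>

definition chart_coeff :: "S \<Rightarrow> P2 \<Rightarrow> nat \<Rightarrow> nat \<Rightarrow> nat \<Rightarrow> complex" where
  "chart_coeff f q n i k = (-1) ^ k * eval_at ((deriv_x ^^ i) ((deriv_z ^^ k) f)) (coords q) /
     (fact i * fact k * (coords q $ 2) ^ (n - i - k))"

lemma chart_expansion:
  assumes f: "f \<in> forms n" and q: "in_chart q m c"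
  shows "eval_at f v = (\<Sum>k\<le>n. \<Sum>i\<le>n - k. chart_coeff f q n i k *
    (t_of c v ^ k * s_of m v ^ i * v $ 2 ^ (n - i - k)))"
proof -
  let ?V = "coords q"
  have V2: "?V $ 2 \<noteq> 0" using q by (simp add: in_chart_def)
  \<comment> \<open>The base point is the multiple of \<open>coords q\<close> with the same second
    coordinate as \<open>v\<close>; the displacement is s in x and -t in z.\<close>
  have v: "v = vector [- v $ 2 * m + s_of m v, v $ 2, - v $ 2 * c + (- t_of c v)]"
    by (simp add: vec_eq_iff forall_3 s_of_def t_of_def)
  have base: "vector [- v $ 2 * m, v $ 2, - v $ 2 * c] = (v $ 2 / ?V $ 2) *s ?V"
    using q V2 by (simp add: vec_eq_iff forall_3 in_chart_def)
  have summand: "eval_at ((deriv_x ^^ i) ((deriv_z ^^ k) f)) (vector [- v $ 2 * m, v $ 2, - v $ 2 * c]) /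
        (fact i * fact k) * s_of m v ^ i * (- t_of c v) ^ k =
      (if i \<le> n - k then chart_coeff f q n i k * (t_of c v ^ k * s_of m v ^ i * v $ 2 ^ (n - i - k)) else 0)"
    for i k
  proof (cases "i \<le> n - k")
    case False
    have "(deriv_z ^^ k) f \<in> forms (n - k)" using f by (rule forms_higher_deriv_z)
    then have "(deriv_x ^^ i) ((deriv_z ^^ k) f) = 0" using False higher_deriv_eq_0(1) by simp
    then show ?thesis using False by (simp add: eval_at_0)
  next
    case True
    have "(deriv_x ^^ i) ((deriv_z ^^ k) f) \<in> forms (n - k - i)"
      by (intro forms_higher_deriv_x forms_higher_deriv_z f)
    then have "eval_at ((deriv_x ^^ i) ((deriv_z ^^ k) f)) ((v $ 2 / ?V $ 2) *s ?V) =
        (v $ 2 / ?V $ 2) ^ (n - k - i) * eval_at ((deriv_x ^^ i) ((deriv_z ^^ k) f)) ?V"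
      by (rule eval_at_form_scaled)
    moreover have "(- t_of c v) ^ k = (-1) ^ k * t_of c v ^ k" by (rule power_minus)
    moreover have "n - i - k = n - k - i" by simp
    ultimately show ?thesis unfolding base using True V2
      by (simp add: chart_coeff_def power_divide field_simps)
  qed
  have "eval_at f v = (\<Sum>k\<le>n. \<Sum>i\<le>n. if i \<le> n - k then chart_coeff f q n i k *
      (t_of c v ^ k * s_of m v ^ i * v $ 2 ^ (n - i - k)) else 0)"
    by (subst v) (simp only: taylor_xz[OF f] summand)
  also have "\<dots> = (\<Sum>k\<le>n. \<Sum>i\<le>n - k. chart_coeff f q n i k *
      (t_of c v ^ k * s_of m v ^ i * v $ 2 ^ (n - i - k)))"
    by (intro sum.cong refl sum.mono_neutral_cong_right) auto
  finally show ?thesis .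
qed

definition fat_form :: "nat \<Rightarrow> complex poly \<Rightarrow> complex poly \<Rightarrow> complex \<Rightarrow> complex \<Rightarrow> S" where
  "fat_form j U N m c = (\<Sum>i\<le>j. scale (coeff U i) (t_form c ^ i * s_form m ^ (j - i))) +
     var_y * (\<Sum>i\<le>j - 1. scale (coeff N i) (t_form c ^ i * s_form m ^ (j - 1 - i)))"

lemma eval_at_fat_form:
  "eval_at (fat_form j U N m c) v = fat_value j U N (t_of c v) (s_of m v) (v $ 2)"
  by (simp add: fat_form_def fat_value_def bin_form_def eval_at_simps eval_at_t_form eval_at_s_form mult.assoc)

lemma t_s_monomial_in_forms: "t_form c ^ i * s_form m ^ k \<in> forms (i + k)"
  by (intro forms_mult forms_linear_power t_s_form_in_forms)

lemma fat_form_in_forms: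
  assumes "N = 0 \<or> degree N < j"
  shows "fat_form j U N m c \<in> forms j"
proof -
  have 1: "(\<Sum>i\<le>j. scale (coeff U i) (t_form c ^ i * s_form m ^ (j - i))) \<in> forms j"
  proof (intro forms_sum forms_scale)
    fix i assume "i \<in> {..j}"
    then show "t_form c ^ i * s_form m ^ (j - i) \<in> forms j"
      using t_s_monomial_in_forms[of c i m "j - i"] by simp
  qed
  show ?thesis
  proof (cases j)
    case 0
    then show ?thesis using assms 1 by (simp add: fat_form_def scale_def)
  next
    case (Suc n)
    have "(\<Sum>i\<le>n. scale (coeff N i) (t_form c ^ i * s_form m ^ (n - i))) \<in> forms n"
    proof (intro forms_sum forms_scale)
      fix i assume "i \<in> {..n}"
      then show "t_form c ^ i * s_form m ^ (n - i) \<in> forms n"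
        using t_s_monomial_in_forms[of c i m "n - i"] by simp
    qed
    then have "var_y * (\<Sum>i\<le>n. scale (coeff N i) (t_form c ^ i * s_form m ^ (n - i))) \<in> forms (1 + n)"
      by (intro forms_mult forms_vars)
    then show ?thesis using 1 Suc by (simp add: fat_form_def forms_add)
  qed
qed

lemma vanishes_to_order_mult:
  "vanishes_to_order n f q \<Longrightarrow> vanishes_to_order n (g * f) q"
proof (induction n arbitrary: f g)
  case 0
  show ?case by (rule vanishes_to_order_0)
next
  case (Suc n)
  note D = vanishes_to_order_SucD[OF Suc.prems]
  show ?case
    by (rule vanishes_to_order_SucI)
       (use D in \<open>simp_all add: deriv_mult vanishes_at_def eval_at_mult vanishes_to_order_add Suc.IH\<close>)
qed

lemma vanishes_to_order_mono: "vanishes_to_order n f q \<Longrightarrow> k \<le> n \<Longrightarrow> vanishes_to_order k f q"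
  by (auto simp: vanishes_to_order_def)

lemma vanishes_to_order_t_s_monomial:
  assumes "in_chart q m c"
  shows "vanishes_to_order (i + k) (t_form c ^ i * s_form m ^ k) q"
proof (induction i)
  case 0
  show ?case
  proof (induction k)
    case (Suc k)
    have "vanishes_to_order (Suc k) (s_form m * s_form m ^ k) q"
      by (rule vanishes_to_order_linear_mult[OF s_form_def])
        (use Suc assms in \<open>simp_all add: vanishes_at_def eval_at_s_form t_s_of_center\<close>)
    then show ?case by simp
  qed (simp add: vanishes_to_order_0)
next
  case (Suc i)
  have "vanishes_to_order (Suc (i + k)) (t_form c * (t_form c ^ i * s_form m ^ k)) q"
    by (rule vanishes_to_order_linear_mult[OF t_form_def])
      (use Suc assms in \<open>simp_all add: vanishes_at_def eval_at_t_form t_s_of_center\<close>)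
  then show ?case by (simp add: mult.assoc)
qed

lemma vanishes_to_order_fat_form:
  assumes "in_chart q m c"
  shows "vanishes_to_order (j - 1) (fat_form j U N m c) q"
  unfolding fat_form_def
proof (intro vanishes_to_order_add vanishes_to_order_mult[of _ _ _ var_y] vanishes_to_order_sum
    vanishes_to_order_scale)
  fix i assume "i \<in> {..j}"
  then show "vanishes_to_order (j - 1) (t_form c ^ i * s_form m ^ (j - i)) q"
    using vanishes_to_order_t_s_monomial[OF assms, of i "j - i"] vanishes_to_order_mono[of j _ q "j - 1"]
    by simp
next
  fix i assume "i \<in> {..j - 1}"
  then show "vanishes_to_order (j - 1) (t_form c ^ i * s_form m ^ (j - 1 - i)) q"
    using vanishes_to_order_t_s_monomial[OF assms, of i "j - 1 - i"] le_add_diff_inverse[of i "j - 1"]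
    by simp
qed

text \<open>Derivatives in x and z suffice: at a point with y \<noteq> 0 they determine the order of
  vanishing of a form. In this way a point of multiplicity j - 1 costs exactly
  \<open>j choose 2\<close> linear conditions.\<close>

definition jet :: "P2 \<Rightarrow> nat \<times> nat \<Rightarrow> S \<Rightarrow> complex" where
  "jet q x f = eval_at ((deriv_x ^^ fst x) ((deriv_z ^^ snd x) f)) (coords q)"

definition jet_index :: "nat \<Rightarrow> (nat \<times> nat) set" where
  "jet_index j = {(i, k). i + k < j - 1}"

text \<open>In the expansion at the center the vanishing jets remove all terms of degree below j - 1
  in (t, s). What remains is the part of degree j, which is \<open>U\<close>, and y times the part
  of degree j - 1, which is \<open>N\<close>.\<close>

lemma exists_fat_form:
  assumes f: "f \<in> forms j" and q: "in_chart q m c" and jets: "\<forall>x\<in>jet_index j. jet q x f = 0"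
  shows "\<exists>U N. degree U \<le> j \<and> (N = 0 \<or> degree N < j) \<and> f = fat_form j U N m c"
proof -
  let ?D = "chart_coeff f q j"
  define U where "U = (\<Sum>k\<in>{..j}. monom (?D (j - k) k) k)"
  define N where "N = (\<Sum>k\<in>{..<j}. monom (?D (j - 1 - k) k) k)"
  have cU: "coeff U k = (if k \<le> j then ?D (j - k) k else 0)" for k
    unfolding U_def by (subst coeff_sum_monom) auto
  have cN: "coeff N k = (if k < j then ?D (j - 1 - k) k else 0)" for k
    unfolding N_def by (subst coeff_sum_monom) auto
  have dU: "degree U \<le> j" by (rule degree_le) (simp add: cU)
  have dN: "N = 0 \<or> degree N < j"
  proof (cases j)
    case (Suc j')
    then have "degree N \<le> j'" by (intro degree_le) (simp add: cN)
    then show ?thesis using Suc by simp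
  qed (simp add: N_def)
  have D0: "?D i k = 0" if "i + k < j - 1" for i k
    using jets that by (auto simp: jet_index_def jet_def chart_coeff_def)
  have "f = fat_form j U N m c"
  proof (rule eval_at_ext)
    fix v :: "complex ^ 3"
    let ?t = "t_of c v" and ?s = "s_of m v" and ?y = "v $ 2"
    have inner: "(\<Sum>i\<le>j - k. ?D i k * (?t ^ k * ?s ^ i * ?y ^ (j - i - k))) =
        coeff U k * ?t ^ k * ?s ^ (j - k) + ?y * (coeff N k * ?t ^ k * ?s ^ (j - 1 - k))"
      (is "?L = ?R") if k: "k \<le> j" for k
    proof (cases "k = j")
      case True
      then show ?thesis by (simp add: cU cN)
    next
      case False
      then have kj: "k < j" using k by simp
      have "?L = (\<Sum>i\<in>{j - 1 - k, j - k}. ?D i k * (?t ^ k * ?s ^ i * ?y ^ (j - i - k)))"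
      proof (rule sum.mono_neutral_right)
        show "\<forall>i\<in>{..j - k} - {j - 1 - k, j - k}. ?D i k * (?t ^ k * ?s ^ i * ?y ^ (j - i - k)) = 0"
        proof
          fix i assume "i \<in> {..j - k} - {j - 1 - k, j - k}"
          then have "i + k < j - 1" using kj by auto
          then show "?D i k * (?t ^ k * ?s ^ i * ?y ^ (j - i - k)) = 0" by (simp add: D0)
        qed
      qed auto
      also have "\<dots> = ?R"
      proof -
        have "j - 1 - k \<noteq> j - k" "j - (j - 1 - k) - k = 1" "j - (j - k) - k = 0" using kj by auto
        then show ?thesis using kj by (simp add: cU cN)
      qed
      finally show ?thesis .
    qed
    have "bin_form (j - 1) N ?t ?s = (\<Sum>k\<le>j. coeff N k * ?t ^ k * ?s ^ (j - 1 - k))"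
      unfolding bin_form_def by (rule sum.mono_neutral_left) (auto simp: cN)
    moreover have "eval_at f v = (\<Sum>k\<le>j. coeff U k * ?t ^ k * ?s ^ (j - k) +
        ?y * (coeff N k * ?t ^ k * ?s ^ (j - 1 - k)))"
      unfolding chart_expansion[OF f q] by (intro sum.cong refl inner) simp
    ultimately show "eval_at f v = eval_at (fat_form j U N m c) v"
      unfolding eval_at_fat_form fat_value_def by (simp add: sum.distrib sum_distrib_left bin_form_def)
  qed
  then show ?thesis using dU dN by blast
qed

lemma fat_form_eq_0:
  assumes "degree U \<le> j" "N = 0 \<or> degree N < j" "fat_form j U N m c = 0"
  shows "U = 0 \<and> N = 0"
proof -
  have val: "fat_value j U N t s y = 0" for t s y
  proof -
    have "eval_at (fat_form j U N m c) (vector [s - y * m, y, - t - y * c]) = 0"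
      using assms(3) by (simp add: eval_at_0)
    then show ?thesis by (simp add: eval_at_fat_form t_of_def s_of_def)
  qed
  have "poly U t = 0" for t
    using val[of t 1 0] bin_form_eq_poly[of 1 U j t] assms(1) by (simp add: fat_value_def)
  then have "U = 0" using poly_all_0_iff_0 by blast
  moreover have "N = 0"
  proof (rule ccontr)
    assume "N \<noteq> 0"
    then have "degree N \<le> j - 1" using assms(2) by auto
    then have "poly N t = 0" for t
      using val[of t 1 1] bin_form_eq_poly[of 1 N "j - 1" t] \<open>U = 0\<close> by (simp add: fat_value_def)
    then show False using \<open>N \<noteq> 0\<close> poly_all_0_iff_0 by blast
  qed
  ultimately show ?thesis by simp
qed

text \<open>For a form with vanishing jets the derivatives in y are controlled through
  \<open>fat_form\<close>: each of its terms contains a product of j - 1 linear forms vanishing at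
  the center.\<close>

lemma sections_through_fat_eq:
  assumes "in_chart q m c"
  shows "sections_through_fat Z j q = {f \<in> sections_through Z j. \<forall>x\<in>jet_index j. jet q x f = 0}"
proof -
  have "vanishes_to_order (j - 1) f q \<longleftrightarrow> (\<forall>x\<in>jet_index j. jet q x f = 0)" if f: "f \<in> forms j" for f
  proof
    assume v: "vanishes_to_order (j - 1) f q"
    have "jet q (i, k) f = 0" if "i + k < j - 1" for i k
      using v[unfolded vanishes_to_order_def vanishes_at_def, rule_format, of i 0 k] that
      by (simp add: jet_def)
    then show "\<forall>x\<in>jet_index j. jet q x f = 0" by (auto simp: jet_index_def)
  next
    assume "\<forall>x\<in>jet_index j. jet q x f = 0"
    then show "vanishes_to_order (j - 1) f q"
      using exists_fat_form[OF f assms] vanishes_to_order_fat_form[OF assms] by metis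
  qed
  then show ?thesis by (auto simp: sections_through_fat_def sections_through_def)
qed

lemma derivation_power:
  fixes D :: "S \<Rightarrow> S"
  assumes D: "\<And>f g. D (f * g) = D f * g + f * D g" "D 1 = 0" and l: "D l = scale a 1"
  shows "D (l ^ n) = scale (of_nat n * a) (l ^ (n - 1))"
proof (induction n)
  case (Suc n)
  have "D (l ^ Suc n) = scale a (l ^ n) + l * scale (of_nat n * a) (l ^ (n - 1))"
    using Suc by (simp add: D l scale_def)
  also have "\<dots> = scale (of_nat (Suc n) * a) (l ^ n)"
  proof (cases n)
    case (Suc k)
    show ?thesis by (rule eval_at_ext) (simp add: eval_at_simps Suc algebra_simps)
  qed (simp add: scale_def)
  finally show ?case by simp
qed (simp add: D scale_def)

text \<open>The constant is a falling factorial of \<open>k\<close> times a power of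
  \<open>a\<close>, nonzero up to n = k and zero beyond.\<close>

lemma higher_derivation_power:
  fixes D :: "S \<Rightarrow> S"
  assumes D: "\<And>f g. D (f * g) = D f * g + f * D g" "D 1 = 0" "\<And>c f. D (scale c f) = scale c (D f)"
    and l: "D l = scale a 1" "a \<noteq> 0" and g: "D g = 0"
  shows "\<exists>\<kappa>. (D ^^ n) (l ^ k * g) = scale \<kappa> (l ^ (k - n) * g) \<and> (n \<le> k \<longrightarrow> \<kappa> \<noteq> 0) \<and> (k < n \<longrightarrow> \<kappa> = 0)"
proof (induction n)
  case 0
  show ?case by (intro exI[of _ 1]) (simp add: scale_def one_pCons[symmetric])
next
  case (Suc n)
  then obtain \<kappa> where \<kappa>: "(D ^^ n) (l ^ k * g) = scale \<kappa> (l ^ (k - n) * g)"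
    "n \<le> k \<longrightarrow> \<kappa> \<noteq> 0" "k < n \<longrightarrow> \<kappa> = 0" by blast
  have "(D ^^ Suc n) (l ^ k * g) = scale \<kappa> (scale (of_nat (k - n) * a) (l ^ (k - n - 1)) * g)"
    using \<kappa>(1) derivation_power[of D l a "k - n", OF D(1,2) l(1)] by (simp add: D g)
  also have "\<dots> = scale (\<kappa> * (of_nat (k - n) * a)) (l ^ (k - Suc n) * g)"
    by (rule eval_at_ext) (simp add: eval_at_simps)
  finally show ?case using \<kappa>(2,3) l(2)
    by (intro exI[of _ "\<kappa> * (of_nat (k - n) * a)"]) auto
qed

text \<open>Up to nonzero constants the jets are dual to the monomials in s, t and y. Hence the jets
  that define a fat point are linearly independent on all forms of degree j.\<close>

lemma jet_of_monomial:
  assumes q: "in_chart q m c"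
  shows "jet q (i', k') (s_form m ^ i * (t_form c ^ k * var_y ^ e)) \<noteq> 0 \<longleftrightarrow> i' = i \<and> k' = k"
proof -
  have dz: "deriv_z (t_form c) = scale (-1) 1" "deriv_z (s_form m ^ n * var_y ^ e) = 0" for n
  proof -
    have s: "deriv_z (s_form m) = scale 0 1" "deriv_z var_y = scale 0 1"
      by (simp_all add: s_form_def deriv_linear deriv_vars) (simp_all add: scale_def)
    show "deriv_z (t_form c) = scale (-1) 1"
      by (simp add: t_form_def deriv_linear deriv_vars) (simp add: scale_def)
    show "deriv_z (s_form m ^ n * var_y ^ e) = 0"
      unfolding deriv_mult derivation_power[of deriv_z, OF deriv_mult(3) deriv_1(3) s(1)]
        derivation_power[of deriv_z, OF deriv_mult(3) deriv_1(3) s(2)]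
      by (simp add: scale_def)
  qed
  have dx: "deriv_x (s_form m) = scale 1 1" "deriv_x (t_form c ^ n * var_y ^ e) = 0" for n
  proof -
    have s: "deriv_x (t_form c) = scale 0 1" "deriv_x var_y = scale 0 1"
      by (simp_all add: t_form_def deriv_linear deriv_vars) (simp_all add: scale_def)
    show "deriv_x (s_form m) = scale 1 1"
      by (simp add: s_form_def deriv_linear deriv_vars) (simp add: scale_def)
    show "deriv_x (t_form c ^ n * var_y ^ e) = 0"
      unfolding deriv_mult derivation_power[of deriv_x, OF deriv_mult(1) deriv_1(1) s(1)]
        derivation_power[of deriv_x, OF deriv_mult(1) deriv_1(1) s(2)]
      by (simp add: scale_def)
  qed
  obtain \<kappa> where \<kappa>: "(deriv_z ^^ k') (t_form c ^ k * (s_form m ^ i * var_y ^ e)) =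
      scale \<kappa> (t_form c ^ (k - k') * (s_form m ^ i * var_y ^ e))" "k' \<le> k \<longrightarrow> \<kappa> \<noteq> 0" "k < k' \<longrightarrow> \<kappa> = 0"
    using higher_derivation_power[of deriv_z "t_form c" "-1" "s_form m ^ i * var_y ^ e" k' k]
      deriv_mult(3) deriv_1(3) deriv_linear(6) dz by auto
  obtain \<mu> where \<mu>: "(deriv_x ^^ i') (s_form m ^ i * (t_form c ^ (k - k') * var_y ^ e)) =
      scale \<mu> (s_form m ^ (i - i') * (t_form c ^ (k - k') * var_y ^ e))" "i' \<le> i \<longrightarrow> \<mu> \<noteq> 0" "i < i' \<longrightarrow> \<mu> = 0"
    using higher_derivation_power[of deriv_x "s_form m" 1 "t_form c ^ (k - k') * var_y ^ e" i' i]
      deriv_mult(1) deriv_1(1) deriv_linear(4) dx by auto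
  have "(deriv_x ^^ i') ((deriv_z ^^ k') (s_form m ^ i * (t_form c ^ k * var_y ^ e))) =
      scale \<kappa> ((deriv_x ^^ i') (s_form m ^ i * (t_form c ^ (k - k') * var_y ^ e)))"
    using \<kappa>(1) by (simp add: mult.left_commute higher_deriv_linear)
  \<comment> \<open>The forms s and t vanish at the center, so only exponent zero survives. The
    differences are truncated: for i' > i or k' > k the power of 0 is 1, and \<open>\<mu>\<close> or
    \<open>\<kappa>\<close> vanishes instead.\<close>
  then have "jet q (i', k') (s_form m ^ i * (t_form c ^ k * var_y ^ e)) =
      \<kappa> * (\<mu> * (0 ^ (i - i') * (0 ^ (k - k') * coords q $ 2 ^ e)))"
    unfolding \<mu>(1) jet_def
    by (simp add: eval_at_simps eval_at_s_form eval_at_t_form t_s_of_center[OF q])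
  moreover have "coords q $ 2 \<noteq> 0" using q by (simp add: in_chart_def)
  ultimately show ?thesis using \<kappa>(2,3) \<mu>(2,3) by (auto simp: power_0_left)
qed

lemma finite_jet_index: "finite (jet_index j)"
  by (rule finite_subset[of _ "{..j} \<times> {..j}"]) (auto simp: jet_index_def)

lemma card_jet_index: "card (jet_index j) = j choose 2"
proof -
  have *: "card {(i, k). i + k < n} = (Suc n choose 2)" for n :: nat
  proof (induction n)
    case (Suc n)
    have "{(i, k). i + k < Suc n} = {(i, k). i + k < n} \<union> (\<lambda>i. (i, n - i)) ` {..n}"
      by (auto simp: image_iff less_Suc_eq)
    moreover have "card ((\<lambda>i. (i, n - i)) ` {..n}) = Suc n"
      by (subst card_image) (auto intro: inj_onI)
    moreover have "finite {(i, k). i + k < n}"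
      by (rule finite_subset[of _ "{..n} \<times> {..n}"]) auto
    ultimately have "card {(i, k). i + k < Suc n} = card {(i, k). i + k < n} + Suc n"
      by (simp only:) (subst card_Un_disjoint, auto)
    then show ?case using Suc by (simp add: numeral_2_eq_2)
  qed simp
  show ?thesis
  proof (cases j)
    case 0
    then show ?thesis by (simp add: jet_index_def)
  next
    case (Suc n)
    then show ?thesis using *[of n] by (simp add: jet_index_def)
  qed
qed

lemma functional_eval: "functional scale (\<lambda>f. eval_at f v)"
  by (simp add: functional_def eval_at_simps)

lemma functional_jet: "functional scale (jet q x)"
  by (simp add: functional_def jet_def higher_deriv_linear eval_at_simps)

lemma subspace_forms: "module.subspace scale (forms n)"
proof -
  interpret S: vector_space scale by (rule vector_space_scale)
  show ?thesis by (auto simp: S.subspace_def forms_add forms_scale)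
qed

lemma forms_finite_span: "\<exists>B. finite B \<and> forms n \<subseteq> module.span scale B"
proof -
  interpret S: vector_space scale by (rule vector_space_scale)
  let ?B = "mono3 1 ` ({..n} \<times> {..n} \<times> {..n})"
  have "f \<in> S.span ?B" if f: "f \<in> forms n" for f
  proof (subst expand_monomials, rule S.span_sum)
    fix x assume x: "x \<in> exponents f"
    have "x \<in> {..n} \<times> {..n} \<times> {..n}" using forms_exponents[OF f x] by (cases x) auto
    then have "scale (mcoeff f (fst x) (fst (snd x)) (snd (snd x))) (mono3 1 x) \<in> S.span ?B"
      by (intro S.span_scale S.span_base imageI)
    moreover have "scale k (mono3 1 x) = mono3 k x" for k
      by (rule mcoeff_ext) (simp add: mcoeff_simps mcoeff_mono3)
    ultimately show "mono3 (mcoeff f (fst x) (fst (snd x)) (snd (snd x))) x \<in> S.span ?B" by simp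
  qed
  then show ?thesis by (intro exI[of _ ?B]) auto
qed

section \<open>Comparing dimensions by means of relations\<close>

locale center =
  fixes Z :: "P2 set" and q :: P2 and m c :: complex
  assumes chart: "in_chart q m c"
begin

abbreviation "T p \<equiv> t_of c (coords p)"
abbreviation "Sg p \<equiv> s_of m (coords p)"
abbreviation "Y p \<equiv> coords p $ 2"

lemma sections_through_fat_zero_iff:
  "sections_through_fat Z j q \<subseteq> {0} \<longleftrightarrow> no_fat_curve Z T Sg Y j"
proof
  assume L: "sections_through_fat Z j q \<subseteq> {0}"
  show "no_fat_curve Z T Sg Y j" unfolding no_fat_curve_def
  proof (intro allI impI)
    fix U N assume f: "fat_curve Z T Sg Y j U N"
    then have d: "degree U \<le> j" "N = 0 \<or> degree N < j" by (auto simp: fat_curve_def)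
    have "fat_form j U N m c \<in> sections_through_fat Z j q"
      using f fat_form_in_forms[OF d(2)] vanishes_to_order_fat_form[OF chart]
      by (auto simp: sections_through_fat_def sections_through_def vanishes_at_def eval_at_fat_form fat_curve_def)
    then show "U = 0 \<and> N = 0" using L fat_form_eq_0[OF d] by blast
  qed
next
  assume R: "no_fat_curve Z T Sg Y j"
  show "sections_through_fat Z j q \<subseteq> {0}"
  proof
    fix f assume f: "f \<in> sections_through_fat Z j q"
    then have "f \<in> forms j" "\<forall>x\<in>jet_index j. jet q x f = 0"
      unfolding sections_through_fat_eq[OF chart] by (auto simp: sections_through_def)
    then obtain U N where UN: "degree U \<le> j" "N = 0 \<or> degree N < j" "f = fat_form j U N m c"
      using exists_fat_form[OF _ chart] by blast
    have "fat_curve Z T Sg Y j U N" using f UN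
      by (auto simp: fat_curve_def sections_through_fat_def sections_through_def vanishes_at_def eval_at_fat_form)
    then have "U = 0" "N = 0" using R by (auto simp: no_fat_curve_def)
    then show "f \<in> {0}" by (simp add: UN(3) fat_form_def scale_def)
  qed
qed

end

locale projection = center Z q m c + projected_points Z T Sg Y
  for Z :: "P2 set" and q :: P2 and m c :: complex
begin

lemma fat_rel_iff_forms:
  "fat_rel j w \<longleftrightarrow>
    (\<forall>f\<in>forms j. (\<forall>x\<in>jet_index j. jet q x f = 0) \<longrightarrow> (\<Sum>p\<in>Z. w p * eval_at f (coords p)) = 0)"
proof
  assume L: "fat_rel j w"
  show "\<forall>f\<in>forms j. (\<forall>x\<in>jet_index j. jet q x f = 0) \<longrightarrow> (\<Sum>p\<in>Z. w p * eval_at f (coords p)) = 0"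
  proof (intro ballI impI)
    fix f assume "f \<in> forms j" "\<forall>x\<in>jet_index j. jet q x f = 0"
    then obtain U N where UN: "degree U \<le> j" "N = 0 \<or> degree N < j" "f = fat_form j U N m c"
      using exists_fat_form[OF _ chart] by blast
    let ?e = "\<lambda>k. case k of Inl i \<Rightarrow> coeff U i | Inr i \<Rightarrow> coeff N i"
    have "(\<Sum>p\<in>Z. w p * eval_at f (coords p)) =
        (\<Sum>p\<in>Z. \<Sum>k\<in>fat_index j. ?e k * (w p * fat_monomial j (T p) (Sg p) (Y p) k))"
      by (simp add: UN(3) eval_at_fat_form fat_value_coeffs[OF UN(1,2)] sum_distrib_left mult_ac)
    also have "\<dots> = (\<Sum>k\<in>fat_index j. ?e k * (\<Sum>p\<in>Z. w p * fat_monomial j (T p) (Sg p) (Y p) k))"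
      by (subst sum.swap) (simp add: sum_distrib_left)
    also have "\<dots> = 0" using L by (intro sum.neutral) (auto simp: fat_rel_monomial)
    finally show "(\<Sum>p\<in>Z. w p * eval_at f (coords p)) = 0" .
  qed
next
  assume R: "\<forall>f\<in>forms j. (\<forall>x\<in>jet_index j. jet q x f = 0) \<longrightarrow> (\<Sum>p\<in>Z. w p * eval_at f (coords p)) = 0"
  show "fat_rel j w" unfolding fat_rel_monomial
  proof
    fix k assume k: "k \<in> fat_index j"
    define U where "U = (case k of Inl i \<Rightarrow> monom 1 i | Inr i \<Rightarrow> (0::complex poly))"
    define N where "N = (case k of Inl i \<Rightarrow> (0::complex poly) | Inr i \<Rightarrow> monom 1 i)"
    have d: "degree U \<le> j" "N = 0 \<or> degree N < j"
      using k by (auto simp: U_def N_def degree_monom_eq split: sum.splits)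
    have "(\<Sum>k'\<in>fat_index j. (case k' of Inl i \<Rightarrow> coeff U i | Inr i \<Rightarrow> coeff N i) * g k') =
        (\<Sum>k'\<in>fat_index j. if k' = k then g k else 0)" for g :: "nat + nat \<Rightarrow> complex"
      by (intro sum.cong) (auto simp: U_def N_def split: sum.splits)
    then have ev: "eval_at (fat_form j U N m c) (coords p) = fat_monomial j (T p) (Sg p) (Y p) k" for p
      using k by (simp add: eval_at_fat_form fat_value_coeffs[OF d])
    have "fat_form j U N m c \<in> sections_through_fat {} j q"
      using fat_form_in_forms[OF d(2)] vanishes_to_order_fat_form[OF chart]
      by (auto simp: sections_through_fat_def sections_through_def)
    then have "fat_form j U N m c \<in> forms j" "\<forall>x\<in>jet_index j. jet q x (fat_form j U N m c) = 0"
      unfolding sections_through_fat_eq[OF chart] by (auto simp: sections_through_def)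
    then show "(\<Sum>p\<in>Z. w p * fat_monomial j (T p) (Sg p) (Y p) k) = 0"
      using R ev by auto
  qed
qed

lemma full_rel_iff_forms:
  "full_rel j w \<longleftrightarrow> (\<forall>f\<in>forms j. (\<Sum>p\<in>Z. w p * eval_at f (coords p)) = 0)"
proof
  assume L: "full_rel j w"
  show "\<forall>f\<in>forms j. (\<Sum>p\<in>Z. w p * eval_at f (coords p)) = 0"
  proof
    fix f assume f: "f \<in> forms j"
    let ?D = "chart_coeff f q j"
    have "(\<Sum>p\<in>Z. w p * eval_at f (coords p)) =
        (\<Sum>p\<in>Z. \<Sum>k\<le>j. \<Sum>i\<le>j - k. ?D i k * (w p * (T p ^ k * Sg p ^ i * Y p ^ (j - i - k))))"
      unfolding chart_expansion[OF f chart] by (simp add: sum_distrib_left mult.left_commute)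
    also have "\<dots> = (\<Sum>k\<le>j. \<Sum>p\<in>Z. \<Sum>i\<le>j - k. ?D i k * (w p * (T p ^ k * Sg p ^ i * Y p ^ (j - i - k))))"
      by (rule sum.swap)
    also have "\<dots> = (\<Sum>k\<le>j. \<Sum>i\<le>j - k. \<Sum>p\<in>Z. ?D i k * (w p * (T p ^ k * Sg p ^ i * Y p ^ (j - i - k))))"
      by (intro sum.cong refl sum.swap)
    also have "\<dots> = (\<Sum>k\<le>j. \<Sum>i\<le>j - k. ?D i k * (\<Sum>p\<in>Z. w p * (T p ^ k * Sg p ^ i * Y p ^ (j - i - k))))"
      by (simp add: sum_distrib_left)
    also have "\<dots> = 0"
    proof (intro sum.neutral ballI)
      fix k i assume "k \<in> {..j}" "i \<in> {..j - k}"
      then have "k + i + (j - i - k) = j" by auto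
      then have "(\<Sum>p\<in>Z. w p * (T p ^ k * Sg p ^ i * Y p ^ (j - i - k))) = 0"
        using L unfolding full_rel_def by blast
      then show "?D i k * (\<Sum>p\<in>Z. w p * (T p ^ k * Sg p ^ i * Y p ^ (j - i - k))) = 0" by simp
    qed
    finally show "(\<Sum>p\<in>Z. w p * eval_at f (coords p)) = 0" .
  qed
next
  assume R: "\<forall>f\<in>forms j. (\<Sum>p\<in>Z. w p * eval_at f (coords p)) = 0"
  show "full_rel j w" unfolding full_rel_def
  proof (intro allI impI)
    fix i k e assume "i + k + e = j"
    then have "t_form c ^ i * s_form m ^ k * var_y ^ e \<in> forms j"
      using forms_mult[OF t_s_monomial_in_forms[of c i m k] forms_linear_power[OF forms_vars(2), of e]] by simp
    then have "(\<Sum>p\<in>Z. w p * eval_at (t_form c ^ i * s_form m ^ k * var_y ^ e) (coords p)) = 0"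
      using R by blast
    then show "(\<Sum>p\<in>Z. w p * (T p ^ i * Sg p ^ k * Y p ^ e)) = 0"
      by (simp add: eval_at_simps eval_at_t_form eval_at_s_form)
  qed
qed

text \<open>The excess over the expected dimension means that the jets are dependent on the forms
  through \<open>Z\<close>. Such a combination of jets vanishes where the evaluations at
  \<open>Z\<close> do, so on all forms it equals a combination \<open>w\<close> of evaluations. This
  \<open>w\<close> kills the forms with a fat point, but not all forms, as the jets are independent
  there. The converse reads the same equality backwards.\<close>

theorem unexpected_at_iff:
  "int (h0 (sections_through_fat Z j q)) > max 0 (int (h0 (sections_through Z j)) - int (j choose 2)) \<longleftrightarrow>
    \<not> no_fat_curve Z T Sg Y j \<and> (\<exists>w. fat_rel j w \<and> \<not> full_rel j w)"
proof -
  interpret S: vector_space scale by (rule vector_space_scale)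
  let ?V = "sections_through Z j"
  have Veq: "?V = {f \<in> forms j. \<forall>p\<in>Z. eval_at f (coords p) = 0}"
    by (auto simp: sections_through_def vanishes_at_def)
  have V: "S.subspace ?V"
    unfolding Veq by (rule S.subspace_common_kernel[OF subspace_forms functional_eval])
  obtain B where B: "finite B" "forms j \<subseteq> S.span B" using forms_finite_span by blast
  then have VB: "?V \<subseteq> S.span B" unfolding Veq by blast
  have fatV: "sections_through_fat Z j q \<subseteq> S.span B"
    using VB unfolding sections_through_fat_def by blast
  have pos: "0 < h0 (sections_through_fat Z j q) \<longleftrightarrow> \<not> no_fat_curve Z T Sg Y j"
    unfolding sections_through_fat_zero_iff[symmetric] h0_def
    using S.dim_eq_0_subset[OF fatV B(1)] by linarith
  have less: "h0 ?V < h0 (sections_through_fat Z j q) + (j choose 2) \<longleftrightarrow>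
      (\<exists>l. (\<exists>x\<in>jet_index j. l x \<noteq> 0) \<and> (\<forall>f\<in>?V. (\<Sum>x\<in>jet_index j. l x * jet q x f) = 0))"
    unfolding sections_through_fat_eq[OF chart] h0_def card_jet_index[symmetric]
    by (rule S.dim_common_kernel_less_iff[OF V VB B(1) finite_jet_index functional_jet])
  have "(\<exists>l. (\<exists>x\<in>jet_index j. l x \<noteq> 0) \<and> (\<forall>f\<in>?V. (\<Sum>x\<in>jet_index j. l x * jet q x f) = 0)) \<longleftrightarrow>
      (\<exists>w. fat_rel j w \<and> \<not> full_rel j w)"
  proof
    assume "\<exists>l. (\<exists>x\<in>jet_index j. l x \<noteq> 0) \<and> (\<forall>f\<in>?V. (\<Sum>x\<in>jet_index j. l x * jet q x f) = 0)"
    then obtain l where l: "\<exists>x\<in>jet_index j. l x \<noteq> 0"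
      "\<And>f. f \<in> ?V \<Longrightarrow> (\<Sum>x\<in>jet_index j. l x * jet q x f) = 0" by blast
    have "\<exists>w. \<forall>f\<in>forms j. (\<Sum>x\<in>jet_index j. l x * jet q x f) = (\<Sum>p\<in>Z. w p * eval_at f (coords p))"
    proof (rule S.common_kernel_combination[OF finite_Z subspace_forms functional_eval])
      show "functional scale (\<lambda>f. \<Sum>x\<in>jet_index j. l x * jet q x f)"
        by (intro functional_sum_scaled functional_jet)
      show "(\<Sum>x\<in>jet_index j. l x * jet q x f) = 0"
        if "f \<in> forms j" "\<forall>p\<in>Z. eval_at f (coords p) = 0" for f
        using l(2)[of f] that by (simp add: Veq)
    qed
    then obtain w where w: "\<And>f. f \<in> forms j \<Longrightarrow>
      (\<Sum>x\<in>jet_index j. l x * jet q x f) = (\<Sum>p\<in>Z. w p * eval_at f (coords p))" by blast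
    have "fat_rel j w" unfolding fat_rel_iff_forms
      using w[symmetric] by simp
    moreover have "\<not> full_rel j w"
    proof
      assume full: "full_rel j w"
      obtain i k where ik: "(i, k) \<in> jet_index j" "l (i, k) \<noteq> 0" using l(1) by auto
      \<comment> \<open>On this form of degree j all jets but the one at (i, k) vanish, so it
        isolates the coefficient \<open>l (i, k)\<close>.\<close>
      let ?f = "s_form m ^ i * (t_form c ^ k * var_y ^ (j - i - k))"
      have "t_form c ^ k * s_form m ^ i * var_y ^ (j - i - k) \<in> forms (k + i + (j - i - k))"
        by (rule forms_mult[OF t_s_monomial_in_forms forms_linear_power[OF forms_vars(2)]])
      moreover have "k + i + (j - i - k) = j" using ik by (auto simp: jet_index_def)
      ultimately have f: "?f \<in> forms j" by (simp add: mult_ac)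
      have "(\<Sum>x\<in>jet_index j. l x * jet q x ?f) = (\<Sum>x\<in>jet_index j. if x = (i, k) then l x * jet q x ?f else 0)"
        using jet_of_monomial[OF chart, of _ _ i k "j - i - k"] by (intro sum.cong) auto
      then have "l (i, k) * jet q (i, k) ?f = 0"
        using w[OF f] full f ik(1) finite_jet_index by (simp add: full_rel_iff_forms)
      then show False using ik(2) jet_of_monomial[OF chart, of i k i k "j - i - k"] by auto
    qed
    ultimately show "\<exists>w. fat_rel j w \<and> \<not> full_rel j w" by blast
  next
    assume "\<exists>w. fat_rel j w \<and> \<not> full_rel j w"
    then obtain w where w: "fat_rel j w" "\<not> full_rel j w" by blast
    have "\<exists>l. \<forall>f\<in>forms j. (\<Sum>p\<in>Z. w p * eval_at f (coords p)) = (\<Sum>x\<in>jet_index j. l x * jet q x f)"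
    proof (rule S.common_kernel_combination[OF finite_jet_index subspace_forms functional_jet])
      show "functional scale (\<lambda>f. \<Sum>p\<in>Z. w p * eval_at f (coords p))"
        by (intro functional_sum_scaled functional_eval)
      show "(\<Sum>p\<in>Z. w p * eval_at f (coords p)) = 0"
        if "f \<in> forms j" "\<forall>x\<in>jet_index j. jet q x f = 0" for f
        using w(1) that by (simp add: fat_rel_iff_forms)
    qed
    then obtain l where l: "\<And>f. f \<in> forms j \<Longrightarrow>
      (\<Sum>p\<in>Z. w p * eval_at f (coords p)) = (\<Sum>x\<in>jet_index j. l x * jet q x f)" by blast
    have "\<exists>x\<in>jet_index j. l x \<noteq> 0"
    proof (rule ccontr)
      assume "\<not> ?thesis"
      then have "full_rel j w" unfolding full_rel_iff_forms using l by simp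
      then show False using w(2) by simp
    qed
    moreover have "(\<Sum>x\<in>jet_index j. l x * jet q x f) = 0" if "f \<in> ?V" for f
      using that l[of f] by (simp add: Veq)
    ultimately show "\<exists>l. (\<exists>x\<in>jet_index j. l x \<noteq> 0) \<and> (\<forall>f\<in>?V. (\<Sum>x\<in>jet_index j. l x * jet q x f) = 0)"
      by blast
  qed
  then show ?thesis using pos less by auto
qed

end

section \<open>Generic points of the plane\<close>

lemma exists_point:
  assumes "v \<noteq> 0"
  shows "\<exists>q k. k \<noteq> 0 \<and> coords q = k *s v"
proof -
  have "proportional v v" using assms by (auto simp: proportional_def intro: exI[of _ 1])
  then have "proportional (rep_P2 (abs_P2 v)) v" by (rule Quotient3_rep_abs[OF Quotient3_P2])
  moreover define q where "q = abs_P2 v"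
  ultimately obtain k where k: "k \<noteq> 0" "v = k *s coords q" by (auto simp: proportional_def coords_def)
  then have "coords q = inverse k *s v" by (simp add: vector_smult_assoc)
  then show ?thesis using k(1) by (metis inverse_nonzero_iff_nonzero)
qed

lemma generically_iff:
  "generically P \<longleftrightarrow> (\<exists>n. \<exists>g\<in>forms n. g \<noteq> 0 \<and> (\<forall>q. eval_at g (coords q) \<noteq> 0 \<longrightarrow> P q))"
proof
  assume "generically P"
  then obtain U where U: "zariski_closed (- U)" "U \<noteq> {}" "\<forall>q\<in>U. P q" by (auto simp: generically_def)
  then obtain T where T: "T \<subseteq> (\<Union>d. forms d)" "- U = {p. \<forall>f\<in>T. vanishes_at f p}"
    by (auto simp: zariski_closed_def)
  obtain q where "q \<in> U" using U(2) by blast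
  then obtain f where f: "f \<in> T" "\<not> vanishes_at f q" using T(2) by blast
  then have "f \<noteq> 0" by (auto simp: vanishes_at_def eval_at_0)
  moreover obtain n where "f \<in> forms n" using f T(1) by blast
  moreover have "P q'" if "eval_at f (coords q') \<noteq> 0" for q'
  proof -
    have "q' \<notin> - U" using that f(1) T(2) by (auto simp: vanishes_at_def)
    then show ?thesis using U(3) by simp
  qed
  ultimately show "\<exists>n. \<exists>g\<in>forms n. g \<noteq> 0 \<and> (\<forall>q. eval_at g (coords q) \<noteq> 0 \<longrightarrow> P q)" by blast
next
  assume "\<exists>n. \<exists>g\<in>forms n. g \<noteq> 0 \<and> (\<forall>q. eval_at g (coords q) \<noteq> 0 \<longrightarrow> P q)"
  then obtain n g where g: "g \<in> forms n" "g \<noteq> 0" "\<And>q. eval_at g (coords q) \<noteq> 0 \<Longrightarrow> P q" by blast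
  let ?U = "{q. eval_at g (coords q) \<noteq> 0}"
  \<comment> \<open>The factor x forces v \<noteq> 0; a constant \<open>g\<close> would also be
    nonzero at the origin, which represents no point.\<close>
  have "var_x \<noteq> 0" by (simp add: var_x_def)
  then have "var_x * g \<noteq> 0" using g(2) by simp
  then obtain v where "eval_at (var_x * g) v \<noteq> 0" using eval_at_eq_0 by blast
  then have v: "v \<noteq> 0" "eval_at g v \<noteq> 0" by (auto simp: eval_at_simps)
  then obtain q k where "k \<noteq> 0" "coords q = k *s v" using exists_point by blast
  then have "q \<in> ?U" using v(2) by (simp add: eval_at_form_scaled[OF g(1)])
  moreover have "zariski_closed (- ?U)" unfolding zariski_closed_def
    by (rule exI[of _ "{g}"]) (use g(1) in \<open>auto simp: vanishes_at_def\<close>)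
  ultimately show "generically P" unfolding generically_def using g(3) by (intro exI[of _ ?U]) auto
qed

lemma generically_mono: "generically P \<Longrightarrow> (\<And>q. P q \<Longrightarrow> Q q) \<Longrightarrow> generically Q"
  by (auto simp: generically_def)

lemma generically_False: "\<not> generically (\<lambda>q. False)"
  by (auto simp: generically_def)

lemma generically_True: "generically (\<lambda>q. True)"
  unfolding generically_iff by (intro exI[of _ 0] bexI[of _ 1]) (simp_all add: forms_1)

lemma generically_const: "generically (\<lambda>q. b) \<longleftrightarrow> b"
  using generically_True generically_False by (cases b) simp_all

lemma generically_conj:
  assumes "generically P" "generically Q"
  shows "generically (\<lambda>q. P q \<and> Q q)"
proof -
  obtain m f n g where "f \<in> forms m" "f \<noteq> 0" "\<forall>q. eval_at f (coords q) \<noteq> 0 \<longrightarrow> P q"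
    "g \<in> forms n" "g \<noteq> 0" "\<forall>q. eval_at g (coords q) \<noteq> 0 \<longrightarrow> Q q"
    using assms unfolding generically_iff by blast
  then show ?thesis unfolding generically_iff
    by (intro exI[of _ "m + n"] bexI[of _ "f * g"]) (auto simp: eval_at_simps forms_mult)
qed

text \<open>For polynomials in the parameters of the center: the outer variable is c, the inner one
  m.\<close>

definition eval2 :: "complex poly poly \<Rightarrow> complex \<Rightarrow> complex \<Rightarrow> complex" where
  "eval2 r m c = poly (poly r [:c:]) m"

lemma eval2_simps:
  "eval2 (r + r') m c = eval2 r m c + eval2 r' m c" "eval2 (r * r') m c = eval2 r m c * eval2 r' m c"
  "eval2 0 m c = 0" "eval2 1 m c = 1" "eval2 (- r) m c = - eval2 r m c" "eval2 (r - r') m c = eval2 r m c - eval2 r' m c"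
  by (simp_all add: eval2_def)

lemma eval2_power: "eval2 (r ^ n) m c = eval2 r m c ^ n"
  by (induction n) (simp_all add: eval2_simps)

lemma eval2_sum: "eval2 (\<Sum>x\<in>A. f x) m c = (\<Sum>x\<in>A. eval2 (f x) m c)"
  by (induction A rule: infinite_finite_induct) (simp_all add: eval2_simps)

lemma eval2_prod: "eval2 (\<Prod>x\<in>A. f x) m c = (\<Prod>x\<in>A. eval2 (f x) m c)"
  by (induction A rule: infinite_finite_induct) (simp_all add: eval2_simps)

lemma eval2_nonzero: "r \<noteq> 0 \<Longrightarrow> \<exists>m c. eval2 r m c \<noteq> 0"
  using poly_poly_eq_0[of r] unfolding eval2_def by blast

lemma eval2_expand:
  "\<exists>n. \<forall>m c. eval2 r m c = (\<Sum>j\<le>degree r. \<Sum>i\<le>n. coeff (coeff r j) i * m ^ i * c ^ j)"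
proof (intro exI allI)
  fix m c
  let ?n = "\<Sum>j\<le>degree r. degree (coeff r j)"
  have "poly (poly r [:c:]) m = (\<Sum>j\<le>degree r. poly (coeff r j) m * c ^ j)"
    unfolding poly_altdef[of r] by (simp add: poly_sum poly_power)
  also have "\<dots> = (\<Sum>j\<le>degree r. (\<Sum>i\<le>?n. coeff (coeff r j) i * m ^ i) * c ^ j)"
  proof (intro sum.cong refl)
    fix j assume "j \<in> {..degree r}"
    then have "degree (coeff r j) \<le> ?n" by (intro member_le_sum) auto
    then show "poly (coeff r j) m * c ^ j = (\<Sum>i\<le>?n. coeff (coeff r j) i * m ^ i) * c ^ j"
      by (simp add: poly_eq_sum_le)
  qed
  finally show "eval2 r m c = (\<Sum>j\<le>degree r. \<Sum>i\<le>?n. coeff (coeff r j) i * m ^ i * c ^ j)"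
    by (simp add: eval2_def sum_distrib_right)
qed

text \<open>On the chart m = -x/y and c = -z/y, and clearing denominators turns
  \<open>\<delta>\<close> into a form. The extra factor y keeps its nonvanishing locus inside the
  chart.\<close>

lemma generically_chart:
  assumes "\<delta> \<noteq> 0" "\<And>q m c. in_chart q m c \<Longrightarrow> eval2 \<delta> m c \<noteq> 0 \<Longrightarrow> P q"
  shows "generically P"
proof -
  obtain n where n: "\<And>m c. eval2 \<delta> m c = (\<Sum>j\<le>degree \<delta>. \<Sum>i\<le>n. coeff (coeff \<delta> j) i * m ^ i * c ^ j)"
    using eval2_expand by blast
  let ?N = "n + degree \<delta>"
  define g where "g = var_y * (\<Sum>j\<le>degree \<delta>. \<Sum>i\<le>n. scale (coeff (coeff \<delta> j) i)
      ((- var_x) ^ i * (- var_z) ^ j * var_y ^ (?N - i - j)))"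
  have "g \<in> forms (1 + ?N)" unfolding g_def
  proof (rule forms_mult[OF forms_vars(2)], intro forms_sum forms_scale)
    fix j i assume "j \<in> {..degree \<delta>}" "i \<in> {..n}"
    then have "?N = i + j + (?N - i - j)" by simp
    then show "(- var_x) ^ i * (- var_z) ^ j * var_y ^ (?N - i - j) \<in> forms ?N"
      by (metis forms_mult forms_linear_power forms_minus forms_vars)
  qed
  moreover have ev: "eval_at g v = v $ 2 ^ Suc ?N * eval2 \<delta> m c"
    if "v $ 1 = - m * v $ 2" "v $ 3 = - c * v $ 2" for v :: "complex ^ 3" and m c
  proof -
    have summand: "coeff (coeff \<delta> j) i * ((m * v $ 2) ^ i * (c * v $ 2) ^ j * v $ 2 ^ (?N - i - j)) =
        v $ 2 ^ ?N * (coeff (coeff \<delta> j) i * m ^ i * c ^ j)" if "j \<le> degree \<delta>" "i \<le> n" for i j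
    proof -
      have "?N = i + j + (?N - i - j)" using that by simp
      then have "v $ 2 ^ ?N = v $ 2 ^ i * v $ 2 ^ j * v $ 2 ^ (?N - i - j)" by (metis power_add)
      then show ?thesis by (simp add: power_mult_distrib)
    qed
    have "eval_at g v = v $ 2 * (\<Sum>j\<le>degree \<delta>. \<Sum>i\<le>n.
        coeff (coeff \<delta> j) i * ((m * v $ 2) ^ i * (c * v $ 2) ^ j * v $ 2 ^ (?N - i - j)))"
      by (simp add: g_def eval_at_simps that)
    also have "\<dots> = v $ 2 * (\<Sum>j\<le>degree \<delta>. \<Sum>i\<le>n.
        v $ 2 ^ ?N * (coeff (coeff \<delta> j) i * m ^ i * c ^ j))"
      by (intro arg_cong[of _ _ "(*) (v $ 2)"] sum.cong refl summand) auto
    finally show ?thesis by (simp add: n sum_distrib_left mult.assoc)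
  qed
  moreover have "g \<noteq> 0"
  proof
    assume g0: "g = 0"
    obtain m c where "eval2 \<delta> m c \<noteq> 0" using eval2_nonzero assms(1) by blast
    then show False using ev[of "vector [- m, 1, - c]" m c] g0 by (simp add: eval_at_0)
  qed
  moreover have "P q" if "eval_at g (coords q) \<noteq> 0" for q
  proof -
    let ?v = "coords q"
    have y: "?v $ 2 \<noteq> 0" using that by (auto simp: g_def eval_at_simps)
    define m where "m = - ?v $ 1 / ?v $ 2"
    define c where "c = - ?v $ 3 / ?v $ 2"
    have ch: "in_chart q m c" using y by (simp add: in_chart_def m_def c_def)
    then have "eval2 \<delta> m c \<noteq> 0" using ev[of ?v m c] that by (auto simp: in_chart_def)
    then show ?thesis using assms(2) ch by blast
  qed
  ultimately show ?thesis unfolding generically_iff by blast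
qed

section \<open>The generic center\<close>

lemma eval_at_linear_form:
  "eval_at (linear_form p) v = coords p $ 1 * v $ 1 + coords p $ 2 * v $ 2 + coords p $ 3 * v $ 3"
  by (simp add: linear_form_def eval_at_simps)

lemma linear_form_in_forms: "linear_form p \<in> forms 1"
  unfolding linear_form_def by (intro forms_add forms_scale forms_vars)

lemma linear_form_nonzero: "linear_form p \<noteq> 0"
proof
  assume "linear_form p = 0"
  then have z: "coords p $ 1 * v $ 1 + coords p $ 2 * v $ 2 + coords p $ 3 * v $ 3 = 0" for v :: "complex ^ 3"
    using eval_at_linear_form[of p v] by (simp add: eval_at_0)
  have "coords p = 0"
    using z[of "vector [1, 0, 0]"] z[of "vector [0, 1, 0]"] z[of "vector [0, 0, 1]"]
    by (simp add: vec_eq_iff forall_3)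
  then show False using coords_nonzero by blast
qed

lemma coords_proportional:
  assumes "coords p = k *s coords q"
  shows "p = q"
proof -
  have "k \<noteq> 0" using assms coords_nonzero[of p] by auto
  then have "proportional (coords q) (coords p)"
    using assms coords_nonzero by (auto simp: proportional_def)
  then show ?thesis
    using Quotient3_rel[OF Quotient3_P2, of "coords q" "coords p"] coords_nonzero
    by (metis coords_def Quotient3_P2 Quotient3_abs_rep)
qed

lemma cross_product_zero_imp_eq:
  assumes "coords p $ 1 * coords q $ 2 = coords p $ 2 * coords q $ 1"
    "coords p $ 1 * coords q $ 3 = coords p $ 3 * coords q $ 1"
    "coords p $ 2 * coords q $ 3 = coords p $ 3 * coords q $ 2"
  shows "p = q"
proof -
  have "coords q \<noteq> 0" by (rule coords_nonzero)
  then obtain i where i: "coords q $ i \<noteq> 0" by (auto simp: vec_eq_iff)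
  have "coords p $ j * coords q $ i = coords p $ i * coords q $ j" for j
    using assms exhaust_3[of i] exhaust_3[of j] by auto
  then have "coords p = (coords p $ i / coords q $ i) *s coords q"
    using i by (simp add: vec_eq_iff field_simps)
  then show ?thesis by (rule coords_proportional)
qed

abbreviation cc :: "complex \<Rightarrow> complex poly poly" where "cc a \<equiv> [:[:a:]:]"

definition t_poly :: "P2 \<Rightarrow> complex poly poly" where
  "t_poly p = - (cc (coords p $ 3) + cc (coords p $ 2) * [:0, 1:])"

definition s_poly :: "P2 \<Rightarrow> complex poly poly" where
  "s_poly p = cc (coords p $ 1) + cc (coords p $ 2) * [:[:0, 1:]:]"

lemma eval2_t_s_poly:
  "eval2 (t_poly p) m c = t_of c (coords p)" "eval2 (s_poly p) m c = s_of m (coords p)"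
  "eval2 (cc a) m c = a"
  by (simp_all add: eval2_def t_poly_def s_poly_def t_of_def s_of_def)

lemma eval2_fat_monomial:
  "eval2 (fat_monomial j t s y k) m c = fat_monomial j (eval2 t m c) (eval2 s m c) (eval2 y m c) k"
  by (simp add: fat_monomial_def eval2_simps eval2_power split: sum.splits)

text \<open>The equations hold at every center, whereas the coefficient vector is nonzero only as a
  polynomial and may vanish at special centers.\<close>

definition fat_family :: "P2 set \<Rightarrow> nat \<Rightarrow> (nat + nat \<Rightarrow> complex poly poly) \<Rightarrow> bool" where
  "fat_family Z j w \<longleftrightarrow> (\<exists>k\<in>fat_index j. w k \<noteq> 0) \<and>
    (\<forall>m c. \<forall>p\<in>Z. (\<Sum>k\<in>fat_index j. eval2 (w k) m c *
      fat_monomial j (t_of c (coords p)) (s_of m (coords p)) (coords p $ 2) k) = 0)"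

abbreviation no_fat_at :: "P2 set \<Rightarrow> nat \<Rightarrow> complex \<Rightarrow> complex \<Rightarrow> bool" where
  "no_fat_at Z j m c \<equiv>
    no_fat_curve Z (\<lambda>p. t_of c (coords p)) (\<lambda>p. s_of m (coords p)) (\<lambda>p. coords p $ 2) j"

lemma fat_dichotomy:
  assumes "finite Z"
  shows "(\<exists>w. fat_family Z j w) \<or> (\<exists>\<delta>. \<delta> \<noteq> 0 \<and> (\<forall>m c. eval2 \<delta> m c \<noteq> 0 \<longrightarrow> no_fat_at Z j m c))"
proof -
  define M where "M k p = fat_monomial j (t_poly p) (s_poly p) (cc (coords p $ 2)) k" for k p
  have evM: "eval2 (M k p) m c = fat_monomial j (t_of c (coords p)) (s_of m (coords p)) (coords p $ 2) k" for k p m c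
    by (simp add: M_def eval2_fat_monomial eval2_t_s_poly)
  from kernel_or_left_inverse[OF finite_fat_index[of j] assms, of M] show ?thesis
  proof (elim disjE exE conjE)
    fix w assume w: "\<exists>k\<in>fat_index j. w k \<noteq> 0" "\<forall>p\<in>Z. (\<Sum>k\<in>fat_index j. w k * M k p) = 0"
    have "(\<Sum>k\<in>fat_index j. eval2 (w k) m c * eval2 (M k p) m c) = 0" if "p \<in> Z" for p m c
      using arg_cong[OF w(2)[rule_format, OF that], of "\<lambda>r. eval2 r m c"]
      by (simp add: eval2_sum eval2_simps)
    then show ?thesis using w(1) unfolding fat_family_def evM by blast
  next
    fix N \<delta> assume \<delta>: "\<delta> \<noteq> (0 :: complex poly poly)"
      and N: "\<forall>k\<in>fat_index j. \<forall>l\<in>fat_index j. (\<Sum>p\<in>Z. N k p * M l p) = (if k = l then \<delta> else 0)"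
    have "no_fat_at Z j m c" if nz: "eval2 \<delta> m c \<noteq> 0" for m c
      unfolding no_fat_curve_iff evM[of _ _ m c, symmetric]
    proof (intro allI impI ballI)
      fix w k assume w: "\<forall>p\<in>Z. (\<Sum>k\<in>fat_index j. w k * eval2 (M k p) m c) = 0" and k: "k \<in> fat_index j"
      have "0 = (\<Sum>p\<in>Z. eval2 (N k p) m c * (\<Sum>l\<in>fat_index j. w l * eval2 (M l p) m c))"
        using w by simp
      also have "\<dots> = (\<Sum>p\<in>Z. \<Sum>l\<in>fat_index j. w l * (eval2 (N k p) m c * eval2 (M l p) m c))"
        by (simp add: sum_distrib_left mult_ac)
      also have "\<dots> = (\<Sum>l\<in>fat_index j. w l * eval2 (\<Sum>p\<in>Z. N k p * M l p) m c)"
        by (subst sum.swap) (simp add: sum_distrib_left eval2_sum eval2_simps)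
      also have "\<dots> = (\<Sum>l\<in>fat_index j. if l = k then w l * eval2 \<delta> m c else 0)"
        using N k by (intro sum.cong) (auto simp: eval2_simps)
      also have "\<dots> = w k * eval2 \<delta> m c" using k by simp
      finally show "w k = 0" using nz by simp
    qed
    then show ?thesis using \<delta> by blast
  qed
qed

lemma fat_family_imp_fat_curve:
  assumes "fat_family Z j w"
  shows "\<exists>\<delta>. \<delta> \<noteq> 0 \<and> (\<forall>m c. eval2 \<delta> m c \<noteq> 0 \<longrightarrow> \<not> no_fat_at Z j m c)"
proof -
  obtain k where k: "k \<in> fat_index j" "w k \<noteq> 0" using assms by (auto simp: fat_family_def)
  have "\<not> no_fat_at Z j m c" if "eval2 (w k) m c \<noteq> 0" for m c
  proof
    assume "no_fat_at Z j m c"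
    from this[unfolded no_fat_curve_iff, THEN spec, of "\<lambda>k. eval2 (w k) m c"]
    show False using assms k(1) that unfolding fat_family_def by blast
  qed
  then show ?thesis using k(2) by blast
qed

text \<open>The last clause omits only (0 : 0 : 1), dual to the line at infinity. For the other
  points s \<noteq> 0 says that the line y = m x + c meets the dual line at an affine point, namely
  at x = t / s.\<close>

lemma general_position:
  assumes "finite Z"
  shows "\<exists>\<delta>. \<delta> \<noteq> 0 \<and> (\<forall>m c. eval2 \<delta> m c \<noteq> 0 \<longrightarrow>
    projected_points Z (\<lambda>p. t_of c (coords p)) (\<lambda>p. s_of m (coords p)) \<and>
    (\<forall>p\<in>Z. coords p $ 1 \<noteq> 0 \<or> coords p $ 2 \<noteq> 0 \<longrightarrow> s_of m (coords p) \<noteq> 0))"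
proof -
  define A where "A p = (if coords p $ 1 \<noteq> 0 \<or> coords p $ 2 \<noteq> 0 then s_poly p else 1)" for p
  define B where "B p p' = t_poly p * s_poly p' - t_poly p' * s_poly p" for p p'
  define \<delta> where "\<delta> = (\<Prod>p\<in>Z. A p) * (\<Prod>p\<in>Z. \<Prod>p'\<in>Z - {p}. B p p')"
  have A: "A p \<noteq> 0" for p
  proof (cases "coords p $ 1 \<noteq> 0 \<or> coords p $ 2 \<noteq> 0")
    case True
    then have "s_of 0 (coords p) \<noteq> 0 \<or> s_of 1 (coords p) \<noteq> 0" by (auto simp: s_of_def)
    then have "eval2 (s_poly p) 0 0 \<noteq> 0 \<or> eval2 (s_poly p) 1 0 \<noteq> 0" by (simp add: eval2_t_s_poly)
    then show ?thesis using True by (auto simp: A_def eval2_simps)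
  qed (simp add: A_def)
  have B: "B p p' \<noteq> 0" if "p \<noteq> p'" for p p'
  proof
    assume "B p p' = 0"
    then have "eval2 (B p p') m c = 0" for m c by (simp add: eval2_simps)
    then have e: "t_of c (coords p) * s_of m (coords p') = t_of c (coords p') * s_of m (coords p)" for m c
      by (simp add: B_def eval2_simps eval2_t_s_poly)
    \<comment> \<open>The values at (m, c) = (0,0), (1,0) and (0,1) yield the three minors of the
      coordinates of \<open>p\<close> and \<open>p'\<close>.\<close>
    have "p = p'"
    proof (rule cross_product_zero_imp_eq)
      show 1: "coords p $ 1 * coords p' $ 3 = coords p $ 3 * coords p' $ 1"
        using e[of 0 0] by (simp add: t_of_def s_of_def mult.commute)
      show "coords p $ 1 * coords p' $ 2 = coords p $ 2 * coords p' $ 1"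
        using e[of 1 0] 1 by (simp add: t_of_def s_of_def algebra_simps)
      show "coords p $ 2 * coords p' $ 3 = coords p $ 3 * coords p' $ 2"
        using e[of 0 1] 1 by (simp add: t_of_def s_of_def algebra_simps)
    qed
    then show False using that by simp
  qed
  have "\<delta> \<noteq> 0" unfolding \<delta>_def using assms A B by (auto simp: prod_zero_iff)
  moreover have "projected_points Z (\<lambda>p. t_of c (coords p)) (\<lambda>p. s_of m (coords p)) \<and>
    (\<forall>p\<in>Z. coords p $ 1 \<noteq> 0 \<or> coords p $ 2 \<noteq> 0 \<longrightarrow> s_of m (coords p) \<noteq> 0)"
    if nz: "eval2 \<delta> m c \<noteq> 0" for m c
  proof -
    have Anz: "eval2 (A p) m c \<noteq> 0" if "p \<in> Z" for p
      using nz that assms by (auto simp: \<delta>_def eval2_simps eval2_prod)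
    have Bnz: "eval2 (B p p') m c \<noteq> 0" if "p \<in> Z" "p' \<in> Z" "p \<noteq> p'" for p p'
      using nz that assms by (auto simp: \<delta>_def eval2_simps eval2_prod)
    have s: "s_of m (coords p) \<noteq> 0" if "p \<in> Z" "coords p $ 1 \<noteq> 0 \<or> coords p $ 2 \<noteq> 0" for p
      using Anz[OF that(1)] that(2) by (auto simp: A_def eval2_t_s_poly)
    have "projected_points Z (\<lambda>p. t_of c (coords p)) (\<lambda>p. s_of m (coords p))"
    proof
      show "finite Z" by (rule assms)
      fix p assume p: "p \<in> Z"
      show "t_of c (coords p) \<noteq> 0 \<or> s_of m (coords p) \<noteq> 0"
      proof (cases "coords p $ 1 \<noteq> 0 \<or> coords p $ 2 \<noteq> 0")
        case False
        then have "coords p $ 3 \<noteq> 0" using coords_nonzero[of p] by (auto simp: vec_eq_iff forall_3)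
        then show ?thesis using False by (simp add: t_of_def)
      qed (use s p in blast)
    next
      fix p p' assume "p \<in> Z" "p' \<in> Z" "p \<noteq> p'"
      then show "t_of c (coords p) * s_of m (coords p') \<noteq> t_of c (coords p') * s_of m (coords p)"
        using Bnz[of p p'] by (simp add: B_def eval2_simps eval2_t_s_poly)
    qed
    then show ?thesis using s by blast
  qed
  ultimately show ?thesis by blast
qed

text \<open>
  A vector field $\theta = (\alpha, \beta, \gamma)$ tangent to the lines of the arrangement and not
  a multiple of the Euler field $(x, y, z)$.
\<close>

definition log_triple :: "P2 set \<Rightarrow> nat \<Rightarrow> S \<Rightarrow> S \<Rightarrow> S \<Rightarrow> bool" where
  "log_triple Z n \<alpha> \<beta> \<gamma> \<longleftrightarrow> \<alpha> \<in> forms n \<and> \<beta> \<in> forms n \<and> \<gamma> \<in> forms n \<and>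
    (\<forall>p\<in>Z. \<forall>v. eval_at (linear_form p) v = 0 \<longrightarrow>
       coords p $ 1 * eval_at \<alpha> v + coords p $ 2 * eval_at \<beta> v + coords p $ 3 * eval_at \<gamma> v = 0) \<and>
    (\<alpha> * var_y \<noteq> \<beta> * var_x \<or> \<alpha> * var_z \<noteq> \<gamma> * var_x \<or> \<beta> * var_z \<noteq> \<gamma> * var_y)"

section \<open>Substitutions: lines and points of the plane\<close>

definition subst3 :: "S \<Rightarrow> S \<Rightarrow> S \<Rightarrow> S \<Rightarrow> S" where
  "subst3 f A B C = (\<Sum>x\<in>exponents f. scale (mcoeff f (fst x) (fst (snd x)) (snd (snd x)))
     (A ^ fst x * B ^ fst (snd x) * C ^ snd (snd x)))"

lemma eval_at_subst3:
  "eval_at (subst3 f A B C) v = eval_at f (vector [eval_at A v, eval_at B v, eval_at C v])"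
  unfolding eval_at_expand[of f "vector _"] by (simp add: subst3_def eval_at_simps mult.assoc)

lemma subst3_hom:
  "subst3 (f + g) A B C = subst3 f A B C + subst3 g A B C"
  "subst3 (f - g) A B C = subst3 f A B C - subst3 g A B C"
  "subst3 (f * g) A B C = subst3 f A B C * subst3 g A B C"
  "subst3 (scale a f) A B C = scale a (subst3 f A B C)"
  "subst3 1 A B C = 1" "subst3 0 A B C = 0"
  "subst3 var_x A B C = A" "subst3 var_y A B C = B" "subst3 var_z A B C = C"
  by (rule eval_at_ext, simp add: eval_at_subst3 eval_at_simps)+

text \<open>Reduces an identity compatible with the ring operations, such as a chain rule, to its
  check on the variables.\<close>

lemma S_induct [case_names one var_x var_y var_z add mult scale]:
  assumes "P 1" "P var_x" "P var_y" "P var_z" "\<And>f g. P f \<Longrightarrow> P g \<Longrightarrow> P (f + g)"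
    "\<And>f g. P f \<Longrightarrow> P g \<Longrightarrow> P (f * g)" "\<And>a f. P f \<Longrightarrow> P (scale a f)"
  shows "P f"
proof -
  have pow: "P (g ^ n)" if "P g" for g n
    by (induction n) (use assms that in auto)
  have "mono3 a x = scale a (var_x ^ fst x * var_y ^ fst (snd x) * var_z ^ snd (snd x))" for a x
    by (rule eval_at_ext) (simp add: eval_at_mono3 eval_at_simps mult.assoc)
  then have mono: "P (mono3 a x)" for a x using assms pow by simp
  have z: "P 0" using assms(7)[OF assms(1), of 0] by (simp add: scale_def)
  have "P (\<Sum>x\<in>A. mono3 (h x) x)" for A h
    by (induction A rule: infinite_finite_induct) (use z mono assms(5) in auto)
  then show ?thesis by (subst expand_monomials)
qed

text \<open>
  Coordinate changes between $C[m][c][x]$, where the degree is the degree along the line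
  $y = mx + c$, and $C[x][y][m]$, where \<open>pderiv\<close> moves the line with the point $(x,y)$ fixed.
\<close>

definition to_lines :: "S \<Rightarrow> S" where
  "to_lines f = subst3 f var_z (var_x * var_z + var_y) var_x"

definition to_points :: "S \<Rightarrow> S" where
  "to_points g = subst3 g var_z (var_y - var_z * var_x) var_x"

lemma eval_at_to_lines: "eval_at (to_lines f) v = eval_at f (vector [v $ 3, v $ 1 * v $ 3 + v $ 2, v $ 1])"
  by (simp add: to_lines_def eval_at_subst3 eval_at_simps)

lemma eval_at_to_points: "eval_at (to_points f) v = eval_at f (vector [v $ 3, v $ 2 - v $ 3 * v $ 1, v $ 1])"
  by (simp add: to_points_def eval_at_subst3 eval_at_simps)

lemma eval_at_vector: "eval_at f (vector [v $ 1, v $ 2, v $ 3]) = eval_at f v"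
  by (simp add: eval_at_def)

lemma to_lines_to_points: "to_lines (to_points g) = g"
  by (rule eval_at_ext) (simp add: eval_at_to_lines eval_at_to_points eval_at_vector)

lemma to_points_to_lines: "to_points (to_lines g) = g"
  by (rule eval_at_ext) (simp add: eval_at_to_lines eval_at_to_points eval_at_vector algebra_simps)

lemma to_lines_hom:
  "to_lines (f + g) = to_lines f + to_lines g" "to_lines (f - g) = to_lines f - to_lines g"
  "to_lines (f * g) = to_lines f * to_lines g" "to_lines 0 = 0"
  by (simp_all add: to_lines_def subst3_hom)

lemma to_lines_eq_0: "to_lines f = 0 \<longleftrightarrow> f = 0"
  by (metis to_points_to_lines to_lines_hom(4))

text \<open>The derivation d/dm at fixed (x, y), written in the coordinates (m, c, x) of
  \<open>to_lines\<close>: since c = y - m x, it is the m-derivative minus x times the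
  c-derivative.\<close>

definition line_derivation :: "S \<Rightarrow> S" where
  "line_derivation g = deriv_x g - var_z * deriv_y g"

lemma line_derivation_simps:
  "line_derivation (f + g) = line_derivation f + line_derivation g"
  "line_derivation (f * g) = line_derivation f * g + f * line_derivation g"
  "line_derivation (scale a f) = scale a (line_derivation f)"
  by (simp_all add: line_derivation_def deriv_linear deriv_mult algebra_simps)
     (simp add: scale_def algebra_simps smult_diff_right)

lemma pderiv_to_points: "pderiv (to_points g) = to_points (line_derivation g)"
  unfolding deriv_z_def[symmetric]
proof (induction g rule: S_induct)
  case one
  show ?case by (simp add: to_points_def subst3_hom line_derivation_def deriv_1)
next
  case var_x
  show ?case by (simp add: to_points_def subst3_hom line_derivation_def deriv_vars)
next
  case var_y
  have "deriv_z (var_y - var_z * var_x) = - var_x"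
    using deriv_linear(3)[of "var_y - var_z * var_x" "var_z * var_x"]
    by (simp add: deriv_mult deriv_vars eq_neg_iff_add_eq_0)
  moreover have "subst3 (0 - var_z) A B C = 0 - C" for A B C
    unfolding subst3_hom(2) by (simp add: subst3_hom)
  ultimately show ?case by (simp add: to_points_def subst3_hom line_derivation_def deriv_vars)
next
  case var_z
  show ?case by (simp add: to_points_def subst3_hom line_derivation_def deriv_vars)
next
  case (add f g)
  then show ?case by (simp add: to_points_def subst3_hom line_derivation_simps deriv_linear)
next
  case (mult f g)
  then show ?case by (simp add: to_points_def subst3_hom line_derivation_simps deriv_mult)
next
  case (scale a f)
  then show ?case by (simp add: to_points_def subst3_hom line_derivation_simps deriv_linear)
qed

lemma degree_line_derivation: "degree (line_derivation g) \<le> Suc (degree g)"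
proof -
  have 1: "degree (deriv_x g) \<le> degree g" "degree (deriv_y g) \<le> degree g"
    unfolding deriv_x_def deriv_y_def by (rule degree_le, simp add: coeff_map_poly coeff_eq_0)+
  have "degree (var_z * deriv_y g) \<le> degree var_z + degree (deriv_y g)" by (rule degree_mult_le)
  then have "degree (var_z * deriv_y g) \<le> Suc (degree g)" using 1 by (simp add: var_z_def)
  then show ?thesis unfolding line_derivation_def using 1 by (intro degree_diff_le) auto
qed

lemma coeff_slice_z: "coeff (slice_z f a b) k = eval2 (coeff f k) a b"
  by (simp add: slice_z_def coeff_map_poly eval2_def)

text \<open>A generic line y = m x + c meets the lines dual to \<open>Z\<close> in
  \<open>card Z\<close> distinct affine points, all of them zeros of \<open>f\<close>; the degree of
  \<open>to_lines f\<close> is the degree in x along this line.\<close>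

lemma line_roots_imp_zero:
  assumes Z: "finite Z" and fin: "\<And>p. p \<in> Z \<Longrightarrow> coords p $ 1 \<noteq> 0 \<or> coords p $ 2 \<noteq> 0"
    and deg: "degree (to_lines f) < card Z"
    and zero: "\<And>p x y m. p \<in> Z \<Longrightarrow> coords p $ 1 * x + coords p $ 2 * y + coords p $ 3 = 0 \<Longrightarrow>
      eval_at f (vector [x, y, m]) = 0"
  shows "f = 0"
proof (rule ccontr)
  assume "f \<noteq> 0"
  define g where "g = to_lines f"
  have "g \<noteq> 0" using \<open>f \<noteq> 0\<close> by (simp add: g_def to_lines_eq_0)
  obtain \<delta> where \<delta>: "\<delta> \<noteq> 0" "\<And>m c. eval2 \<delta> m c \<noteq> 0 \<Longrightarrow>
    projected_points Z (\<lambda>p. t_of c (coords p)) (\<lambda>p. s_of m (coords p)) \<and>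
    (\<forall>p\<in>Z. coords p $ 1 \<noteq> 0 \<or> coords p $ 2 \<noteq> 0 \<longrightarrow> s_of m (coords p) \<noteq> 0)"
    using general_position[OF Z] by blast
  \<comment> \<open>The line is also chosen such that the leading coefficient of \<open>g\<close>, a
    polynomial in (m, c), is nonzero on it; so the restriction cannot be zero.\<close>
  have "\<delta> * lead_coeff g \<noteq> 0" using \<delta>(1) \<open>g \<noteq> 0\<close> by simp
  then obtain m c where mc: "eval2 (\<delta> * lead_coeff g) m c \<noteq> 0" using eval2_nonzero by blast
  then have nz: "eval2 \<delta> m c \<noteq> 0" "eval2 (lead_coeff g) m c \<noteq> 0" by (auto simp: eval2_simps)
  interpret projected_points Z "\<lambda>p. t_of c (coords p)" "\<lambda>p. s_of m (coords p)" "\<lambda>p. 0"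
    using \<delta>(2)[OF nz(1)] by blast
  have s: "s_of m (coords p) \<noteq> 0" if "p \<in> Z" for p using \<delta>(2)[OF nz(1)] fin that by blast
  let ?h = "slice_z g m c"
  have deg_h: "degree ?h \<le> degree g" by (rule degree_le) (simp add: coeff_slice_z coeff_eq_0 eval2_simps)
  have "?h = 0"
  proof (rule bin_form_many_zeros[of Z "degree g"])
    show "degree g < card Z" using deg by (simp add: g_def)
    fix p assume p: "p \<in> Z"
    let ?x = "t_of c (coords p) / s_of m (coords p)"
    have eq: "coords p $ 1 * x + coords p $ 2 * (m * x + c) + coords p $ 3 =
        s_of m (coords p) * x - t_of c (coords p)" for x
      by (simp add: s_of_def t_of_def algebra_simps)
    have "coords p $ 1 * ?x + coords p $ 2 * (m * ?x + c) + coords p $ 3 = 0"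
      unfolding eq using s[OF p] by simp
    then have "eval_at f (vector [?x, m * ?x + c, m]) = 0" using zero[OF p] by blast
    then have "poly ?h ?x = 0" by (simp add: poly_slice_z g_def eval_at_to_lines)
    then show "bin_form (degree g) ?h (t_of c (coords p)) (s_of m (coords p)) = 0"
      using bin_form_eq_poly[OF s[OF p] deg_h] by simp
  qed (use deg_h in auto)
  then show False using nz(2) coeff_slice_z[of g m c "degree g"] by simp
qed

section \<open>Descent of the generic fat curve\<close>

text \<open>The homogeneous part of degree \<open>l\<close> of U(x, y), evaluated at (1, m) and
  regarded as a polynomial in m.\<close>

definition top_part :: "nat \<Rightarrow> complex poly poly \<Rightarrow> complex poly" where
  "top_part l U = (\<Sum>j\<in>{..l}. monom (coeff (coeff U j) (l - j)) j)"

lemma coeff_top_part: "coeff (top_part l U) j = (if j \<le> l then coeff (coeff U j) (l - j) else 0)"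
  unfolding top_part_def by (subst coeff_sum_monom) auto

lemma coeff_on_line_through_origin: "coeff (poly U [:0, m:]) l = poly (top_part l U) m"
proof -
  have pw: "[:0, m:] ^ j = monom (m ^ j) j" for j :: nat
    by (induction j) (simp_all add: monom_0 monom_Suc mult.commute one_pCons smult_monom)
  have c: "coeff (coeff U j * [:0, m:] ^ j) l = (if j \<le> l then coeff (coeff U j) (l - j) * m ^ j else 0)" for j
    unfolding pw mult.commute[of "coeff U j"] coeff_monom_mult by (simp add: mult.commute)
  have "coeff (poly U [:0, m:]) l = (\<Sum>j\<le>max l (degree U). coeff (coeff U j * [:0, m:] ^ j) l)"
    by (subst poly_eq_sum_le[of U "max l (degree U)"]) (simp_all add: coeff_sum)
  also have "\<dots> = (\<Sum>j\<le>l. coeff (coeff U j) (l - j) * m ^ j)"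
    unfolding c by (rule sum.mono_neutral_cong_right) auto
  also have "\<dots> = poly (top_part l U) m"
    by (simp add: top_part_def poly_sum poly_monom)
  finally show ?thesis .
qed

lemma poly_poly_expand:
  assumes "\<And>l. n < l \<Longrightarrow> top_part l U = 0"
  shows "poly (poly U [:y:]) x = (\<Sum>l\<le>n. \<Sum>j\<le>l. coeff (coeff U j) (l - j) * x ^ (l - j) * y ^ j)"
proof -
  have zero: "coeff (coeff U j) i = 0" if "n < i + j" for i j
    using arg_cong[OF assms[OF that], of "\<lambda>p. coeff p j"] by (simp add: coeff_top_part)
  have dU: "degree U \<le> n" by (rule degree_le) (auto intro: poly_eqI simp: zero)
  have dc: "degree (coeff U j) \<le> n - j" for j by (rule degree_le) (auto simp: zero)
  have "poly (poly U [:y:]) x = (\<Sum>j\<le>n. poly (coeff U j) x * y ^ j)"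
    by (subst poly_eq_sum_le[OF dU]) (simp add: poly_sum poly_power)
  also have "\<dots> = (\<Sum>j\<le>n. \<Sum>i\<le>n - j. coeff (coeff U j) i * x ^ i * y ^ j)"
    by (simp add: poly_eq_sum_le[OF dc] sum_distrib_right)
  also have "\<dots> = (\<Sum>(j, i)\<in>(SIGMA j:{..n}. {..n - j}). coeff (coeff U j) i * x ^ i * y ^ j)"
    by (rule sum.Sigma) auto
  also have "\<dots> = (\<Sum>(l, j)\<in>(SIGMA l:{..n}. {..l}). coeff (coeff U j) (l - j) * x ^ (l - j) * y ^ j)"
    by (rule sum.reindex_bij_witness[of _ "\<lambda>(l, j). (j, l - j)" "\<lambda>(j, i). (i + j, j)"]) auto
  also have "\<dots> = (\<Sum>l\<le>n. \<Sum>j\<le>l. coeff (coeff U j) (l - j) * x ^ (l - j) * y ^ j)"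
    by (rule sum.Sigma[symmetric]) auto
  finally show ?thesis .
qed

lemma eval_at_const: "eval_at [:U:] v = poly (poly U [:v $ 2:]) (v $ 1)"
  by (simp add: eval_at_def)

lemma poly_poly_eval: "poly (poly X q) x = poly (poly X [:poly q x:]) x"
  for X :: "complex poly poly"
  by (induction X) simp_all

text \<open>
  After division by the greatest common divisor, $u$ divides its own derivative, which has smaller
  degree.
\<close>

lemma coprime_proportional_derivatives:
  fixes u w :: S
  assumes "u * pderiv w = w * pderiv u" "u \<noteq> 0 \<or> w \<noteq> 0"
  shows "\<exists>h U V. h \<noteq> 0 \<and> u = h * [:U:] \<and> w = h * [:V:]"
proof -
  have g0: "gcd u w \<noteq> 0" using assms(2) by simp
  then obtain u' w' where uw: "u = u' * gcd u w" "w = w' * gcd u w" "coprime u' w'"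
    using gcd_coprime_exists by blast
  define h where "h = gcd u w"
  have h: "h \<noteq> 0" "u = u' * h" "w = w' * h" using g0 uw by (simp_all add: h_def)
  have "(u' * h) * pderiv (w' * h) = (w' * h) * pderiv (u' * h)" using assms(1) h(2,3) by simp
  then have "h * h * (u' * pderiv w' - w' * pderiv u') = 0"
    by (simp add: pderiv_mult algebra_simps)
  then have eq: "u' * pderiv w' = w' * pderiv u'" using h(1) by simp
  have const: "degree a = 0" if "coprime a b" "a * pderiv b = b * pderiv a" for a b :: S
  proof (rule ccontr)
    assume deg: "degree a \<noteq> 0"
    then have "pderiv a \<noteq> 0" by (simp add: pderiv_eq_0_iff)
    have "a dvd b * pderiv a" using that(2) by (metis dvd_triv_left)
    then have "a dvd pderiv a" using that(1) by (simp add: coprime_dvd_mult_right_iff)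
    then have "degree a \<le> degree (pderiv a)" using \<open>pderiv a \<noteq> 0\<close> by (rule dvd_imp_degree_le)
    then show False using deg by (simp add: degree_pderiv)
  qed
  have "degree u' = 0" "degree w' = 0"
    using const[OF uw(3) eq] const[of w' u'] uw(3) eq by (simp_all add: coprime_commute)
  then obtain U V where "u' = [:U:]" "w' = [:V:]" by (meson degree_eq_zeroE)
  then show ?thesis using h by (intro exI[of _ h] exI[of _ U] exI[of _ V]) (simp add: mult.commute)
qed

text \<open>The dual line is not the line at infinity. Homogeneity gives the zeros with nonzero
  third coordinate, and these are dense in the dual line.\<close>

lemma eval_zero_on_dual_line:
  assumes g: "g \<in> forms n" and fin: "coords p $ 1 \<noteq> 0 \<or> coords p $ 2 \<noteq> 0"
    and aff: "\<And>x y. coords p $ 1 * x + coords p $ 2 * y + coords p $ 3 = 0 \<Longrightarrow>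
      eval_at g (vector [x, y, 1]) = 0"
    and v: "eval_at (linear_form p) v = 0"
  shows "eval_at g v = 0"
proof -
  have proj: "eval_at g w = 0" if w: "eval_at (linear_form p) w = 0" "w $ 3 \<noteq> 0" for w :: "complex ^ 3"
  proof -
    have "w = w $ 3 *s vector [w $ 1 / w $ 3, w $ 2 / w $ 3, 1]"
      using w(2) by (simp add: vec_eq_iff forall_3)
    moreover have "eval_at g (vector [w $ 1 / w $ 3, w $ 2 / w $ 3, 1]) = 0"
      using w by (intro aff) (simp add: eval_at_linear_form field_simps)
    ultimately show ?thesis using eval_at_form_scaled[OF g] by (metis mult_zero_right)
  qed
  obtain w :: "complex ^ 3" where w: "eval_at (linear_form p) w = 0" "w $ 3 = 1"
  proof (cases "coords p $ 1 = 0")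
    case True
    then show thesis using fin that[of "vector [0, - coords p $ 3 / coords p $ 2, 1]"]
      by (simp add: eval_at_linear_form)
  next
    case False
    then show thesis using that[of "vector [- coords p $ 3 / coords p $ 1, 0, 1]"]
      by (simp add: eval_at_linear_form)
  qed
  show ?thesis
  proof (rule eval_at_0_by_density[of "{- v $ 3}" _ _ w])
    fix e assume "e \<notin> {- v $ 3}"
    then have "(v + e *s w) $ 3 \<noteq> 0" using w(2) by (auto simp: add_eq_0_iff2)
    moreover have "eval_at (linear_form p) (v + e *s w) = 0"
    proof -
      have "eval_at (linear_form p) (v + e *s w) = eval_at (linear_form p) v + e * eval_at (linear_form p) w"
        by (simp add: eval_at_linear_form algebra_simps)
      then show ?thesis using v w by simp
    qed
    ultimately show "eval_at g (v + e *s w) = 0" by (rule proj[rotated])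
  qed simp
qed

text \<open>
  The affine vector field $(u, v)$ along the line $y = mx + c$ is tangent to the arrangement, and
  $v - mu$ is its component normal to the line.  The Wronskian $W$ of $u$ and $v$ for $d/dm$ at
  fixed $(x,y)$ vanishes for degree reasons.  A point of $Z$ with $p_1 = p_2 = 0$ is dual to the
  line at infinity; it lowers the bound for the degree of $u$ instead of giving a zero of $W$.
\<close>

lemma descent_to_affine_field:
  assumes Z: "finite Z" and card: "2 * a + 2 < card Z" and w: "fat_family Z (Suc a) w"
  shows "\<exists>h U V. h \<noteq> 0 \<and> (U \<noteq> 0 \<or> V \<noteq> 0) \<and>
    degree (to_lines (h * [:U:])) \<le> Suc a \<and>
    ((\<exists>p\<in>Z. coords p $ 1 = 0 \<and> coords p $ 2 = 0) \<longrightarrow> degree (to_lines (h * [:U:])) \<le> a) \<and>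
    degree (to_lines (h * ([:V:] - var_z * [:U:]))) \<le> a \<and>
    (\<forall>p\<in>Z. \<forall>x y m. coords p $ 1 \<noteq> 0 \<or> coords p $ 2 \<noteq> 0 \<longrightarrow>
       coords p $ 1 * x + coords p $ 2 * y + coords p $ 3 = 0 \<longrightarrow>
       eval_at (h * (scale (coords p $ 1) [:U:] + scale (coords p $ 2) [:V:])) (vector [x, y, m]) = 0)"
proof -
  define u0 :: S where "u0 = (\<Sum>i\<in>{..Suc a}. monom (w (Inl i)) i)"
  define n0 :: S where "n0 = (\<Sum>i\<in>{..a}. monom (w (Inr i)) i)"
  have cu: "coeff u0 i = (if i \<le> Suc a then w (Inl i) else 0)" for i
    unfolding u0_def by (subst coeff_sum_monom) auto
  have cn: "coeff n0 i = (if i \<le> a then w (Inr i) else 0)" for i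
    unfolding n0_def by (subst coeff_sum_monom) auto
  have du: "degree u0 \<le> Suc a" by (rule degree_le) (simp add: cu)
  have dn: "degree n0 \<le> a" by (rule degree_le) (simp add: cn)
  define Inf where "Inf \<longleftrightarrow> (\<exists>p\<in>Z. coords p $ 1 = 0 \<and> coords p $ 2 = 0)"
  define e :: nat where "e = (if Inf then 1 else 0)"
  define F where "F = {p \<in> Z. coords p $ 1 \<noteq> 0 \<or> coords p $ 2 \<noteq> 0}"
  have rel: "bin_form (Suc a) (slice_z u0 m c) (t_of c (coords p)) (s_of m (coords p)) +
      coords p $ 2 * bin_form a (slice_z n0 m c) (t_of c (coords p)) (s_of m (coords p)) = 0"
    if p: "p \<in> Z" for p m c
  proof -
    have "(\<Sum>k\<in>fat_index (Suc a). eval2 (w k) m c *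
        fat_monomial (Suc a) (t_of c (coords p)) (s_of m (coords p)) (coords p $ 2) k) = 0"
      using w p unfolding fat_family_def by blast
    then show ?thesis unfolding bin_form_def sum_fat_index
      by (simp add: coeff_slice_z cu cn fat_monomial_def sum_distrib_left mult_ac lessThan_Suc_atMost
          cong: sum.cong_simp)
  qed
  have du': "degree u0 \<le> Suc a - e"
  proof (cases Inf)
    case True
    then obtain p where p: "p \<in> Z" "coords p $ 1 = 0" "coords p $ 2 = 0" by (auto simp: Inf_def)
    then have "coords p $ 3 \<noteq> 0" using coords_nonzero[of p] by (auto simp: vec_eq_iff forall_3)
    then have "coeff (slice_z u0 m c) (Suc a) = 0" for m c
      using rel[OF p(1), of m c] p by (simp add: s_of_def t_of_def bin_form_at_infinity)
    then have "coeff u0 (Suc a) = 0" using eval2_nonzero unfolding coeff_slice_z by blast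
    then have "degree u0 \<le> a"
      using du by (metis degree_0 le_SucE leading_coeff_0_iff zero_le)
    then show ?thesis using True by (simp add: e_def)
  qed (use du in \<open>simp add: e_def\<close>)
  have cardF: "card Z \<le> card F + e"
  proof (cases Inf)
    case True
    then obtain p0 where p0: "p0 \<in> Z" "coords p0 $ 1 = 0" "coords p0 $ 2 = 0" by (auto simp: Inf_def)
    have "p = p0" if "p \<in> Z - F" for p
      using that p0 by (intro cross_product_zero_imp_eq) (auto simp: F_def)
    then have "Z \<subseteq> insert p0 F" by blast
    then have "card Z \<le> card (insert p0 F)" using Z by (intro card_mono) (auto simp: F_def)
    also have "\<dots> \<le> Suc (card F)" by (rule card_insert_le_m1[of "Suc (card F)", simplified]) auto
    finally show ?thesis using True by (simp add: e_def)
  next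
    case False
    then have "Z = F" by (auto simp: F_def Inf_def)
    then show ?thesis by simp
  qed
  \<comment> \<open>Here \<open>var_x\<close> is m, so this is the component v of the field, n0
    being the normal component v - m u.\<close>
  define w0 where "w0 = n0 + var_x * u0"
  define u where "u = to_points u0"
  define v where "v = to_points w0"
  define W where "W = u * pderiv v - v * pderiv u"
  have lines: "to_lines u = u0" "to_lines v = w0" by (simp_all add: u_def v_def to_lines_to_points)
  have linesW: "to_lines W = u0 * line_derivation w0 - w0 * line_derivation u0"
    by (simp add: W_def to_lines_hom lines) (simp add: u_def v_def pderiv_to_points to_lines_to_points)
  have ldx: "line_derivation var_x = 1"
    by (simp add: line_derivation_def deriv_vars)
  \<comment> \<open>The terms m u0 D u0, with D the derivation, cancel. Without this cancellation
    the degree bound would be larger by one.\<close>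
  have W2: "to_lines W = u0 * line_derivation n0 + u0 * u0 - n0 * line_derivation u0"
    unfolding linesW w0_def line_derivation_simps ldx by (simp add: algebra_simps)
  have dW: "degree (to_lines W) \<le> 2 * a + 2 - e"
  proof -
    have "degree (u0 * line_derivation n0) \<le> 2 * a + 2 - e"
      by (rule order.trans[OF degree_mult_le])
        (use du' dn degree_line_derivation[of n0] in \<open>auto simp: e_def\<close>)
    moreover have "degree (u0 * u0) \<le> 2 * a + 2 - e"
      by (rule order.trans[OF degree_mult_le]) (use du' in \<open>auto simp: e_def\<close>)
    moreover have "degree (n0 * line_derivation u0) \<le> 2 * a + 2 - e"
      by (rule order.trans[OF degree_mult_le])
        (use du' dn degree_line_derivation[of u0] in \<open>auto simp: e_def\<close>)
    ultimately show ?thesis unfolding W2 by (intro degree_diff_le degree_add_le)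
  qed
  define f where "f p = scale (coords p $ 1) u + scale (coords p $ 2) v" for p
  have fz: "eval_at (f p) (vector [x, y, m]) = 0"
    if p: "p \<in> F" and on: "coords p $ 1 * x + coords p $ 2 * y + coords p $ 3 = 0" for p x y m
  \<comment> \<open>The slopes with s = 0 belong to lines parallel to the one dual to
    \<open>p\<close>. Division by s fails there, and density in m covers them.\<close>
  proof (rule eval_at_0_by_density[of "{e. s_of (m + e) (coords p) = 0}" _ _ "vector [0, 0, 1]"])
    show "finite {e. s_of (m + e) (coords p) = 0}"
    proof (cases "coords p $ 2 = 0")
      case True
      then show ?thesis using p by (simp add: s_of_def F_def)
    next
      case False
      then have "{e. s_of (m + e) (coords p) = 0} \<subseteq> {- coords p $ 1 / coords p $ 2 - m}"
        by (auto simp: s_of_def field_simps add_eq_0_iff)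
      then show ?thesis by (rule finite_subset) simp
    qed
    fix e assume "e \<notin> {e. s_of (m + e) (coords p) = 0}"
    then have s: "s_of (m + e) (coords p) \<noteq> 0" by simp
    define m' where "m' = m + e"
    define c where "c = y - m' * x"
    let ?s = "s_of m' (coords p)" and ?t = "t_of c (coords p)"
    have s': "?s \<noteq> 0" using s by (simp add: m'_def)
    have "?s * x - ?t = coords p $ 1 * x + coords p $ 2 * y + coords p $ 3"
      by (simp add: s_of_def t_of_def c_def algebra_simps)
    then have t: "?t / ?s = x" using on s' by (simp add: field_simps)
    have dsl: "degree (slice_z u0 m' c) \<le> Suc a" "degree (slice_z n0 m' c) \<le> a"
      by (rule degree_le, simp add: coeff_slice_z cu cn eval2_simps)+
    have vec: "vector [x, y, m] + e *s vector [0, 0, 1] = (vector [x, y, m'] :: complex ^ 3)"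
      by (simp add: vec_eq_iff forall_3 m'_def)
    have ev: "eval_at u (vector [x, y, m']) = poly (slice_z u0 m' c) x"
      "eval_at v (vector [x, y, m']) = poly (slice_z n0 m' c) x + m' * poly (slice_z u0 m' c) x"
      by (simp_all add: u_def v_def eval_at_to_points poly_slice_z w0_def eval_at_simps c_def)
    have "?s ^ Suc a * poly (slice_z u0 m' c) x + coords p $ 2 * (?s ^ a * poly (slice_z n0 m' c) x) = 0"
      using rel[of p m' c] p bin_form_eq_poly[OF s' dsl(1), of ?t] bin_form_eq_poly[OF s' dsl(2), of ?t]
      by (simp add: t F_def)
    then have "?s ^ a * (?s * poly (slice_z u0 m' c) x + coords p $ 2 * poly (slice_z n0 m' c) x) = 0"
      by (simp add: algebra_simps)
    then have "?s * poly (slice_z u0 m' c) x + coords p $ 2 * poly (slice_z n0 m' c) x = 0"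
      using s' by simp
    then show "eval_at (f p) (vector [x, y, m] + e *s vector [0, 0, 1]) = 0"
      unfolding vec f_def by (simp add: eval_at_simps ev s_of_def algebra_simps)
  qed
  have fz': "eval_at (pderiv (f p)) (vector [x, y, m]) = 0"
    if p: "p \<in> F" and on: "coords p $ 1 * x + coords p $ 2 * y + coords p $ 3 = 0" for p x y m
  proof -
    have "poly (slice_z (f p) x y) m = 0" for m using fz[OF p on] by (simp add: poly_slice_z)
    then have "slice_z (f p) x y = 0" using poly_all_0_iff_0 by blast
    then have "slice_z (deriv_z (f p)) x y = 0" by (metis pderiv_0 pderiv_slice_z)
    then show ?thesis using poly_slice_z[of "deriv_z (f p)" x y m] by (simp add: deriv_z_def)
  qed
  have pderiv_f: "pderiv (f p) = scale (coords p $ 1) (pderiv u) + scale (coords p $ 2) (pderiv v)" for p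
    using deriv_linear(3,6) by (simp add: f_def flip: deriv_z_def)
  \<comment> \<open>On the line dual to \<open>p\<close> both (u, v) and its m-derivative are
    annihilated by the nonzero vector (p_1, p_2), so the Wronskian vanishes there. The at least d -
    e such lines exceed its degree, at most 2a + 2 - e.\<close>
  have W0: "W = 0"
  proof (rule line_roots_imp_zero[of F])
    show "finite F" using Z by (simp add: F_def)
    show "degree (to_lines W) < card F" using dW card cardF by (auto simp: e_def split: if_splits)
    fix p x y m assume p: "p \<in> F" and on: "coords p $ 1 * x + coords p $ 2 * y + coords p $ 3 = 0"
    let ?P = "vector [x, y, m] :: complex ^ 3"
    let ?u = "eval_at u ?P" and ?v = "eval_at v ?P" and ?u' = "eval_at (pderiv u) ?P" and ?v' = "eval_at (pderiv v) ?P"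
    have e1: "coords p $ 1 * ?u + coords p $ 2 * ?v = 0"
      using fz[OF p on, of m] by (simp add: f_def eval_at_simps)
    have e2: "coords p $ 1 * ?u' + coords p $ 2 * ?v' = 0"
      using fz'[OF p on, of m] by (simp add: pderiv_f eval_at_simps)
    have "coords p $ 1 * (?u * ?v' - ?v * ?u') =
        (coords p $ 1 * ?u + coords p $ 2 * ?v) * ?v' - ?v * (coords p $ 1 * ?u' + coords p $ 2 * ?v')"
      "coords p $ 2 * (?u * ?v' - ?v * ?u') =
        ?u * (coords p $ 1 * ?u' + coords p $ 2 * ?v') - (coords p $ 1 * ?u + coords p $ 2 * ?v) * ?u'"
      by (simp_all add: algebra_simps)
    then have "coords p $ 1 * (?u * ?v' - ?v * ?u') = 0" "coords p $ 2 * (?u * ?v' - ?v * ?u') = 0"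
      unfolding e1 e2 by simp_all
    then have "?u * ?v' - ?v * ?u' = 0" using p by (auto simp: F_def)
    then show "eval_at W ?P = 0" by (simp add: W_def eval_at_simps)
  qed (auto simp: F_def)
  have nz: "u \<noteq> 0 \<or> v \<noteq> 0"
  proof (rule ccontr)
    assume "\<not> ?thesis"
    then have "u0 = 0" "w0 = 0" using lines by (auto simp: to_lines_hom)
    then have "u0 = 0" "n0 = 0" by (auto simp: w0_def)
    then have "w k = 0" if "k \<in> fat_index (Suc a)" for k
      using that cu cn by (cases k) (auto split: if_splits, metis coeff_0, metis coeff_0 less_Suc_eq_le)
    then show False using w by (auto simp: fat_family_def)
  qed
  obtain h U V where hUV: "h \<noteq> 0" "u = h * [:U:]" "v = h * [:V:]"
    using coprime_proportional_derivatives[of u v] W0 nz by (auto simp: W_def)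
  have n: "to_lines (h * ([:V:] - var_z * [:U:])) = n0"
  proof -
    have "h * ([:V:] - var_z * [:U:]) = v - var_z * u" by (simp add: hUV algebra_simps)
    moreover have "to_lines var_z = var_x" by (simp add: to_lines_def subst3_hom)
    ultimately show ?thesis by (simp add: to_lines_hom lines w0_def)
  qed
  show ?thesis
  proof (intro exI conjI)
    show "h \<noteq> 0" by (rule hUV)
    show "U \<noteq> 0 \<or> V \<noteq> 0" using nz hUV by auto
    show "degree (to_lines (h * [:U:])) \<le> Suc a" using du hUV(2) lines by simp
    show "(\<exists>p\<in>Z. coords p $ 1 = 0 \<and> coords p $ 2 = 0) \<longrightarrow> degree (to_lines (h * [:U:])) \<le> a"
      using du' hUV(2) lines by (auto simp: e_def Inf_def split: if_splits)
    show "degree (to_lines (h * ([:V:] - var_z * [:U:]))) \<le> a" unfolding n by (rule dn)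
    show "\<forall>p\<in>Z. \<forall>x y m. coords p $ 1 \<noteq> 0 \<or> coords p $ 2 \<noteq> 0 \<longrightarrow>
       coords p $ 1 * x + coords p $ 2 * y + coords p $ 3 = 0 \<longrightarrow>
       eval_at (h * (scale (coords p $ 1) [:U:] + scale (coords p $ 2) [:V:])) (vector [x, y, m]) = 0"
    proof (intro ballI allI impI)
      fix p x y m assume p: "p \<in> Z" "coords p $ 1 \<noteq> 0 \<or> coords p $ 2 \<noteq> 0"
        and on: "coords p $ 1 * x + coords p $ 2 * y + coords p $ 3 = 0"
      have "h * (scale (coords p $ 1) [:U:] + scale (coords p $ 2) [:V:]) = f p"
        unfolding f_def hUV(2,3)
        by (rule eval_at_ext) (simp add: eval_at_simps algebra_simps del: mult_pCons_right)
      then show "eval_at (h * (scale (coords p $ 1) [:U:] + scale (coords p $ 2) [:V:])) (vector [x, y, m]) = 0"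
        using fz[of p x y m] p on by (simp add: F_def)
    qed
  qed
qed

text \<open>
  Components of degree $k + 1$ are allowed as long as they are a multiple of the Euler field, which
  becomes the third component $\gamma$ at infinity.
\<close>

lemma affine_field_homogenization:
  assumes U: "\<And>l. Suc k < l \<Longrightarrow> top_part l U = 0"
    and V: "\<And>l. k < l \<Longrightarrow> top_part l V = pCons 0 (top_part l U)"
  shows "\<exists>\<alpha>\<in>forms k. \<exists>\<beta>\<in>forms k. \<exists>\<gamma>\<in>forms k.
    (\<forall>x y. eval_at \<alpha> (vector [x, y, 1]) - x * eval_at \<gamma> (vector [x, y, 1]) = poly (poly U [:y:]) x \<and>
           eval_at \<beta> (vector [x, y, 1]) - y * eval_at \<gamma> (vector [x, y, 1]) = poly (poly V [:y:]) x) \<and>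
    (top_part (Suc k) U = 0 \<longrightarrow> \<gamma> = 0)"
proof -
  define H where "H X = (\<Sum>l\<le>k. \<Sum>j\<le>l. mono3 (coeff (coeff X j) (l - j)) (l - j, j, k - l))" for X
  \<comment> \<open>Chosen such that -x \<gamma> and -y \<gamma> are the parts of degree k + 1 of
    \<open>U\<close> and \<open>V\<close>.\<close>
  define \<gamma> where "\<gamma> = (\<Sum>j\<le>k. mono3 (- coeff (coeff U j) (Suc k - j)) (k - j, j, 0))"
  have mono3_form: "mono3 a (i, j, l) \<in> forms (i + j + l)" for a i j l
    by (auto simp: forms_def mcoeff_mono3)
  have Hf: "H X \<in> forms k" for X unfolding H_def
  proof (intro forms_sum)
    fix l j assume "l \<in> {..k}" "j \<in> {..l}"
    then show "mono3 (coeff (coeff X j) (l - j)) (l - j, j, k - l) \<in> forms k"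
      using mono3_form[of _ "l - j" j "k - l"] by simp
  qed
  have \<gamma>f: "\<gamma> \<in> forms k" unfolding \<gamma>_def
  proof (intro forms_sum)
    fix j assume "j \<in> {..k}"
    then show "mono3 (- coeff (coeff U j) (Suc k - j)) (k - j, j, 0) \<in> forms k"
      using mono3_form[of _ "k - j" j 0] by simp
  qed
  have Vzero: "\<And>l. Suc k < l \<Longrightarrow> top_part l V = 0" using U V by simp
  have cV: "coeff (top_part (Suc k) V) j = (case j of 0 \<Rightarrow> 0 | Suc i \<Rightarrow> coeff (top_part (Suc k) U) i)" for j
    using V[of "Suc k"] by (simp add: coeff_pCons)
  \<comment> \<open>As \<open>top_part (Suc k) V\<close> has no term of degree k + 2, its equality
    with \<open>pCons 0 (top_part (Suc k) U)\<close> excludes the term y^(k+1) from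
    \<open>U\<close>.\<close>
  have U0: "coeff (coeff U (Suc k)) 0 = 0"
    using cV[of "Suc (Suc k)"] by (simp add: coeff_top_part)
  have V0: "coeff (coeff V 0) (Suc k) = 0" using cV[of 0] by (simp add: coeff_top_part)
  have VU: "coeff (coeff V (Suc j)) (k - j) = coeff (coeff U j) (Suc k - j)" if "j \<le> k" for j
    using cV[of "Suc j"] that by (simp add: coeff_top_part)
  have evH: "eval_at (H X) (vector [x, y, 1]) =
      (\<Sum>l\<le>k. \<Sum>j\<le>l. coeff (coeff X j) (l - j) * x ^ (l - j) * y ^ j)" for X x y
    by (simp add: H_def eval_at_sum eval_at_mono3)
  have ev\<gamma>: "eval_at \<gamma> (vector [x, y, 1]) = - (\<Sum>j\<le>k. coeff (coeff U j) (Suc k - j) * x ^ (k - j) * y ^ j)" for x y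
    by (simp add: \<gamma>_def eval_at_sum eval_at_mono3 sum_negf)
  have "eval_at (H U) (vector [x, y, 1]) - x * eval_at \<gamma> (vector [x, y, 1]) = poly (poly U [:y:]) x" for x y
  proof -
    have e: "poly (poly U [:y:]) x =
        (\<Sum>l\<le>Suc k. \<Sum>j\<le>l. coeff (coeff U j) (l - j) * x ^ (l - j) * y ^ j)"
      by (rule poly_poly_expand) (rule U)
    have top: "(\<Sum>j\<le>Suc k. coeff (coeff U j) (Suc k - j) * x ^ (Suc k - j) * y ^ j) =
        x * (\<Sum>j\<le>k. coeff (coeff U j) (Suc k - j) * x ^ (k - j) * y ^ j)"
      unfolding sum_distrib_left by (simp add: U0 Suc_diff_le mult_ac cong: sum.cong_simp)
    show ?thesis unfolding e sum.atMost_Suc[of _ k] top[unfolded sum.atMost_Suc[of _ k]] evH ev\<gamma>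
      by simp
  qed
  moreover have "eval_at (H V) (vector [x, y, 1]) - y * eval_at \<gamma> (vector [x, y, 1]) = poly (poly V [:y:]) x" for x y
  proof -
    have e: "poly (poly V [:y:]) x =
        (\<Sum>l\<le>Suc k. \<Sum>j\<le>l. coeff (coeff V j) (l - j) * x ^ (l - j) * y ^ j)"
      by (rule poly_poly_expand) (rule Vzero)
    have top: "(\<Sum>j\<le>Suc k. coeff (coeff V j) (Suc k - j) * x ^ (Suc k - j) * y ^ j) =
        y * (\<Sum>j\<le>k. coeff (coeff U j) (Suc k - j) * x ^ (k - j) * y ^ j)"
      unfolding sum_distrib_left sum.atMost_Suc_shift by (simp add: V0 VU mult_ac cong: sum.cong_simp)
    show ?thesis unfolding e sum.atMost_Suc[of _ k] top[unfolded sum.atMost_Suc[of _ k]] evH ev\<gamma>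
      by simp
  qed
  moreover have "\<gamma> = 0" if "top_part (Suc k) U = 0"
  proof -
    have "coeff (coeff U j) (Suc k - j) = 0" if "j \<le> k" for j
      using arg_cong[OF \<open>top_part (Suc k) U = 0\<close>, of "\<lambda>p. coeff p j"] that by (simp add: coeff_top_part)
    moreover have "mono3 0 x = 0" for x by (simp add: mono3_def)
    ultimately show ?thesis by (simp add: \<gamma>_def)
  qed
  ultimately show ?thesis using Hf \<gamma>f by blast
qed

text \<open>The reduced field (U, V) no longer depends on m and has degree k = a - \<kappa>, where
  \<kappa> is the degree of h along lines. Its tangency can fail only at lines on which h vanishes
  for all m. There are at most \<kappa> of them, and multiplication by their linear forms restores
  tangency without exceeding degree a.\<close>

theorem descent:
  assumes Z: "finite Z" and card: "2 * a + 2 < card Z" and w: "fat_family Z (Suc a) w"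
  shows "\<exists>\<alpha> \<beta> \<gamma>. log_triple Z a \<alpha> \<beta> \<gamma>"
proof -
  obtain h U V where h: "h \<noteq> 0" and UV: "U \<noteq> 0 \<or> V \<noteq> 0"
    and dU: "degree (to_lines (h * [:U:])) \<le> Suc a"
    and dU': "(\<exists>p\<in>Z. coords p $ 1 = 0 \<and> coords p $ 2 = 0) \<longrightarrow> degree (to_lines (h * [:U:])) \<le> a"
    and dN: "degree (to_lines (h * ([:V:] - var_z * [:U:]))) \<le> a"
    and zero: "\<And>p x y m. p \<in> Z \<Longrightarrow> coords p $ 1 \<noteq> 0 \<or> coords p $ 2 \<noteq> 0 \<Longrightarrow>
       coords p $ 1 * x + coords p $ 2 * y + coords p $ 3 = 0 \<Longrightarrow>
       eval_at (h * (scale (coords p $ 1) [:U:] + scale (coords p $ 2) [:V:])) (vector [x, y, m]) = 0"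
    using descent_to_affine_field[OF assms] by (elim exE conjE) (rule that, assumption+, blast)
  define \<kappa> where "\<kappa> = degree (to_lines h)"
  have h0: "to_lines h \<noteq> 0" using h by (simp add: to_lines_eq_0)
  have deg_mult: "degree (to_lines (h * g)) = \<kappa> + degree (to_lines g)" if "g \<noteq> 0" for g
    using h0 that by (simp add: to_lines_hom \<kappa>_def degree_mult_eq to_lines_eq_0)
  define N where "N = [:V:] - var_z * [:U:]"
  have N0: "N \<noteq> 0"
  proof
    assume "N = 0"
    then have "[:V, - U:] = 0" by (simp add: N_def var_z_def)
    then show False using UV by simp
  qed
  define k where "k = a - \<kappa>"
  have \<kappa>: "\<kappa> \<le> a" and dN': "degree (to_lines N) \<le> k"
    using dN[folded N_def] deg_mult[OF N0] by (auto simp: k_def)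
  have dUk: "degree (to_lines [:U:]) \<le> Suc k" if "U \<noteq> 0"
  proof -
    have "[:U:] \<noteq> 0" using that by simp
    then show ?thesis using deg_mult[of "[:U:]"] dU \<kappa> unfolding k_def by linarith
  qed
  have dUk': "degree (to_lines [:U:]) \<le> k"
    if "U \<noteq> 0" "\<exists>p\<in>Z. coords p $ 1 = 0 \<and> coords p $ 2 = 0"
  proof -
    have "[:U:] \<noteq> 0" using that by simp
    then show ?thesis using deg_mult[of "[:U:]"] dU' that(2) \<kappa> unfolding k_def by linarith
  qed
  \<comment> \<open>The lines y = m x through the origin, c = 0, suffice to read off the homogeneous
    parts.\<close>
  have lineU: "coeff (poly X [:0, m:]) l = eval2 (coeff (to_lines [:X:]) l) m 0" for X m l
  proof -
    have "poly (poly X [:0, m:]) x = poly (slice_z (to_lines [:X:]) m 0) x" for x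
    proof -
      have "poly (slice_z (to_lines [:X:]) m 0) x = poly (poly X [:m * x:]) x"
        by (simp add: poly_slice_z eval_at_to_lines eval_at_const)
      moreover have "poly [:0, m:] x = m * x" by simp
      ultimately show ?thesis using poly_poly_eval[of X "[:0, m:]" x] by metis
    qed
    then have "poly X [:0, m:] = slice_z (to_lines [:X:]) m 0" by (intro poly_ext) blast
    then show ?thesis by (simp add: coeff_slice_z)
  qed
  have topU: "top_part l U = 0" if "degree (to_lines [:U:]) < l \<or> U = 0" for l
  proof -
    have "poly (top_part l U) m = 0" for m
      using that lineU[of U m l] by (auto simp: coeff_on_line_through_origin[symmetric] coeff_eq_0 eval2_simps)
    then show ?thesis using poly_all_0_iff_0 by blast
  qed
  have topU1: "top_part l U = 0" if "Suc k < l" for l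
    using topU[of l] dUk that by (cases "U = 0") auto
  have topUinf: "top_part (Suc k) U = 0" if "\<exists>p\<in>Z. coords p $ 1 = 0 \<and> coords p $ 2 = 0"
    using topU[of "Suc k"] dUk' that by (cases "U = 0") auto
  have topV: "top_part l V = pCons 0 (top_part l U)" if l: "k < l" for l
  proof -
    have "poly (top_part l V - pCons 0 (top_part l U)) m = 0" for m
    proof -
      have 1: "coeff (to_lines N) l = 0" using dN' l by (intro coeff_eq_0) simp
      have "[:V:] = N + var_z * [:U:]" by (simp add: N_def)
      then have "to_lines [:V:] = to_lines (N + var_z * [:U:])" by (rule arg_cong)
      also have "\<dots> = to_lines N + to_lines var_z * to_lines [:U:]" by (simp only: to_lines_hom)
      also have "to_lines var_z = var_x" by (simp add: to_lines_def subst3_hom)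
      finally have 2: "to_lines [:V:] = to_lines N + var_x * to_lines [:U:]" .
      have "var_x * g = smult [:[:0, 1:]:] g" for g :: S by (simp add: var_x_def)
      then have "coeff (to_lines [:V:]) l = [:[:0, 1:]:] * coeff (to_lines [:U:]) l"
        unfolding 2 by (simp add: 1)
      then show ?thesis
        by (simp add: coeff_on_line_through_origin[symmetric] lineU eval2_simps) (simp add: eval2_def)
    qed
    then have "top_part l V - pCons 0 (top_part l U) = 0" using poly_all_0_iff_0 by blast
    then show ?thesis by simp
  qed
  obtain \<alpha> \<beta> \<gamma> where forms: "\<alpha> \<in> forms k" "\<beta> \<in> forms k" "\<gamma> \<in> forms k"
    and ev: "\<And>x y. eval_at \<alpha> (vector [x, y, 1]) - x * eval_at \<gamma> (vector [x, y, 1]) = poly (poly U [:y:]) x"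
      "\<And>x y. eval_at \<beta> (vector [x, y, 1]) - y * eval_at \<gamma> (vector [x, y, 1]) = poly (poly V [:y:]) x"
    and \<gamma>: "top_part (Suc k) U = 0 \<Longrightarrow> \<gamma> = 0"
    using affine_field_homogenization[of k U V, OF topU1 topV] by metis
  define fin where "fin p \<longleftrightarrow> coords p $ 1 \<noteq> 0 \<or> coords p $ 2 \<noteq> 0" for p
  define B where "B = {p \<in> Z. fin p \<and> (\<forall>x y m. coords p $ 1 * x + coords p $ 2 * y + coords p $ 3 = 0 \<longrightarrow>
      eval_at h (vector [x, y, m]) = 0)}"
  have finB: "finite B" using Z by (simp add: B_def)
  have cardB: "card B \<le> \<kappa>"
  proof (rule ccontr)
    assume "\<not> card B \<le> \<kappa>"
    then have "h = 0" using finB by (intro line_roots_imp_zero[of B]) (auto simp: B_def fin_def \<kappa>_def)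
    then show False using h by simp
  qed
  have good: "coords p $ 1 * eval_at \<alpha> v + coords p $ 2 * eval_at \<beta> v + coords p $ 3 * eval_at \<gamma> v = 0"
    if p: "p \<in> Z - B" and v: "eval_at (linear_form p) v = 0" for p v
  proof (cases "fin p")
    case False
    then have inf: "coords p $ 1 = 0" "coords p $ 2 = 0" by (auto simp: fin_def)
    then have "\<gamma> = 0" using p by (intro \<gamma> topUinf) blast
    then show ?thesis using inf by (simp add: eval_at_0)
  next
    case True
    let ?D = "scale (coords p $ 1) [:U:] + scale (coords p $ 2) [:V:] :: S"
    obtain x1 y1 m1 where on1: "coords p $ 1 * x1 + coords p $ 2 * y1 + coords p $ 3 = 0"
      and h1: "eval_at h (vector [x1, y1, m1]) \<noteq> 0"
      using p True by (auto simp: B_def)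
    \<comment> \<open>The direction of the dual line, at fixed m1. Along it h is not identically
      zero, so it can be cancelled from \<open>h * ?D\<close> off a finite set.\<close>
    let ?w = "vector [- coords p $ 2, coords p $ 1, 0] :: complex ^ 3"
    define F where "F = {e. eval_at h (vector [x1, y1, m1] + e *s ?w) = 0}"
    have finF: "finite F" unfolding F_def by (rule finite_zeros_on_line[of _ _ 0]) (use h1 in simp)
    have D0: "eval_at ?D (vector [x1, y1, m1]  + e *s ?w) = 0" for e
    proof (rule eval_at_0_by_density[of "(\<lambda>e'. e' - e) ` F" _ _ ?w])
      show "finite ((\<lambda>e'. e' - e) ` F)" using finF by simp
      fix e' assume "e' \<notin> (\<lambda>e'. e' - e) ` F"
      then have nF: "e + e' \<notin> F" by (force simp: image_iff algebra_simps)
      let ?x = "x1 - (e + e') * coords p $ 2" and ?y = "y1 + (e + e') * coords p $ 1"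
      have vec: "vector [x1, y1, m1] + e *s ?w + e' *s ?w = vector [?x, ?y, m1]"
        "vector [x1, y1, m1] + (e + e') *s ?w = vector [?x, ?y, m1]"
        by (simp_all add: vec_eq_iff forall_3 algebra_simps)
      have "coords p $ 1 * ?x + coords p $ 2 * ?y + coords p $ 3 = 0"
        using on1 by (simp add: algebra_simps)
      then have "eval_at (h * ?D) (vector [?x, ?y, m1]) = 0"
        using zero[of p] p True by (simp add: fin_def)
      moreover have "eval_at h (vector [?x, ?y, m1]) \<noteq> 0" using nF[unfolded F_def mem_Collect_eq vec(2)] .
      ultimately show "eval_at ?D (vector [x1, y1, m1] + e *s ?w + e' *s ?w) = 0"
        unfolding vec(1) eval_at_mult by simp
    qed
    let ?g = "scale (coords p $ 1) \<alpha> + scale (coords p $ 2) \<beta> + scale (coords p $ 3) \<gamma>"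
    have "eval_at ?g v = 0"
    proof (rule eval_zero_on_dual_line[OF _ _ _ v])
      show "?g \<in> forms k" by (intro forms_add forms_scale forms)
      show "coords p $ 1 \<noteq> 0 \<or> coords p $ 2 \<noteq> 0" using True by (simp add: fin_def)
      fix x y assume on: "coords p $ 1 * x + coords p $ 2 * y + coords p $ 3 = 0"
      have diff: "coords p $ 1 * (x - x1) = - (coords p $ 2 * (y - y1))"
      proof -
        have "coords p $ 1 * (x - x1) + coords p $ 2 * (y - y1) =
          (coords p $ 1 * x + coords p $ 2 * y + coords p $ 3) -
          (coords p $ 1 * x1 + coords p $ 2 * y1 + coords p $ 3)" by (simp add: algebra_simps)
        then show ?thesis unfolding on on1 by (simp add: eq_neg_iff_add_eq_0)
      qed
      have "\<exists>e. x = x1 - e * coords p $ 2 \<and> y = y1 + e * coords p $ 1"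
      proof (cases "coords p $ 1 = 0")
        case True': True
        then have "coords p $ 2 \<noteq> 0" using True by (simp add: fin_def)
        then show ?thesis using diff True'
          by (intro exI[of _ "(x1 - x) / coords p $ 2"]) (simp add: field_simps)
      next
        case False
        then show ?thesis using diff
          by (intro exI[of _ "(y - y1) / coords p $ 1"]) (simp add: field_simps)
      qed
      then obtain e where e: "x = x1 - e * coords p $ 2" "y = y1 + e * coords p $ 1" by blast
      have "vector [x1, y1, m1] + e *s ?w = vector [x, y, m1]"
        by (simp add: vec_eq_iff forall_3 e)
      then have D: "coords p $ 1 * poly (poly U [:y:]) x + coords p $ 2 * poly (poly V [:y:]) x = 0"
        using D0[of e] by (simp add: eval_at_simps eval_at_const)
      let ?P = "vector [x, y, 1] :: complex ^ 3"
      have "eval_at ?g ?P = (coords p $ 1 * (eval_at \<alpha> ?P - x * eval_at \<gamma> ?P) +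
          coords p $ 2 * (eval_at \<beta> ?P - y * eval_at \<gamma> ?P)) +
          eval_at \<gamma> ?P * (coords p $ 1 * x + coords p $ 2 * y + coords p $ 3)"
        by (simp add: eval_at_simps algebra_simps)
      then show "eval_at ?g ?P = 0" using D on by (simp add: ev)
    qed
    then show ?thesis by (simp add: eval_at_simps)
  qed
  \<comment> \<open>The power of x only fills up the degree to \<kappa>.\<close>
  define g where "g = var_x ^ (\<kappa> - card B) * (\<Prod>p\<in>B. linear_form p)"
  have g: "g \<in> forms \<kappa>"
  proof -
    have "g \<in> forms ((\<kappa> - card B) + card B)" unfolding g_def
      by (intro forms_mult forms_linear_power forms_vars forms_prod finB linear_form_in_forms)
    then show ?thesis using cardB by simp
  qed
  have "var_x \<noteq> 0" by (simp add: var_x_def)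
  then have g0: "g \<noteq> 0" using finB linear_form_nonzero by (simp add: g_def prod_zero_iff)
  have "log_triple Z a (g * \<alpha>) (g * \<beta>) (g * \<gamma>)"
    unfolding log_triple_def
  proof (intro conjI ballI allI impI)
    have "\<kappa> + k = a" using \<kappa> by (simp add: k_def)
    then show "g * \<alpha> \<in> forms a" "g * \<beta> \<in> forms a" "g * \<gamma> \<in> forms a"
      using forms_mult[OF g] forms by metis+
    fix p v assume p: "p \<in> Z" and v: "eval_at (linear_form p) v = 0"
    show "coords p $ 1 * eval_at (g * \<alpha>) v + coords p $ 2 * eval_at (g * \<beta>) v +
        coords p $ 3 * eval_at (g * \<gamma>) v = 0"
    proof (cases "p \<in> B")
      case True
      then have "eval_at g v = 0" using v finB by (auto simp: g_def eval_at_simps)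
      then show ?thesis by (simp add: eval_at_mult)
    next
      case False
      have "coords p $ 1 * eval_at (g * \<alpha>) v + coords p $ 2 * eval_at (g * \<beta>) v +
          coords p $ 3 * eval_at (g * \<gamma>) v =
        eval_at g v * (coords p $ 1 * eval_at \<alpha> v + coords p $ 2 * eval_at \<beta> v + coords p $ 3 * eval_at \<gamma> v)"
        by (simp add: eval_at_mult algebra_simps)
      then show ?thesis using good[of p v] p v False by simp
    qed
  next
    show "g * \<alpha> * var_y \<noteq> g * \<beta> * var_x \<or> g * \<alpha> * var_z \<noteq> g * \<gamma> * var_x \<or> g * \<beta> * var_z \<noteq> g * \<gamma> * var_y"
    proof (rule ccontr)
      assume "\<not> ?thesis"
      then have "g * (\<alpha> * var_z) = g * (\<gamma> * var_x)" "g * (\<beta> * var_z) = g * (\<gamma> * var_y)"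
        by (simp_all add: mult.assoc)
      then have "\<alpha> * var_z = \<gamma> * var_x" "\<beta> * var_z = \<gamma> * var_y" using g0 by simp_all
      then have "eval_at (\<alpha> * var_z) (vector [x, y, 1]) = eval_at (\<gamma> * var_x) (vector [x, y, 1])"
        "eval_at (\<beta> * var_z) (vector [x, y, 1]) = eval_at (\<gamma> * var_y) (vector [x, y, 1])" for x y
        by simp_all
      then have "poly (poly U [:y:]) x = 0" "poly (poly V [:y:]) x = 0" for x y
        using ev[of x y] by (simp_all add: eval_at_simps mult.commute)
      then have "U = 0" "V = 0" using poly_poly_eq_0 by blast+
      then show False using UV by simp
    qed
  qed
  then show ?thesis by blast
qed

section \<open>Jacobian syzygies and logarithmic vector fields\<close>

lemma poly_root_eval:
  "poly (poly (poly g r) [:b:]) a = eval_at g (vector [a, b, poly (poly r [:b:]) a])"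
  for g :: S
proof -
  have "poly (poly (poly g r) [:b:]) a = poly (poly (poly g [:[:poly (poly r [:b:]) a:]:]) [:b:]) a"
    by (induction g) simp_all
  then show ?thesis by (simp add: eval_at_def)
qed

text \<open>As c \<noteq> 0, the linear form is a constant times z - r with r in C[x][y]; vanishing
  on its zero set makes r a root of \<open>g\<close> as a polynomial in z.\<close>

lemma linear_dvd_aux:
  assumes "c \<noteq> 0" and zero: "\<And>v. a * v $ 1 + b * v $ 2 + c * v $ 3 = 0 \<Longrightarrow> eval_at g v = 0"
  shows "(scale a var_x + scale b var_y + scale c var_z) dvd g"
proof -
  define r :: "complex poly poly" where "r = [:[:0, - a / c:], [:- b / c:]:]"
  have r: "poly (poly r [:y:]) x = - (a * x + b * y) / c" for x y
    using assms(1) by (simp add: r_def field_simps)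
  have "poly g r = 0"
  proof (rule poly_poly_eq_0)
    fix x y
    show "poly (poly (poly g r) [:y:]) x = 0"
      unfolding poly_root_eval r by (rule zero) (use assms(1) in simp)
  qed
  then have "[:- r, 1:] dvd g" by (simp add: poly_eq_0_iff_dvd)
  moreover have eq: "scale a var_x + scale b var_y + scale c var_z = scale c [:- r, 1:]"
  proof (rule eval_at_ext)
    fix v
    have "eval_at [:- r, 1:] v = v $ 3 - poly (poly r [:v $ 2:]) (v $ 1)"
      by (simp add: eval_at_def)
    then show "eval_at (scale a var_x + scale b var_y + scale c var_z) v = eval_at (scale c [:- r, 1:]) v"
      unfolding eval_at_scale r using assms(1) by (simp add: eval_at_simps field_simps)
  qed
  have "[:- r, 1:] = (scale a var_x + scale b var_y + scale c var_z) * scale (inverse c) 1"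
    by (rule eval_at_ext, unfold eq eval_at_mult eval_at_scale eval_at_1) (use assms(1) in simp)
  ultimately show ?thesis by (metis dvd_mult_left)
qed

lemma linear_form_dvd:
  assumes zero: "\<And>v. eval_at (linear_form p) v = 0 \<Longrightarrow> eval_at g v = 0"
  shows "linear_form p dvd g"
proof -
  have vec: "eval_at g (vector [v $ 1, v $ 2, v $ 3]) = eval_at g v" for g v by (rule eval_at_vector)
  consider "coords p $ 3 \<noteq> 0" | "coords p $ 2 \<noteq> 0" | "coords p $ 1 \<noteq> 0"
    using coords_nonzero[of p] by (auto simp: vec_eq_iff forall_3)
  then show ?thesis
  proof cases
    case 1
    then show ?thesis unfolding linear_form_def
      by (rule linear_dvd_aux) (use zero in \<open>simp add: eval_at_linear_form\<close>)
  next
    case 2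
    \<comment> \<open>An involution of the variables that moves a nonzero coefficient to z.\<close>
    let ?\<sigma> = "\<lambda>f. subst3 f var_x var_z var_y"
    have "(scale (coords p $ 1) var_x + scale (coords p $ 3) var_y + scale (coords p $ 2) var_z) dvd ?\<sigma> g"
    proof (rule linear_dvd_aux[OF 2])
      fix v :: "complex ^ 3"
      assume "coords p $ 1 * v $ 1 + coords p $ 3 * v $ 2 + coords p $ 2 * v $ 3 = 0"
      then show "eval_at (?\<sigma> g) v = 0"
        unfolding eval_at_subst3 by (intro zero) (simp add: eval_at_linear_form eval_at_simps add_ac)
    qed
    then obtain k where k: "?\<sigma> g =
      (scale (coords p $ 1) var_x + scale (coords p $ 3) var_y + scale (coords p $ 2) var_z) * k"
      by (auto simp: dvd_def)
    have "g = ?\<sigma> (?\<sigma> g)" by (rule eval_at_ext) (simp add: eval_at_subst3 eval_at_simps vec)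
    also have "\<dots> = linear_form p * ?\<sigma> k"
      unfolding k by (rule eval_at_ext) (simp add: eval_at_subst3 eval_at_simps eval_at_linear_form add_ac)
    finally show ?thesis by simp
  next
    case 3
    let ?\<sigma> = "\<lambda>f. subst3 f var_z var_y var_x"
    have "(scale (coords p $ 3) var_x + scale (coords p $ 2) var_y + scale (coords p $ 1) var_z) dvd ?\<sigma> g"
    proof (rule linear_dvd_aux[OF 3])
      fix v :: "complex ^ 3"
      assume "coords p $ 3 * v $ 1 + coords p $ 2 * v $ 2 + coords p $ 1 * v $ 3 = 0"
      then show "eval_at (?\<sigma> g) v = 0"
        unfolding eval_at_subst3 by (intro zero) (simp add: eval_at_linear_form eval_at_simps add_ac)
    qed
    then obtain k where k: "?\<sigma> g =
      (scale (coords p $ 3) var_x + scale (coords p $ 2) var_y + scale (coords p $ 1) var_z) * k"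
      by (auto simp: dvd_def)
    have "g = ?\<sigma> (?\<sigma> g)" by (rule eval_at_ext) (simp add: eval_at_subst3 eval_at_simps vec)
    also have "\<dots> = linear_form p * ?\<sigma> k"
      unfolding k by (rule eval_at_ext) (simp add: eval_at_subst3 eval_at_simps eval_at_linear_form add_ac)
    finally show ?thesis by simp
  qed
qed

lemma derivation_prod:
  fixes D :: "S \<Rightarrow> S"
  assumes D: "\<And>f g. D (f * g) = D f * g + f * D g" "D 1 = 0" and "finite A"
  shows "D (\<Prod>p\<in>A. l p) = (\<Sum>p\<in>A. D (l p) * (\<Prod>p'\<in>A - {p}. l p'))"
  using assms(3)
proof (induction A rule: finite_induct)
  case (insert x A)
  have "(\<Prod>p'\<in>insert x A - {p}. l p') = l x * (\<Prod>p'\<in>A - {p}. l p')" if "p \<in> A" for p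
  proof -
    have "insert x A - {p} = insert x (A - {p})" using that insert.hyps by auto
    then show ?thesis using insert.hyps by simp
  qed
  then have "(\<Sum>p\<in>A. D (l p) * (\<Prod>p'\<in>insert x A - {p}. l p')) =
      l x * (\<Sum>p\<in>A. D (l p) * (\<Prod>p'\<in>A - {p}. l p'))"
    by (simp add: sum_distrib_left mult.left_commute)
  moreover have "insert x A - {x} = A" using insert.hyps by auto
  ultimately show ?case using insert by (simp add: D)
qed (simp add: D)

text \<open>The vector field (a, b, c) applied to the linear form dual to \<open>p\<close>.\<close>

definition dot :: "P2 \<Rightarrow> S \<Rightarrow> S \<Rightarrow> S \<Rightarrow> S" where
  "dot p a b c = scale (coords p $ 1) a + scale (coords p $ 2) b + scale (coords p $ 3) c"

lemma jacobian_sum: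
  assumes "finite Z"
  shows "a * deriv_x (dual_form Z) + b * deriv_y (dual_form Z) + c * deriv_z (dual_form Z) =
    (\<Sum>p\<in>Z. dot p a b c * dual_form (Z - {p}))"
proof -
  have l: "deriv_x (linear_form p) = scale (coords p $ 1) 1" "deriv_y (linear_form p) = scale (coords p $ 2) 1"
    "deriv_z (linear_form p) = scale (coords p $ 3) 1" for p
    by (simp_all add: linear_form_def deriv_linear deriv_vars) (simp_all add: scale_def)
  have s: "scale k 1 * f = scale k f" "g * scale k f = scale k (g * f)" for k f g by (simp_all add: scale_def)
  have d: "deriv_x (dual_form Z) = (\<Sum>p\<in>Z. scale (coords p $ 1) (dual_form (Z - {p})))"
    "deriv_y (dual_form Z) = (\<Sum>p\<in>Z. scale (coords p $ 2) (dual_form (Z - {p})))"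
    "deriv_z (dual_form Z) = (\<Sum>p\<in>Z. scale (coords p $ 3) (dual_form (Z - {p})))"
    unfolding dual_form_def
    by (simp_all add: derivation_prod[of deriv_x, OF deriv_mult(1) deriv_1(1) assms]
        derivation_prod[of deriv_y, OF deriv_mult(2) deriv_1(2) assms]
        derivation_prod[of deriv_z, OF deriv_mult(3) deriv_1(3) assms] l s)
  show ?thesis unfolding d sum_distrib_left sum.distrib[symmetric]
    by (intro sum.cong refl) (simp add: dot_def scale_def algebra_simps)
qed

lemma linear_form_mult_dual_form:
  "finite Z \<Longrightarrow> p \<in> Z \<Longrightarrow> linear_form p * dual_form (Z - {p}) = dual_form Z"
  by (simp add: dual_form_def prod.remove)

lemma euler_dual_form:
  assumes "finite Z"
  shows "var_x * deriv_x (dual_form Z) + var_y * deriv_y (dual_form Z) + var_z * deriv_z (dual_form Z) =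
    of_nat (card Z) * dual_form Z"
proof -
  have "(\<Sum>p\<in>Z. dot p var_x var_y var_z * dual_form (Z - {p})) = (\<Sum>p\<in>Z. dual_form Z)"
    using linear_form_mult_dual_form[OF assms]
    by (intro sum.cong refl) (simp add: dot_def linear_form_def)
  then show ?thesis unfolding jacobian_sum[OF assms] by simp
qed

lemma dual_form_nonzero: "finite Z \<Longrightarrow> dual_form Z \<noteq> 0"
  by (simp add: dual_form_def prod_zero_iff linear_form_nonzero)

lemma dual_form_in_forms: "finite Z \<Longrightarrow> dual_form Z \<in> forms (card Z)"
  unfolding dual_form_def by (intro forms_prod linear_form_in_forms)

definition syzygy :: "S \<Rightarrow> nat \<Rightarrow> bool" where
  "syzygy f r \<longleftrightarrow> (\<exists>a\<in>forms r. \<exists>b\<in>forms r. \<exists>c\<in>forms r. \<not> (a = 0 \<and> b = 0 \<and> c = 0) \<and>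
     a * deriv_x f + b * deriv_y f + c * deriv_z f = 0)"

lemma mdr_le: "syzygy f r \<Longrightarrow> mdr f \<le> r"
  unfolding mdr_def syzygy_def by (rule Least_le)

text \<open>The relation with coefficients f_y, -f_x, 0, or 1, 0, 0 if f_x = 0, ensures that the
  \<open>LEAST\<close> in \<open>mdr\<close> is attained.\<close>

lemma syzygy_mdr:
  assumes "f \<in> forms n"
  shows "syzygy f (mdr f)"
proof -
  have "\<exists>r. syzygy f r"
  proof (cases "deriv_x f = 0")
    case True
    then have "syzygy f 0" unfolding syzygy_def
      by (intro bexI[of _ 1] bexI[of _ 0]) (simp_all add: forms_1)
    then show ?thesis by blast
  next
    case False
    then have "syzygy f (n - 1)" unfolding syzygy_def
      by (intro bexI[of _ "deriv_y f"] bexI[of _ "- deriv_x f"] bexI[of _ 0])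
        (use forms_deriv[OF assms] in \<open>simp_all add: forms_minus\<close>)
    then show ?thesis by blast
  qed
  then show ?thesis unfolding mdr_def syzygy_def by (rule LeastI_ex)
qed

text \<open>Tangency makes each \<open>dot\<close> divisible by its linear form, so the field maps f
  to G f. By Euler's formula, d times the field minus G times the Euler field annihilates f. This
  difference is nonzero because the field is not a multiple of the Euler field.\<close>

lemma log_triple_imp_syzygy:
  assumes Z: "finite Z" "Z \<noteq> {}" and log: "log_triple Z n \<alpha> \<beta> \<gamma>"
  shows "syzygy (dual_form Z) n"
proof -
  have forms: "\<alpha> \<in> forms n" "\<beta> \<in> forms n" "\<gamma> \<in> forms n" using log by (auto simp: log_triple_def)
  have "\<exists>g. dot p \<alpha> \<beta> \<gamma> = linear_form p * g" if "p \<in> Z" for p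
  proof -
    have "linear_form p dvd dot p \<alpha> \<beta> \<gamma>"
      by (rule linear_form_dvd) (use log that in \<open>auto simp: log_triple_def dot_def eval_at_simps\<close>)
    then show ?thesis by (auto simp: dvd_def)
  qed
  then obtain g where g: "\<And>p. p \<in> Z \<Longrightarrow> dot p \<alpha> \<beta> \<gamma> = linear_form p * g p" by metis
  \<comment> \<open>Stated after multiplication by a linear form: the degree n - 1 of
    \<open>g p\<close> itself would be truncated at n = 0.\<close>
  have gf: "g p * x \<in> forms n" if p: "p \<in> Z" and x: "x \<in> forms 1" for p x
  proof -
    have "dot p \<alpha> \<beta> \<gamma> * x \<in> forms (n + 1)" unfolding dot_def
      by (intro forms_mult forms_add forms_scale forms x)
    then have "linear_form p * (g p * x) \<in> forms (Suc n)" using g[OF p] by (simp add: mult.assoc)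
    then show ?thesis by (rule forms_factor[OF _ linear_form_in_forms linear_form_nonzero])
  qed
  define G where "G = (\<Sum>p\<in>Z. g p)"
  have Gf: "G * x \<in> forms n" if "x \<in> forms 1" for x
    unfolding G_def sum_distrib_right by (intro forms_sum gf that)
  let ?d = "of_nat (card Z) :: complex"
  have d0: "?d \<noteq> 0" using Z by simp
  have sd: "scale ?d f = of_nat (card Z) * f" for f
    by (rule eval_at_ext) (simp add: eval_at_def scale_def)
  let ?a = "scale ?d \<alpha> - G * var_x" and ?b = "scale ?d \<beta> - G * var_y" and ?c = "scale ?d \<gamma> - G * var_z"
  let ?f = "dual_form Z"
  have "(\<Sum>p\<in>Z. dot p \<alpha> \<beta> \<gamma> * dual_form (Z - {p})) = G * ?f"
    unfolding G_def sum_distrib_right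
    by (intro sum.cong refl)
      (simp add: g linear_form_mult_dual_form[OF Z(1)] mult_ac flip: linear_form_mult_dual_form[OF Z(1)])
  then have 1: "\<alpha> * deriv_x ?f + \<beta> * deriv_y ?f + \<gamma> * deriv_z ?f = G * ?f"
    unfolding jacobian_sum[OF Z(1)] .
  have "?a * deriv_x ?f + ?b * deriv_y ?f + ?c * deriv_z ?f =
      of_nat (card Z) * (\<alpha> * deriv_x ?f + \<beta> * deriv_y ?f + \<gamma> * deriv_z ?f) -
      G * (var_x * deriv_x ?f + var_y * deriv_y ?f + var_z * deriv_z ?f)"
    by (simp add: sd algebra_simps)
  also have "\<dots> = 0" unfolding 1 euler_dual_form[OF Z(1)] by (simp add: mult.left_commute)
  finally have syz: "?a * deriv_x ?f + ?b * deriv_y ?f + ?c * deriv_z ?f = 0" .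
  have "\<not> (?a = 0 \<and> ?b = 0 \<and> ?c = 0)"
  proof
    assume "?a = 0 \<and> ?b = 0 \<and> ?c = 0"
    then have e: "scale ?d \<alpha> = G * var_x" "scale ?d \<beta> = G * var_y" "scale ?d \<gamma> = G * var_z" by simp_all
    have sm: "scale ?d (f * x) = scale ?d f * x" for f x by (simp add: scale_def)
    have inj: "f = f'" if "scale ?d f = scale ?d f'" for f f'
    proof (rule mcoeff_ext)
      fix i j k
      have "?d * mcoeff f i j k = ?d * mcoeff f' i j k" using that by (metis mcoeff_simps(5))
      then show "mcoeff f i j k = mcoeff f' i j k" using d0 by simp
    qed
    have "\<alpha> * var_y = \<beta> * var_x" "\<alpha> * var_z = \<gamma> * var_x" "\<beta> * var_z = \<gamma> * var_y"
      by (rule inj, unfold sm e, simp add: mult_ac)+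
    then show False using log by (auto simp: log_triple_def)
  qed
  moreover have "?a \<in> forms n" "?b \<in> forms n" "?c \<in> forms n"
    using forms Gf[OF forms_vars(1)] Gf[OF forms_vars(2)] Gf[OF forms_vars(3)]
    by (auto intro: forms_diff forms_scale)
  ultimately show ?thesis unfolding syzygy_def using syz by blast
qed

lemma exists_point_off_lines:
  assumes "finite A" "p \<notin> A"
  shows "\<exists>w. eval_at (linear_form p) w = 0 \<and> eval_at (\<Prod>q\<in>A. linear_form q) w \<noteq> 0"
  using assms
proof (induction A rule: finite_induct)
  case empty
  have "eval_at (linear_form p) 0 = 0" by (simp add: eval_at_linear_form)
  then show ?case by (auto simp: eval_at_1)
next
  case (insert q A)
  then obtain w0 where w0: "eval_at (linear_form p) w0 = 0" "eval_at (\<Prod>q\<in>A. linear_form q) w0 \<noteq> 0"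
    by auto
  have "p \<noteq> q" using insert.prems by auto
  have "\<exists>w1. eval_at (linear_form p) w1 = 0 \<and> eval_at (linear_form q) w1 \<noteq> 0"
  proof (rule ccontr)
    assume "\<not> ?thesis"
    then have *: "eval_at (linear_form p) w = 0 \<Longrightarrow> eval_at (linear_form q) w = 0" for w by blast
    have "q = p"
      using *[of "vector [0, coords p $ 3, - coords p $ 2]"]
        *[of "vector [- coords p $ 3, 0, coords p $ 1]"] *[of "vector [coords p $ 2, - coords p $ 1, 0]"]
      by (intro cross_product_zero_imp_eq) (simp_all add: eval_at_linear_form mult.commute)
    then show False using \<open>p \<noteq> q\<close> by simp
  qed
  then obtain w1 where w1: "eval_at (linear_form p) w1 = 0" "eval_at (linear_form q) w1 \<noteq> 0" by blast
  have lin: "eval_at (linear_form r) (w0 + e *s w1) = eval_at (linear_form r) w0 + e * eval_at (linear_form r) w1"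
    for r e by (simp add: eval_at_linear_form algebra_simps)
  let ?F = "{e. eval_at (\<Prod>q\<in>A. linear_form q) (w0 + e *s w1) = 0} \<union>
    {- eval_at (linear_form q) w0 / eval_at (linear_form q) w1}"
  have "finite ?F" using finite_zeros_on_line[of _ w0 0 w1] w0(2) by simp
  then obtain e where e: "e \<notin> ?F" using infinite_UNIV_char_0 ex_new_if_finite by blast
  then have "eval_at (linear_form q) (w0 + e *s w1) \<noteq> 0"
    unfolding lin using w1(2) by (auto simp: field_simps add_eq_0_iff)
  then have "eval_at (\<Prod>q\<in>insert q A. linear_form q) (w0 + e *s w1) \<noteq> 0"
    using e insert.hyps by (simp add: eval_at_simps)
  moreover have "eval_at (linear_form p) (w0 + e *s w1) = 0" using w0 w1 by (simp add: lin)
  ultimately show ?case by blast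
qed

text \<open>On the line dual to \<open>p\<close> only the summand of \<open>p\<close> in
  \<open>jacobian_sum\<close> survives, so \<open>dot p a b c\<close> vanishes off the other lines
  and by density on the whole line. A syzygy proportional to the Euler field is zero, since the
  Euler field maps f to d f \<noteq> 0.\<close>

lemma syzygy_imp_log_triple:
  assumes Z: "finite Z" "Z \<noteq> {}" and syz: "syzygy (dual_form Z) n"
  shows "\<exists>\<alpha> \<beta> \<gamma>. log_triple Z n \<alpha> \<beta> \<gamma>"
proof -
  let ?f = "dual_form Z"
  obtain a b c where forms: "a \<in> forms n" "b \<in> forms n" "c \<in> forms n" and nz: "\<not> (a = 0 \<and> b = 0 \<and> c = 0)"
    and rel: "a * deriv_x ?f + b * deriv_y ?f + c * deriv_z ?f = 0"
    using syz by (auto simp: syzygy_def)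
  have "log_triple Z n a b c" unfolding log_triple_def
  proof (intro conjI ballI allI impI forms)
    fix p v assume p: "p \<in> Z" and v: "eval_at (linear_form p) v = 0"
    have van: "eval_at (dot p a b c) w = 0"
      if w: "eval_at (linear_form p) w = 0" "eval_at (dual_form (Z - {p})) w \<noteq> 0" for w
    proof -
      have "0 = (\<Sum>p'\<in>Z. eval_at (dot p' a b c) w * eval_at (dual_form (Z - {p'})) w)"
        using arg_cong[OF rel, of "\<lambda>g. eval_at g w"] unfolding jacobian_sum[OF Z(1)]
        by (simp add: eval_at_simps)
      also have "\<dots> = (\<Sum>p'\<in>Z. if p' = p then eval_at (dot p a b c) w * eval_at (dual_form (Z - {p})) w else 0)"
      proof (intro sum.cong refl)
        fix p' assume "p' \<in> Z"
        show "eval_at (dot p' a b c) w * eval_at (dual_form (Z - {p'})) w =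
          (if p' = p then eval_at (dot p a b c) w * eval_at (dual_form (Z - {p})) w else 0)"
        proof (cases "p' = p")
          case False
          then have "p \<in> Z - {p'}" using p by simp
          then have "eval_at (dual_form (Z - {p'})) w = 0"
            using Z(1) w(1) by (auto simp: dual_form_def eval_at_prod)
          then show ?thesis using False by simp
        qed simp
      qed
      also have "\<dots> = eval_at (dot p a b c) w * eval_at (dual_form (Z - {p})) w" using Z(1) p by simp
      finally show ?thesis using w(2) by simp
    qed
    obtain w where w: "eval_at (linear_form p) w = 0" "eval_at (dual_form (Z - {p})) w \<noteq> 0"
      using exists_point_off_lines[of "Z - {p}" p] Z(1) by (auto simp: dual_form_def)
    have "eval_at (dot p a b c) v = 0"
    proof (rule eval_at_0_by_density)
      show "finite {e. eval_at (dual_form (Z - {p})) (v + e *s (w - v)) = 0}"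
        by (rule finite_zeros_on_line[of _ _ 1]) (use w(2) in simp)
      fix e assume "e \<notin> {e. eval_at (dual_form (Z - {p})) (v + e *s (w - v)) = 0}"
      moreover have "eval_at (linear_form p) (v + e *s (w - v)) =
          (1 - e) * eval_at (linear_form p) v + e * eval_at (linear_form p) w"
        by (simp add: eval_at_linear_form algebra_simps)
      ultimately show "eval_at (dot p a b c) (v + e *s (w - v)) = 0" using v w(1) by (intro van) auto
    qed
    then show "coords p $ 1 * eval_at a v + coords p $ 2 * eval_at b v + coords p $ 3 * eval_at c v = 0"
      by (simp add: dot_def eval_at_simps)
  next
    show "a * var_y \<noteq> b * var_x \<or> a * var_z \<noteq> c * var_x \<or> b * var_z \<noteq> c * var_y"
    proof (rule ccontr)
      assume "\<not> ?thesis"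
      then have e: "a * var_y = b * var_x" "a * var_z = c * var_x" "b * var_z = c * var_y" by auto
      let ?E = "var_x * deriv_x ?f + var_y * deriv_y ?f + var_z * deriv_z ?f"
      have E0: "?E \<noteq> 0" unfolding euler_dual_form[OF Z(1)]
        using dual_form_nonzero[OF Z(1)] Z by simp
      have "a * ?E = a * var_x * deriv_x ?f + a * var_y * deriv_y ?f + a * var_z * deriv_z ?f"
        by (simp add: algebra_simps)
      also have "\<dots> = var_x * (a * deriv_x ?f + b * deriv_y ?f + c * deriv_z ?f)"
        unfolding e by (simp add: algebra_simps)
      finally have a: "a = 0" using rel E0 by simp
      have "b * ?E = b * var_x * deriv_x ?f + b * var_y * deriv_y ?f + b * var_z * deriv_z ?f"
        by (simp add: algebra_simps)
      also have "\<dots> = var_y * (a * deriv_x ?f + b * deriv_y ?f + c * deriv_z ?f)"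
        unfolding e(1)[symmetric] e(3) by (simp add: algebra_simps)
      finally have b: "b = 0" using rel E0 by simp
      have "c * ?E = c * var_x * deriv_x ?f + c * var_y * deriv_y ?f + c * var_z * deriv_z ?f"
        by (simp add: algebra_simps)
      also have "\<dots> = var_z * (a * deriv_x ?f + b * deriv_y ?f + c * deriv_z ?f)"
        unfolding e(2,3)[symmetric] by (simp add: algebra_simps)
      finally have "c = 0" using rel E0 by simp
      then show False using nz a b by simp
    qed
  qed
  then show ?thesis by blast
qed

section \<open>From logarithmic fields to curves with a fat point\<close>

definition restrict_to_line :: "complex \<Rightarrow> complex \<Rightarrow> S \<Rightarrow> complex poly" where
  "restrict_to_line m c f = (\<Sum>x\<in>exponents f. smult (mcoeff f (fst x) (fst (snd x)) (snd (snd x)))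
     (monom 1 (fst x) * [:c, m:] ^ fst (snd x)))"

lemma poly_restrict_to_line: "poly (restrict_to_line m c f) x = eval_at f (vector [x, m * x + c, 1])"
  unfolding eval_at_expand[of f "vector _"]
  by (simp add: restrict_to_line_def poly_sum poly_monom poly_power mult_ac add_ac)

lemma linear_power_degree: "degree ([:c, m:] ^ j) \<le> j"
  by (rule order.trans[OF degree_power_le]) simp

lemma bin_form_linear_power: "bin_form j ([:c, m:] ^ j) t s = (m * t + c * s) ^ j"
proof (induction j)
  case (Suc j)
  have "bin_form (Suc j) ([:c, m:] * [:c, m:] ^ j) t s = (m * t + c * s) * bin_form j ([:c, m:] ^ j) t s"
    by (rule bin_form_linear_mult[OF linear_power_degree])
  then show ?case using Suc by simp
qed (simp add: bin_form_def)

lemma bin_form_sum: "bin_form n (\<Sum>x\<in>A. f x) t s = (\<Sum>x\<in>A. bin_form n (f x) t s)"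
  by (induction A rule: infinite_finite_induct) (simp_all add: bin_form_add)

lemma restrict_to_line_degree:
  assumes "f \<in> forms n"
  shows "degree (restrict_to_line m c f) \<le> n"
  unfolding restrict_to_line_def
proof (rule degree_sum_le)
  fix x assume "x \<in> exponents f"
  then have n: "fst x + fst (snd x) + snd (snd x) = n" by (rule forms_exponents[OF assms])
  have "degree (monom (1::complex) (fst x) * [:c, m:] ^ fst (snd x)) \<le> fst x + fst (snd x)"
    by (rule order.trans[OF degree_mult_le]) (use linear_power_degree in \<open>simp add: degree_monom_eq\<close>)
  then show "degree (smult (mcoeff f (fst x) (fst (snd x)) (snd (snd x)))
      (monom 1 (fst x) * [:c, m:] ^ fst (snd x))) \<le> n"
    using n by (intro order.trans[OF degree_smult_le]) simp
qed (rule finite_exponents)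

lemma bin_form_restrict_to_line:
  assumes "f \<in> forms n"
  shows "bin_form n (restrict_to_line m c f) t s = eval_at f (vector [t, m * t + c * s, s])"
  unfolding eval_at_expand[of f "vector _"] restrict_to_line_def bin_form_sum
proof (intro sum.cong refl)
  fix x assume "x \<in> exponents f"
  then have n: "n = fst x + fst (snd x) + snd (snd x)" using forms_exponents[OF assms] by simp
  have d: "degree (monom (1::complex) (fst x) * [:c, m:] ^ fst (snd x)) \<le> fst x + fst (snd x)"
    by (rule order.trans[OF degree_mult_le]) (use linear_power_degree in \<open>simp add: degree_monom_eq\<close>)
  let ?v = "vector [t, m * t + c * s, s] :: complex ^ 3"
  show "bin_form n (smult (mcoeff f (fst x) (fst (snd x)) (snd (snd x)))
      (monom 1 (fst x) * [:c, m:] ^ fst (snd x))) t s =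
    mcoeff f (fst x) (fst (snd x)) (snd (snd x)) * ?v $ 1 ^ fst x * ?v $ 2 ^ fst (snd x) *
      ?v $ 3 ^ snd (snd x)"
    unfolding n bin_form_smult bin_form_add_degree[OF d] bin_form_monom_mult[OF linear_power_degree] bin_form_linear_power
    by (simp add: mult_ac)
qed

text \<open>The curve has U = \<alpha> - x \<gamma> and N = \<beta> - m \<alpha> - c \<gamma>,
  restricted to y = m x + c. At (t : m t + c s : s), where this line meets the one dual to
  \<open>p\<close>, the value of the equation at \<open>p\<close> is the tangency condition. If U
  and N vanish at x, the field at (x, y, 1) is a multiple of this vector.\<close>

lemma log_triple_imp_fat_curve_at:
  assumes log: "log_triple Z n \<alpha> \<beta> \<gamma>"
    and nz: "\<not> (\<alpha>' * y = \<beta>' * x \<and> \<alpha>' = \<gamma>' * x \<and> \<beta>' = \<gamma>' * y)"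
    and ev: "\<alpha>' = eval_at \<alpha> (vector [x, y, 1])" "\<beta>' = eval_at \<beta> (vector [x, y, 1])"
      "\<gamma>' = eval_at \<gamma> (vector [x, y, 1])" and y: "y = m * x + c"
  shows "\<not> no_fat_at Z (Suc n) m c"
proof
  assume nf: "no_fat_at Z (Suc n) m c"
  have forms: "\<alpha> \<in> forms n" "\<beta> \<in> forms n" "\<gamma> \<in> forms n" using log by (auto simp: log_triple_def)
  let ?r = "restrict_to_line m c"
  define U where "U = ?r \<alpha> - pCons 0 (?r \<gamma>)"
  define N where "N = ?r \<beta> - smult m (?r \<alpha>) - smult c (?r \<gamma>)"
  note d = restrict_to_line_degree[OF forms(1), of m c] restrict_to_line_degree[OF forms(2), of m c]
    restrict_to_line_degree[OF forms(3), of m c]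
  have dU: "degree U \<le> Suc n" unfolding U_def
    using d by (intro degree_diff_le) (auto simp: degree_pCons_eq_if)
  have dN: "degree N \<le> n" unfolding N_def
    using d by (intro degree_diff_le order.trans[OF degree_smult_le]) auto
  have "fat_value (Suc n) U N (t_of c (coords p)) (s_of m (coords p)) (coords p $ 2) = 0" if p: "p \<in> Z" for p
  proof -
    let ?t = "t_of c (coords p)" and ?s = "s_of m (coords p)"
    let ?v = "vector [?t, m * ?t + c * ?s, ?s] :: complex ^ 3"
    have "eval_at (linear_form p) ?v = 0"
      by (simp add: eval_at_linear_form s_of_def t_of_def algebra_simps)
    then have rel: "coords p $ 1 * eval_at \<alpha> ?v + coords p $ 2 * eval_at \<beta> ?v +
        coords p $ 3 * eval_at \<gamma> ?v = 0"
      using log p unfolding log_triple_def by blast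
    have alg: "(?s * A - ?t * C) + coords p $ 2 * (B - m * A - c * C) =
        coords p $ 1 * A + coords p $ 2 * B + coords p $ 3 * C" for A B C
      by (simp add: s_of_def t_of_def algebra_simps)
    have val: "fat_value (Suc n) U N ?t ?s (coords p $ 2) =
        (?s * eval_at \<alpha> ?v - ?t * eval_at \<gamma> ?v) +
        coords p $ 2 * (eval_at \<beta> ?v - m * eval_at \<alpha> ?v - c * eval_at \<gamma> ?v)"
      unfolding fat_value_def U_def N_def
      by (simp add: bin_form_diff bin_form_smult bin_form_Suc[OF d(1)] bin_form_pCons_0[OF d(3)] bin_form_restrict_to_line forms)
    show ?thesis unfolding val alg by (rule rel)
  qed
  then have "fat_curve Z (\<lambda>p. t_of c (coords p)) (\<lambda>p. s_of m (coords p)) (\<lambda>p. coords p $ 2) (Suc n) U N"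
    using dU dN by (auto simp: fat_curve_def)
  then have "U = 0" "N = 0" using nf by (auto simp: no_fat_curve_def)
  then have "poly U x = 0" "poly N x = 0" by simp_all
  then have 1: "\<alpha>' = x * \<gamma>'" and "\<beta>' - m * \<alpha>' - c * \<gamma>' = 0"
    by (simp_all add: U_def N_def poly_restrict_to_line ev y)
  then have 2: "\<beta>' = m * \<alpha>' + c * \<gamma>'" by (simp only: diff_diff_eq eq_iff_diff_eq_0[symmetric])
  have "\<beta>' = y * \<gamma>'" unfolding 2 1 y by (simp add: algebra_simps)
  then show False using nz 1 by (simp add: mult_ac)
qed

text \<open>Otherwise some \<open>\<delta>\<close> excludes curves at almost all centers. Some minor
  E of the field and the Euler field is nonzero; a point (x, y) with E \<noteq> 0 and a slope m with
  \<delta> \<noteq> 0 for the line through it contradict each other.\<close>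

lemma log_triple_imp_fat_curve:
  assumes Z: "finite Z" and log: "log_triple Z n \<alpha> \<beta> \<gamma>"
  shows "\<exists>w. fat_family Z (Suc n) w"
proof (rule ccontr)
  assume "\<not> ?thesis"
  then obtain \<delta> where \<delta>: "\<delta> \<noteq> 0" "\<And>m c. eval2 \<delta> m c \<noteq> 0 \<Longrightarrow> no_fat_at Z (Suc n) m c"
    using fat_dichotomy[OF Z, of "Suc n"] by blast
  have forms: "\<alpha> \<in> forms n" "\<beta> \<in> forms n" "\<gamma> \<in> forms n" using log by (auto simp: log_triple_def)
  obtain E where E: "E \<in> {\<alpha> * var_y - \<beta> * var_x, \<alpha> * var_z - \<gamma> * var_x, \<beta> * var_z - \<gamma> * var_y}" "E \<noteq> 0"
  proof (cases "\<alpha> * var_y = \<beta> * var_x")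
    case False
    then show thesis using that[of "\<alpha> * var_y - \<beta> * var_x"] by simp
  next
    case 1: True
    show thesis
    proof (cases "\<alpha> * var_z = \<gamma> * var_x")
      case False
      then show thesis using that[of "\<alpha> * var_z - \<gamma> * var_x"] by simp
    next
      case True
      then have "\<beta> * var_z \<noteq> \<gamma> * var_y" using log 1 by (auto simp: log_triple_def)
      then show thesis using that[of "\<beta> * var_z - \<gamma> * var_y"] by simp
    qed
  qed
  have Ef: "E \<in> forms (n + 1)"
    using E(1) forms by (auto intro!: forms_diff forms_mult forms_vars simp del: One_nat_def Suc_eq_plus1_left)
  define E' where "E' = subst3 E var_x var_y 1"
  have "E' \<noteq> 0"
  proof
    assume "E' = 0"
    then have z: "eval_at E (vector [x, y, 1]) = 0" for x y
      using eval_at_subst3[of E var_x var_y 1 "vector [x, y, 0]"] by (simp add: E'_def eval_at_simps)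
    \<comment> \<open>The factor z deals with the points at infinity.\<close>
    have "eval_at (E * var_z) v = 0" for v
    proof (cases "v $ 3 = 0")
      case False
      then have "v = v $ 3 *s vector [v $ 1 / v $ 3, v $ 2 / v $ 3, 1]"
        by (simp add: vec_eq_iff forall_3)
      then have "eval_at E v = 0" using eval_at_form_scaled[OF Ef] z by (metis mult_zero_right)
      then show ?thesis by (simp add: eval_at_simps)
    qed (simp add: eval_at_simps)
    then have "E * var_z = 0" by (rule eval_at_eq_0)
    then show False using E(2) by (simp add: var_z_def)
  qed
  moreover have "to_points [:\<delta>:] \<noteq> 0"
  proof
    assume "to_points [:\<delta>:] = 0"
    then have "[:\<delta>:] = to_lines 0" using to_lines_to_points by metis
    then show False using \<delta>(1) by (simp add: to_lines_hom)
  qed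
  ultimately have "E' * to_points [:\<delta>:] \<noteq> 0" by simp
  then obtain v where v: "eval_at (E' * to_points [:\<delta>:]) v \<noteq> 0" using eval_at_eq_0 by blast
  define x y m where "x = v $ 1" "y = v $ 2" "m = v $ 3"
  define c where "c = y - m * x"
  have "eval2 \<delta> m c \<noteq> 0"
    using v by (simp add: eval_at_simps eval_at_to_points eval_at_const x_y_m_def c_def eval2_def)
  then have nf: "no_fat_at Z (Suc n) m c" by (rule \<delta>(2))
  have Exy: "eval_at E (vector [x, y, 1]) \<noteq> 0"
    using v by (simp add: E'_def eval_at_subst3 eval_at_simps x_y_m_def)
  show False
  proof (rule notE[OF log_triple_imp_fat_curve_at[OF log _ refl refl refl] nf])
    show "y = m * x + c" by (simp add: c_def)
    show "\<not> (eval_at \<alpha> (vector [x, y, 1]) * y = eval_at \<beta> (vector [x, y, 1]) * x \<and>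
        eval_at \<alpha> (vector [x, y, 1]) = eval_at \<gamma> (vector [x, y, 1]) * x \<and>
        eval_at \<beta> (vector [x, y, 1]) = eval_at \<gamma> (vector [x, y, 1]) * y)"
      (is "\<not> ?A")
    proof
      assume A: ?A
      have "eval_at (\<alpha> * var_y - \<beta> * var_x) (vector [x, y, 1]) = 0"
        "eval_at (\<alpha> * var_z - \<gamma> * var_x) (vector [x, y, 1]) = 0"
        "eval_at (\<beta> * var_z - \<gamma> * var_y) (vector [x, y, 1]) = 0"
        using A by (simp_all only: eval_at_simps vector_3)
          (simp_all only: mult_1_right diff_self mult.assoc mult.commute[of y x])
      then show False using Exy E(1) by blast
    qed
  qed
qed

lemma mdr_log_triple:
  assumes "finite Z" "Z \<noteq> {}"
  shows "\<exists>\<alpha> \<beta> \<gamma>. log_triple Z (mdr (dual_form Z)) \<alpha> \<beta> \<gamma>"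
  using syzygy_imp_log_triple[OF assms syzygy_mdr[OF dual_form_in_forms[OF assms(1)]]] .

lemma mdr_le_log_triple:
  assumes "finite Z" "Z \<noteq> {}" "log_triple Z n \<alpha> \<beta> \<gamma>"
  shows "mdr (dual_form Z) \<le> n"
  using mdr_le[OF log_triple_imp_syzygy[OF assms]] .

lemma mdr_subset:
  assumes "finite Z" "Z' \<subseteq> Z" "Z' \<noteq> {}"
  shows "mdr (dual_form Z') \<le> mdr (dual_form Z)"
proof -
  obtain \<alpha> \<beta> \<gamma> where "log_triple Z (mdr (dual_form Z)) \<alpha> \<beta> \<gamma>"
    using mdr_log_triple[of Z] assms by auto
  then have "log_triple Z' (mdr (dual_form Z)) \<alpha> \<beta> \<gamma>" using assms(2) by (auto simp: log_triple_def)
  then show ?thesis using assms by (intro mdr_le_log_triple) (auto intro: finite_subset)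
qed

lemma fat_family_mdr:
  assumes "finite Z" "Z \<noteq> {}"
  shows "\<exists>w. fat_family Z (Suc (mdr (dual_form Z))) w"
  using mdr_log_triple[OF assms] log_triple_imp_fat_curve[OF assms(1)] by blast

lemma mdr_le_fat_family:
  assumes "finite Z" "fat_family Z (Suc a) w" "2 * a + 2 < card Z"
  shows "mdr (dual_form Z) \<le> a"
proof -
  have "Z \<noteq> {}" using assms(3) by auto
  then show ?thesis using descent[OF assms(1,3,2)] mdr_le_log_triple[OF assms(1)] by blast
qed

section \<open>Unexpected curves\<close>

text \<open>Dual lines pass through \<open>o'\<close> exactly if their points lie on the line dual
  to \<open>o'\<close>, so this also bounds the number of collinear points of
  \<open>Z\<close>.\<close>

definition concurrent_at_most :: "P2 set \<Rightarrow> nat \<Rightarrow> bool" where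
  "concurrent_at_most Z n \<longleftrightarrow> (\<forall>o'. card {p \<in> Z. eval_at (linear_form p) (coords o') = 0} \<le> n)"

lemma eval_at_linear_form_scaled: "eval_at (linear_form p) (k *s v) = k * eval_at (linear_form p) v"
  using eval_at_form_scaled[OF linear_form_in_forms, of p k v] by simp

lemma dual_line_inj: "inj dual_line"
proof (rule injI)
  fix p q assume eq: "dual_line p = dual_line q"
  have *: "eval_at (linear_form q) v = 0" if "eval_at (linear_form p) v = 0" for v
  proof (cases "v = 0")
    case False
    then obtain o' k where k: "k \<noteq> 0" "coords o' = k *s v" using exists_point by blast
    then have "o' \<in> dual_line p" using that
      by (simp add: dual_line_def vanishes_at_def eval_at_linear_form_scaled)
    then have "o' \<in> dual_line q" using eq by simp
    then show ?thesis using k by (simp add: dual_line_def vanishes_at_def eval_at_linear_form_scaled)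
  qed (simp add: eval_at_linear_form)
  show "p = q"
    using *[of "vector [0, coords p $ 3, - coords p $ 2]"]
      *[of "vector [- coords p $ 3, 0, coords p $ 1]"] *[of "vector [coords p $ 2, - coords p $ 1, 0]"]
    by (intro cross_product_zero_imp_eq) (simp_all add: eval_at_linear_form mult.commute)
qed

lemma max_multiplicity_le_iff:
  assumes "finite Z"
  shows "max_multiplicity (dual_arrangement Z) \<le> n \<longleftrightarrow> concurrent_at_most Z n"
proof -
  have card: "card {L \<in> dual_arrangement Z. q \<in> L} = card {p \<in> Z. eval_at (linear_form p) (coords q) = 0}" for q
  proof -
    have "{L \<in> dual_arrangement Z. q \<in> L} = dual_line ` {p \<in> Z. eval_at (linear_form p) (coords q) = 0}"
      by (auto simp: dual_arrangement_def dual_line_def vanishes_at_def)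
    moreover have "inj_on dual_line A" for A using dual_line_inj by (rule inj_on_subset) simp
    ultimately show ?thesis by (simp add: card_image)
  qed
  have "range (\<lambda>q. card {L \<in> dual_arrangement Z. q \<in> L}) \<subseteq> {..card Z}"
    unfolding card using assms by (auto intro: card_mono)
  then have "finite (range (\<lambda>q. card {L \<in> dual_arrangement Z. q \<in> L}))" by (rule finite_subset) simp
  then show ?thesis unfolding max_multiplicity_def concurrent_at_most_def
    by (subst Max_le_iff) (auto simp: card)
qed

text \<open>Two lines of the arrangement always meet. With n = r + 1 this gives r \<ge> 1, so that j
  > r already implies j \<ge> 2.\<close>

lemma concurrent_at_most_ge_2:
  assumes "concurrent_at_most Z n" "2 \<le> card Z"
  shows "2 \<le> n"
proof -
  have finZ: "finite Z" using assms(2) card.infinite by fastforce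
  obtain p q where pq: "p \<in> Z" "q \<in> Z" "p \<noteq> q"
    using assms(2) finZ by (metis card_le_Suc0_iff_eq not_less_eq_eq numeral_2_eq_2)
  let ?P = "coords p" and ?Q = "coords q"
  let ?v = "vector [?P $ 2 * ?Q $ 3 - ?P $ 3 * ?Q $ 2, ?P $ 3 * ?Q $ 1 - ?P $ 1 * ?Q $ 3,
    ?P $ 1 * ?Q $ 2 - ?P $ 2 * ?Q $ 1] :: complex ^ 3"
  have "?v \<noteq> 0"
  proof
    assume "?v = 0"
    then have "?v $ 1 = 0" "?v $ 2 = 0" "?v $ 3 = 0" by simp_all
    then have "p = q" by (intro cross_product_zero_imp_eq) simp_all
    then show False using pq by simp
  qed
  then obtain o' k where o': "coords o' = k *s ?v" using exists_point by blast
  have "eval_at (linear_form p) ?v = 0" "eval_at (linear_form q) ?v = 0"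
    by (simp_all add: eval_at_linear_form algebra_simps)
  then have "{p, q} \<subseteq> {p \<in> Z. eval_at (linear_form p) (coords o') = 0}"
    using pq by (simp add: o' eval_at_linear_form_scaled)
  then have "card {p, q} \<le> card {p \<in> Z. eval_at (linear_form p) (coords o') = 0}"
    using finZ by (intro card_mono) auto
  also have "\<dots> \<le> n" using assms(1) by (simp add: concurrent_at_most_def)
  finally show ?thesis using pq(3) by simp
qed

lemma line_in_chart:
  "\<exists>o'. \<forall>p. coords p $ 2 = l1 * t_of c (coords p) + l2 * s_of m (coords p) \<longleftrightarrow>
     eval_at (linear_form p) (coords o') = 0"
proof -
  let ?v = "vector [l2, l2 * m - l1 * c - 1, - l1] :: complex ^ 3"
  have "?v \<noteq> 0"
  proof
    assume "?v = 0"
    then have "?v $ 1 = 0" "?v $ 2 = 0" "?v $ 3 = 0" by simp_all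
    then show False by simp
  qed
  then obtain o' k where o': "k \<noteq> 0" "coords o' = k *s ?v" using exists_point by blast
  have "eval_at (linear_form p) ?v =
      l1 * t_of c (coords p) + l2 * s_of m (coords p) - coords p $ 2" for p
    by (simp add: eval_at_linear_form t_of_def s_of_def algebra_simps)
  then have iff: "eval_at (linear_form p) (coords o') = 0 \<longleftrightarrow>
      l1 * t_of c (coords p) + l2 * s_of m (coords p) - coords p $ 2 = 0" for p
    using o' by (simp add: eval_at_linear_form_scaled)
  show ?thesis
  proof (intro exI allI)
    fix p
    show "coords p $ 2 = l1 * t_of c (coords p) + l2 * s_of m (coords p) \<longleftrightarrow>
        eval_at (linear_form p) (coords o') = 0"
      unfolding iff right_minus_eq by (rule eq_commute)
  qed
qed

text \<open>A line has an equation y = l1 t + l2 s unless it passes through the center;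
  \<open>\<delta>\<close> is its linear form at (m, -1, c).\<close>

lemma line_of_point_in_chart:
  "\<exists>\<delta>. \<delta> \<noteq> 0 \<and> (\<forall>m c. eval2 \<delta> m c \<noteq> 0 \<longrightarrow> (\<exists>l1 l2. \<forall>p.
     coords p $ 2 = l1 * t_of c (coords p) + l2 * s_of m (coords p) \<longleftrightarrow>
     eval_at (linear_form p) (coords o') = 0))"
proof -
  let ?v = "coords o'"
  define \<delta> where "\<delta> = cc (?v $ 1) * [:[:0, 1:]:] + cc (?v $ 3) * [:0, 1:] - cc (?v $ 2)"
  have ev: "eval2 \<delta> m c = ?v $ 1 * m + ?v $ 3 * c - ?v $ 2" for m c
    by (simp add: \<delta>_def eval2_def)
  have "\<delta> \<noteq> 0"
  proof
    assume "\<delta> = 0"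
    then have z: "?v $ 1 * m + ?v $ 3 * c - ?v $ 2 = 0" for m c
      using ev[of m c] by (simp add: eval2_simps)
    have "?v = 0" using z[of 0 0] z[of 1 0] z[of 0 1] by (simp add: vec_eq_iff forall_3)
    then show False using coords_nonzero by blast
  qed
  moreover have "\<exists>l1 l2. \<forall>p. coords p $ 2 = l1 * t_of c (coords p) + l2 * s_of m (coords p) \<longleftrightarrow>
     eval_at (linear_form p) (coords o') = 0" if nz: "eval2 \<delta> m c \<noteq> 0" for m c
  proof -
    define \<mu> where "\<mu> = ?v $ 1 * m + ?v $ 3 * c - ?v $ 2"
    have \<mu>: "\<mu> \<noteq> 0" using nz by (simp add: ev \<mu>_def)
    have eq: "\<mu> * (coords p $ 2) - (- ?v $ 3 * t_of c (coords p) + ?v $ 1 * s_of m (coords p)) =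
        - eval_at (linear_form p) ?v" for p
      by (simp add: eval_at_linear_form t_of_def s_of_def \<mu>_def algebra_simps)
    have "coords p $ 2 = - ?v $ 3 / \<mu> * t_of c (coords p) + ?v $ 1 / \<mu> * s_of m (coords p) \<longleftrightarrow>
        \<mu> * (coords p $ 2) - (- ?v $ 3 * t_of c (coords p) + ?v $ 1 * s_of m (coords p)) = 0" for p
      using \<mu> by (simp add: field_simps)
    then show ?thesis unfolding eq by (intro exI[of _ "- ?v $ 3 / \<mu>"] exI[of _ "?v $ 1 / \<mu>"]) simp
  qed
  ultimately show ?thesis by blast
qed

text \<open>
  The smaller exponent of the generic splitting type of the bundle of logarithmic vector fields modulo
  the Euler field.
\<close>

definition multiplicity_index :: "P2 set \<Rightarrow> nat" where
  "multiplicity_index Z = (LEAST a. \<exists>w. fat_family Z (Suc a) w)"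

lemma multiplicity_index_family:
  assumes "finite Z" "Z \<noteq> {}"
  shows "\<exists>w. fat_family Z (Suc (multiplicity_index Z)) w" "multiplicity_index Z \<le> mdr (dual_form Z)"
  unfolding multiplicity_index_def
  using fat_family_mdr[OF assms] by (rule LeastI_ex[OF exI], rule Least_le)

lemma no_fat_at_index:
  assumes "finite Z" "Z \<noteq> {}"
  shows "\<exists>\<delta>. \<delta> \<noteq> 0 \<and> (\<forall>m c. eval2 \<delta> m c \<noteq> 0 \<longrightarrow> no_fat_at Z (multiplicity_index Z) m c)"
proof (cases "multiplicity_index Z")
  \<comment> \<open>\<open>multiplicity_index\<close> only sees the degrees \<open>Suc a\<close>. In
    degree 0 a nonzero constant does not vanish at a point of \<open>Z\<close>.\<close>
  case 0
  have "no_fat_at Z 0 m c" for m c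
    unfolding no_fat_curve_def fat_curve_def
  proof (intro allI impI, elim conjE)
    fix U N :: "complex poly"
    assume d: "degree U \<le> 0" "N = 0 \<or> degree N < 0"
      and v: "\<forall>p\<in>Z. fat_value 0 U N (t_of c (coords p)) (s_of m (coords p)) (coords p $ 2) = 0"
    have "N = 0" using d by simp
    moreover have "coeff U 0 = 0" using v assms(2) \<open>N = 0\<close> by (auto simp: fat_value_def bin_form_def)
    ultimately show "U = 0 \<and> N = 0" using d(1) by (metis le_zero_eq leading_coeff_0_iff)
  qed
  then show ?thesis using 0 by (intro exI[of _ 1]) simp
next
  case (Suc n)
  then have "\<not> (\<exists>w. fat_family Z (Suc n) w)"
    unfolding multiplicity_index_def using not_less_Least[of n "\<lambda>a. \<exists>w. fat_family Z (Suc a) w"] by simp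
  then show ?thesis using fat_dichotomy[OF assms(1), of "Suc n"] Suc by auto
qed

lemma projectionI:
  assumes "projected_points Z (\<lambda>p. t_of c (coords p)) (\<lambda>p. s_of m (coords p))" "in_chart q m c"
  shows "projection Z q m c"
  using assms by (simp add: projection_def center_def)

text \<open>One open set serves all j. The four polynomials ensure that there is no curve of degree
  a, that there is one of degree a + 1, that the projection is in general position, and that, if a +
  2 points of \<open>Z\<close> are collinear, their line misses the center.\<close>

lemma unexpected_generic_center:
  assumes Z: "finite Z" "Z \<noteq> {}"
  shows "generically (\<lambda>q. \<forall>j. int (h0 (sections_through_fat Z j q)) >
      max 0 (int (h0 (sections_through Z j)) - int (j choose 2)) \<longleftrightarrow>
    multiplicity_index Z < j \<and> j + multiplicity_index Z + 1 < card Z \<and> concurrent_at_most Z (multiplicity_index Z + 1))"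
proof -
  let ?a = "multiplicity_index Z"
  obtain \<delta>1 where \<delta>1: "\<delta>1 \<noteq> 0" "\<And>m c. eval2 \<delta>1 m c \<noteq> 0 \<Longrightarrow> no_fat_at Z ?a m c"
    using no_fat_at_index[OF Z] by blast
  obtain \<delta>2 where \<delta>2: "\<delta>2 \<noteq> 0" "\<And>m c. eval2 \<delta>2 m c \<noteq> 0 \<Longrightarrow> \<not> no_fat_at Z (Suc ?a) m c"
    using multiplicity_index_family(1)[OF Z] fat_family_imp_fat_curve by blast
  obtain \<delta>3 where \<delta>3: "\<delta>3 \<noteq> 0" "\<And>m c. eval2 \<delta>3 m c \<noteq> 0 \<Longrightarrow>
      projected_points Z (\<lambda>p. t_of c (coords p)) (\<lambda>p. s_of m (coords p))"
    using general_position[OF Z(1)] by blast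
  obtain \<delta>4 where \<delta>4: "\<delta>4 \<noteq> 0" "\<And>m c. eval2 \<delta>4 m c \<noteq> 0 \<Longrightarrow> \<not> concurrent_at_most Z (?a + 1) \<Longrightarrow>
      \<exists>l1 l2. ?a + 2 \<le> card {p \<in> Z. coords p $ 2 = l1 * t_of c (coords p) + l2 * s_of m (coords p)}"
  proof (cases "concurrent_at_most Z (?a + 1)")
    case True
    then show thesis using that[of 1] by simp
  next
    case False
    then obtain o' where "\<not> card {p \<in> Z. eval_at (linear_form p) (coords o') = 0} \<le> ?a + 1"
      unfolding concurrent_at_most_def by blast
    then have o': "?a + 2 \<le> card {p \<in> Z. eval_at (linear_form p) (coords o') = 0}" by simp
    obtain \<delta> where \<delta>: "\<delta> \<noteq> 0" "\<And>m c. eval2 \<delta> m c \<noteq> 0 \<Longrightarrow> \<exists>l1 l2. \<forall>p.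
        coords p $ 2 = l1 * t_of c (coords p) + l2 * s_of m (coords p) \<longleftrightarrow>
        eval_at (linear_form p) (coords o') = 0"
      using line_of_point_in_chart[of o'] by blast
    show thesis
    proof (rule that[OF \<delta>(1)])
      fix m c assume "eval2 \<delta> m c \<noteq> 0"
      then obtain l1 l2 where "\<forall>p. coords p $ 2 = l1 * t_of c (coords p) + l2 * s_of m (coords p) \<longleftrightarrow>
        eval_at (linear_form p) (coords o') = 0" using \<delta>(2) by blast
      then show "\<exists>l1 l2. ?a + 2 \<le> card {p \<in> Z. coords p $ 2 = l1 * t_of c (coords p) + l2 * s_of m (coords p)}"
        using o' by (intro exI[of _ l1] exI[of _ l2]) simp
    qed
  qed
  show ?thesis
  proof (rule generically_chart[of "\<delta>1 * \<delta>2 * \<delta>3 * \<delta>4"])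
    show "\<delta>1 * \<delta>2 * \<delta>3 * \<delta>4 \<noteq> 0" using \<delta>1(1) \<delta>2(1) \<delta>3(1) \<delta>4(1) by simp
    fix q m c assume ch: "in_chart q m c" and "eval2 (\<delta>1 * \<delta>2 * \<delta>3 * \<delta>4) m c \<noteq> 0"
    then have nz: "eval2 \<delta>1 m c \<noteq> 0" "eval2 \<delta>2 m c \<noteq> 0" "eval2 \<delta>3 m c \<noteq> 0" "eval2 \<delta>4 m c \<noteq> 0"
      by (auto simp: eval2_simps)
    interpret projection Z q m c using projectionI[OF \<delta>3(2)[OF nz(3)] ch] .
    have nf: "no_fat_curve Z T Sg Y ?a" by (rule \<delta>1(2)[OF nz(1)])
    obtain U N where UN: "fat_curve Z T Sg Y (Suc ?a) U N" "U \<noteq> 0 \<or> N \<noteq> 0"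
      using \<delta>2(2)[OF nz(2)] by (auto simp: no_fat_curve_def)
    have card2: "2 * ?a + 1 \<le> card Z" using no_fat_curve_card[OF Z(1) nf] .
    define b where "b = card Z - 1 - ?a"
    have b: "card Z = ?a + b + 1" "?a \<le> b" using card2 by (auto simp: b_def)
    show "\<forall>j. int (h0 (sections_through_fat Z j q)) >
        max 0 (int (h0 (sections_through Z j)) - int (j choose 2)) \<longleftrightarrow>
      ?a < j \<and> j + ?a + 1 < card Z \<and> concurrent_at_most Z (?a + 1)"
      unfolding unexpected_at_iff
    proof (intro allI iffI)
      fix j assume L: "\<not> no_fat_curve Z T Sg Y j \<and> (\<exists>w. fat_rel j w \<and> \<not> full_rel j w)"
      then obtain w where w: "fat_rel j w" "\<not> full_rel j w" by blast
      have aj: "?a < j" using L no_fat_curve_mono[OF nf, of j] by (meson not_le)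
      have "j < b"
      proof (rule ccontr)
        assume "\<not> j < b"
        then have "w p = 0" if "p \<in> Z" for p
          using fat_rel_trivial[OF nf b, of j w] w(1) that by simp
        then have "full_rel j w" by (simp add: full_rel_def)
        then show False using w(2) by simp
      qed
      moreover have "concurrent_at_most Z (?a + 1)"
      proof (rule ccontr)
        assume "\<not> ?thesis"
        then obtain l1 l2 where "?a + 2 \<le> card {p \<in> Z. Y p = l1 * T p + l2 * Sg p}"
          using \<delta>4(2)[OF nz(4)] by blast
        then have "full_rel j w" using fat_rel_imp_full_rel_on_line[OF UN aj _ w(1)] by blast
        then show False using w(2) by simp
      qed
      ultimately show "?a < j \<and> j + ?a + 1 < card Z \<and> concurrent_at_most Z (?a + 1)"
        using aj b by simp
    next
      fix j assume R: "?a < j \<and> j + ?a + 1 < card Z \<and> concurrent_at_most Z (?a + 1)"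
      then have j: "?a < j" "j < b" using b by auto
      have "card {p \<in> Z. Y p = l1 * T p + l2 * Sg p} \<le> ?a + 1" for l1 l2
      proof -
        obtain o' where "\<forall>p. Y p = l1 * T p + l2 * Sg p \<longleftrightarrow> eval_at (linear_form p) (coords o') = 0"
          using line_in_chart[of l1 c l2 m] by blast
        then show ?thesis using R by (simp add: concurrent_at_most_def)
      qed
      then have "\<exists>w. fat_rel j w \<and> \<not> full_rel j w"
        by (rule fat_rel_not_full_rel[OF nf b(1) UN j])
      moreover have "\<not> no_fat_curve Z T Sg Y j"
        using no_fat_curve_mono[of Z T Sg Y j "Suc ?a"] j(1) \<delta>2(2)[OF nz(2)] by auto
      ultimately show "\<not> no_fat_curve Z T Sg Y j \<and> (\<exists>w. fat_rel j w \<and> \<not> full_rel j w)" by blast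
    qed
  qed
qed

text \<open>The condition found for a generic center does not mention the center, so holding
  generically is the same as holding.\<close>

lemma admits_unexpected_iff:
  assumes Z: "finite Z" "Z \<noteq> {}"
  shows "admits_unexpected Z j \<longleftrightarrow> 2 \<le> j \<and> multiplicity_index Z < j \<and> j + multiplicity_index Z + 1 < card Z \<and>
    concurrent_at_most Z (multiplicity_index Z + 1)" (is "_ \<longleftrightarrow> 2 \<le> j \<and> ?C")
proof -
  have gen: "generically (\<lambda>q. int (h0 (sections_through_fat Z j q)) >
      max 0 (int (h0 (sections_through Z j)) - int (j choose 2)) \<longleftrightarrow> ?C)"
    using unexpected_generic_center[OF Z] by (rule generically_mono) blast
  have "generically (\<lambda>q. int (h0 (sections_through_fat Z j q)) >
      max 0 (int (h0 (sections_through Z j)) - int (j choose 2))) \<longleftrightarrow> ?C"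
  proof
    assume "generically (\<lambda>q. int (h0 (sections_through_fat Z j q)) >
      max 0 (int (h0 (sections_through Z j)) - int (j choose 2)))"
    from generically_conj[OF this gen] have "generically (\<lambda>q. ?C)" by (rule generically_mono) blast
    then show ?C by (simp only: generically_const)
  next
    assume C: ?C
    show "generically (\<lambda>q. int (h0 (sections_through_fat Z j q)) >
      max 0 (int (h0 (sections_through Z j)) - int (j choose 2)))"
      by (rule generically_mono[OF gen]) (use C in blast)
  qed
  then show ?thesis by (simp add: admits_unexpected_def)
qed

lemma not_admits_unexpected_empty: "\<not> admits_unexpected {} j"
proof
  assume "admits_unexpected {} j"
  then have g: "generically (\<lambda>q. int (h0 (sections_through_fat {} j q)) >
      max 0 (int (h0 (sections_through {} j)) - int (j choose 2)))" by (simp add: admits_unexpected_def)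
  have "generically (\<lambda>q. \<not> int (h0 (sections_through_fat {} j q)) >
      max 0 (int (h0 (sections_through {} j)) - int (j choose 2)))"
  proof (rule generically_chart[of 1])
    fix q m c assume "in_chart q m c"
    then interpret projection "{}" q m c by (intro projectionI) (simp_all add: projected_points_def)
    show "\<not> int (h0 (sections_through_fat {} j q)) >
      max 0 (int (h0 (sections_through {} j)) - int (j choose 2))"
      unfolding unexpected_at_iff by (simp add: full_rel_def)
  qed simp
  from generically_conj[OF g this] have "generically (\<lambda>q. False)"
    by (rule generically_mono) blast
  then show False using generically_False by simp
qed

section \<open>Irreducibility of the generic curve\<close>

lemma form_not_unit:
  assumes "f \<in> forms (Suc n)"
  shows "\<not> f dvd 1"
proof
  assume "f dvd 1"
  then obtain g where "1 = f * g" by (auto simp: dvd_def)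
  then have "1 = eval_at f 0 * eval_at g 0" by (metis eval_at_1 eval_at_mult)
  moreover have "eval_at f 0 = 0" using eval_at_form_scaled[OF assms, of 0 0] by simp
  ultimately show False by simp
qed

text \<open>By the fundamental theorem of algebra A is constant on each line y = const other than y
  = 0, and on x = 1, which connects these lines.\<close>

lemma const_if_no_zero:
  fixes A :: "complex poly poly"
  assumes "\<And>x y. poly (poly A [:y:]) x = 0 \<Longrightarrow> x = 0 \<and> y = 0"
  shows "\<exists>k. A = [:[:k:]:]"
proof -
  have const: "constant (poly p)" if "\<And>x. poly p x \<noteq> 0" for p :: "complex poly"
    using fundamental_theorem_of_algebra that by blast
  have 1: "poly (poly A [:y:]) x = poly (poly A [:y:]) 1" if "y \<noteq> 0" for x y
    using const[of "poly A [:y:]"] assms that unfolding constant_def by blast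
  define B where "B = map_poly (\<lambda>h. poly h 1) A"
  have B: "poly B y = poly (poly A [:y:]) 1" for y
    unfolding B_def by (induction A) (simp_all add: map_poly_pCons)
  have "constant (poly B)"
  proof (rule const)
    fix y
    show "poly B y \<noteq> 0" using assms[of y 1] unfolding B by auto
  qed
  then have 2: "poly (poly A [:y:]) 1 = poly B 0" for y
    unfolding B[symmetric] constant_def by blast
  \<comment> \<open>The factor y covers the line y = 0, where A may have a zero at the
    origin.\<close>
  have "[:0, 1:] * (A - [:[:poly B 0:]:]) = 0"
  proof (rule poly_poly_eq_0)
    fix x y
    show "poly (poly ([:0, 1:] * (A - [:[:poly B 0:]:])) [:y:]) x = 0"
      using 1[of y x] 2[of y] by (cases "y = 0") simp_all
  qed
  then have "A - [:[:poly B 0:]:] = 0" by simp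
  then show ?thesis by (intro exI[of _ "poly B 0"]) simp
qed

context projection
begin

text \<open>In the coordinates (s, t, y) the equation has degree at most one in y, so one of two
  factors is free of y. A zero (s, t) of that factor other than the origin would be a common root of
  U and N, which the hypotheses exclude; hence the factor is constant.\<close>

lemma fat_section_irreducible:
  assumes nf: "no_fat_curve Z T Sg Y a" and nf': "\<And>p. p \<in> Z \<Longrightarrow> no_fat_curve (Z - {p}) T Sg Y a"
    and C: "C \<in> sections_through_fat Z (Suc a) q" "C \<noteq> 0"
  shows "irreducible C"
proof -
  have Cf: "C \<in> forms (Suc a)" using C(1) by (auto simp: sections_through_fat_def sections_through_def)
  moreover have "\<forall>x\<in>jet_index (Suc a). jet q x C = 0"
    using C(1) unfolding sections_through_fat_eq[OF chart] by blast
  ultimately obtain U N where UN: "degree U \<le> Suc a" "N = 0 \<or> degree N < Suc a" "C = fat_form (Suc a) U N m c"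
    using exists_fat_form[OF _ chart] by blast
  have curve: "fat_curve Z T Sg Y (Suc a) U N" using C(1) UN
    by (auto simp: fat_curve_def sections_through_fat_def sections_through_def vanishes_at_def eval_at_fat_form)
  have nz: "U \<noteq> 0 \<or> N \<noteq> 0" using C(2) UN(3) by (auto simp: fat_form_def scale_def)
  have no_root: "t0 = 0 \<and> s0 = 0" if "bin_form (Suc a) U t0 s0 = 0" "bin_form a N t0 s0 = 0" for t0 s0
    using fat_curve_common_root[OF curve nz that] nf nf' by blast
  \<comment> \<open>The coordinate change after which the variables x, y, z stand for s, t and the
    old y.\<close>
  define \<Theta> where "\<Theta> f = subst3 f (var_x - scale m var_z) var_z (- var_y - scale c var_z)" for f
  have ev\<Theta>: "eval_at (\<Theta> f) (vector [x, y, z]) = eval_at f (vector [x - m * z, z, - y - c * z])" for f x y z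
    by (simp add: \<Theta>_def eval_at_subst3 eval_at_simps)
  have \<Theta>mult: "\<Theta> (f * g) = \<Theta> f * \<Theta> g" for f g by (simp add: \<Theta>_def subst3_hom)
  have \<Theta>inj: "f = g" if "\<Theta> f = \<Theta> g" for f g
  proof (rule eval_at_ext)
    fix v :: "complex ^ 3"
    have "v = vector [(v $ 1 + m * v $ 2) - m * v $ 2, v $ 2, - (- v $ 3 - c * v $ 2) - c * v $ 2]"
      by (simp add: vec_eq_iff forall_3)
    then show "eval_at f v = eval_at g v" using ev\<Theta> that by metis
  qed
  have ev\<Theta>C: "eval_at (\<Theta> C) (vector [x, y, z]) = bin_form (Suc a) U y x + z * bin_form a N y x" for x y z
    unfolding ev\<Theta> UN(3) eval_at_fat_form by (simp add: fat_value_def t_of_def s_of_def)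
  have zslice: "degree (slice_z (\<Theta> C) x y) \<le> 1" for x y
  proof -
    have "slice_z (\<Theta> C) x y = [:bin_form (Suc a) U y x, bin_form a N y x:]"
      by (rule poly_ext) (simp add: poly_slice_z ev\<Theta>C)
    then show ?thesis by simp
  qed
  have deg: "degree (\<Theta> C) \<le> 1"
  proof (rule degree_le, intro allI impI)
    fix k :: nat assume "1 < k"
    then have "coeff (slice_z (\<Theta> C) x y) k = 0" for x y
      using zslice[of x y] by (intro coeff_eq_0) simp
    then show "coeff (\<Theta> C) k = 0" using eval2_nonzero unfolding coeff_slice_z by blast
  qed
  have unit: "f dvd 1" if CAB: "C = f * g" and d: "degree (\<Theta> f) = 0" for f g
  proof -
    obtain A where A: "\<Theta> f = [:A:]" using d degree_eq_zeroE by blast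
    have "\<exists>k. A = [:[:k:]:]"
    proof (rule const_if_no_zero)
      fix x y assume "poly (poly A [:y:]) x = 0"
      then have "eval_at (\<Theta> f) (vector [x, y, z]) = 0" for z by (simp add: A eval_at_const)
      then have "eval_at (\<Theta> C) (vector [x, y, z]) = 0" for z by (simp add: CAB \<Theta>mult eval_at_mult)
      then have z: "bin_form (Suc a) U y x + z * bin_form a N y x = 0" for z unfolding ev\<Theta>C .
      have "bin_form (Suc a) U y x = 0" using z[of 0] by simp
      moreover from this have "bin_form a N y x = 0" using z[of 1] by simp
      ultimately show "x = 0 \<and> y = 0" using no_root by blast
    qed
    then obtain k where k: "\<Theta> f = [:[:[:k:]:]:]" using A by auto
    have "f = [:[:[:k:]:]:]"
      by (rule \<Theta>inj, unfold k, rule eval_at_ext) (simp add: \<Theta>_def eval_at_subst3 eval_at_const)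
    moreover have "k \<noteq> 0" using calculation C(2) CAB by auto
    ultimately show ?thesis by (intro dvdI[of _ _ "[:[:[:inverse k:]:]:]"]) (simp add: one_pCons)
  qed
  show ?thesis
  proof (rule irreducibleI)
    show "C \<noteq> 0" by (rule C)
    show "\<not> C dvd 1" by (rule form_not_unit[OF Cf])
    fix f g assume CAB: "C = f * g"
    then have "\<Theta> C = \<Theta> f * \<Theta> g" by (simp add: \<Theta>mult)
    moreover have "\<Theta> C \<noteq> 0"
    proof
      assume "\<Theta> C = 0"
      then have "\<Theta> C = \<Theta> 0" by (simp add: \<Theta>_def subst3_hom)
      then show False using \<Theta>inj C(2) by blast
    qed
    ultimately have "degree (\<Theta> f) + degree (\<Theta> g) \<le> 1" using deg by (auto simp: degree_mult_eq)
    then have "degree (\<Theta> f) = 0 \<or> degree (\<Theta> g) = 0" by linarith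
    then show "f dvd 1 \<or> g dvd 1" using unit[OF CAB] unit[of g f] CAB by (auto simp: mult.commute)
  qed
qed

text \<open>The line joining the center and \<open>p\<close> supplies both the missing point and one
  more order of vanishing at the center.\<close>

lemma reducible_fat_section:
  assumes p: "p \<in> Z" and f: "\<not> no_fat_curve (Z - {p}) T Sg Y (Suc a)"
  shows "\<exists>C\<in>sections_through_fat Z (Suc (Suc a)) q. C \<noteq> 0 \<and> \<not> irreducible C"
proof -
  have "center q m c" by (rule center_axioms)
  then interpret del: center "Z - {p}" q m c .
  obtain f where f: "f \<in> sections_through_fat (Z - {p}) (Suc a) q" "f \<noteq> 0"
    using f unfolding del.sections_through_fat_zero_iff[symmetric] by blast
  then have ff: "f \<in> forms (Suc a)" "\<And>p'. p' \<in> Z \<Longrightarrow> p' \<noteq> p \<Longrightarrow> eval_at f (coords p') = 0"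
    "vanishes_to_order a f q"
    by (auto simp: sections_through_fat_def sections_through_def vanishes_at_def)
  define l where "l = scale (- T p) var_x + scale (- c * Sg p - m * T p) var_y + scale (- Sg p) var_z"
  have evl: "eval_at l v = Sg p * t_of c v - T p * s_of m v" for v
    unfolding l_def t_of_def[of c v] s_of_def[of m v] by (simp add: eval_at_simps algebra_simps)
  have lf: "l \<in> forms (Suc 0)" unfolding l_def One_nat_def[symmetric]
    by (intro forms_add forms_scale forms_vars)
  have "l \<noteq> 0"
  proof
    assume "l = 0"
    then have z: "Sg p * t_of c v - T p * s_of m v = 0" for v using evl[of v] by (simp add: eval_at_0)
    have 1: "t_of c (vector [0, 0, -1]) = 1" "s_of m (vector [0, 0, -1]) = 0"
      "t_of c (vector [1, 0, 0]) = 0" "s_of m (vector [1, 0, 0]) = 1"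
      by (simp_all add: t_of_def s_of_def)
    have "Sg p = 0" using z[of "vector [0, 0, -1]"] by (simp add: 1)
    moreover have "T p = 0" using z[of "vector [1, 0, 0]"] by (simp add: 1)
    ultimately show False using nonzero[OF p] by simp
  qed
  have "l * f \<in> sections_through_fat Z (Suc (Suc a)) q"
    unfolding sections_through_fat_def sections_through_def
  proof (intro CollectI conjI ballI)
    show "l * f \<in> forms (Suc (Suc a))" using forms_mult[OF lf ff(1)] by simp
    have "eval_at l (coords p) = 0" unfolding evl right_minus_eq by (rule mult.commute)
    then show "vanishes_at (l * f) p'" if "p' \<in> Z" for p'
      using ff(2)[OF that] by (cases "p' = p") (simp_all add: vanishes_at_def eval_at_mult)
    have "vanishes_at l q" unfolding vanishes_at_def evl t_s_of_center[OF chart] by simp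
    then show "vanishes_to_order (Suc (Suc a) - 1) (l * f) q"
      using vanishes_to_order_linear_mult[OF l_def _ ff(3)] by simp
  qed
  moreover have "\<not> irreducible (l * f)"
    using form_not_unit[OF lf] form_not_unit[OF ff(1)] by (auto simp: irreducible_def)
  ultimately show ?thesis using \<open>l \<noteq> 0\<close> f(2) by (intro bexI[of _ "l * f"]) auto
qed

end

text \<open>If mdr drops to k < r for some Z - {p}, that set has generic curves of degree at most r,
  and the line joining the center to p completes them to reducible curves; two nonempty open sets
  meet, so this contradicts generic irreducibility. If mdr never drops, no Z - {p} has a curve of
  degree r at a generic center.\<close>

lemma generic_irreducibility:
  assumes Z: "finite Z" and r: "r = mdr (dual_form Z)" "1 \<le> r" "2 * r + 2 < card Z"
    and index: "multiplicity_index Z = r" and adm: "admits_unexpected Z (r + 1)"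
  shows "generically (\<lambda>q. \<forall>C. unexpected_curve Z (r + 1) q C \<longrightarrow> irreducible C) \<longleftrightarrow>
    (\<forall>p\<in>Z. r = mdr (dual_form (Z - {p})))"
proof -
  have Zne: "Z \<noteq> {}" using r(3) by auto
  have del: "Z - {p} \<noteq> {}" "card (Z - {p}) = card Z - 1" "mdr (dual_form (Z - {p})) \<le> r"
    if "p \<in> Z" for p
  proof -
    show c: "card (Z - {p}) = card Z - 1" using that by simp
    show ne: "Z - {p} \<noteq> {}"
    proof
      assume "Z - {p} = {}"
      then have "card (Z - {p}) = 0" by (simp only: card.empty)
      then show False using c r(3) by linarith
    qed
    show "mdr (dual_form (Z - {p})) \<le> r" unfolding r(1) by (rule mdr_subset[OF Z _ ne]) auto
  qed
  obtain \<delta>3 where \<delta>3: "\<delta>3 \<noteq> 0" "\<And>m c. eval2 \<delta>3 m c \<noteq> 0 \<Longrightarrow>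
      projected_points Z (\<lambda>p. t_of c (coords p)) (\<lambda>p. s_of m (coords p))"
    using general_position[OF Z] by blast
  show ?thesis
  proof
    assume eq: "\<forall>p\<in>Z. r = mdr (dual_form (Z - {p}))"
    obtain \<delta>1 where \<delta>1: "\<delta>1 \<noteq> 0" "\<And>m c. eval2 \<delta>1 m c \<noteq> 0 \<Longrightarrow> no_fat_at Z r m c"
      using no_fat_at_index[OF Z Zne] index by auto
    have "\<exists>\<delta>. \<delta> \<noteq> 0 \<and> (\<forall>m c. eval2 \<delta> m c \<noteq> 0 \<longrightarrow> no_fat_at (Z - {p}) r m c)" if p: "p \<in> Z" for p
    proof -
      have "\<not> fat_family (Z - {p}) r w" for w
      proof
        assume "fat_family (Z - {p}) r w"
        then have "fat_family (Z - {p}) (Suc (r - 1)) w" using r(2) by simp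
        \<comment> \<open>Descent applies to r - 1 and the remaining d - 1 points, because 2 (r - 1)
          + 2 = 2r < d - 1.\<close>
        then have "mdr (dual_form (Z - {p})) \<le> r - 1"
          using mdr_le_fat_family[of "Z - {p}" "r - 1" w] Z r del(2)[OF p] by simp
        then show False using eq p r(2) by auto
      qed
      then show ?thesis using fat_dichotomy[of "Z - {p}" r] Z by auto
    qed
    then obtain D where D: "\<And>p. p \<in> Z \<Longrightarrow> D p \<noteq> 0"
      "\<And>p m c. p \<in> Z \<Longrightarrow> eval2 (D p) m c \<noteq> 0 \<Longrightarrow> no_fat_at (Z - {p}) r m c" by metis
    show "generically (\<lambda>q. \<forall>C. unexpected_curve Z (r + 1) q C \<longrightarrow> irreducible C)"
    proof (rule generically_chart[of "\<delta>1 * \<delta>3 * (\<Prod>p\<in>Z. D p)"])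
      show "\<delta>1 * \<delta>3 * (\<Prod>p\<in>Z. D p) \<noteq> 0" using \<delta>1(1) \<delta>3(1) D(1) Z by (auto simp: prod_zero_iff)
      fix q m c assume ch: "in_chart q m c" and "eval2 (\<delta>1 * \<delta>3 * (\<Prod>p\<in>Z. D p)) m c \<noteq> 0"
      then have nz: "eval2 \<delta>1 m c \<noteq> 0" "eval2 \<delta>3 m c \<noteq> 0" "\<And>p. p \<in> Z \<Longrightarrow> eval2 (D p) m c \<noteq> 0"
        using Z by (auto simp: eval2_simps eval2_prod)
      interpret projection Z q m c using projectionI[OF \<delta>3(2)[OF nz(2)] ch] .
      show "\<forall>C. unexpected_curve Z (r + 1) q C \<longrightarrow> irreducible C"
      proof (intro allI impI)
        fix C assume "unexpected_curve Z (r + 1) q C"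
        then have "C \<in> sections_through_fat Z (Suc r) q" "C \<noteq> 0" by (auto simp: unexpected_curve_def)
        then show "irreducible C"
          by (intro fat_section_irreducible[of r C] \<delta>1(2)[OF nz(1)] D(2) nz(3))
      qed
    qed
  next
    assume gen: "generically (\<lambda>q. \<forall>C. unexpected_curve Z (r + 1) q C \<longrightarrow> irreducible C)"
    show "\<forall>p\<in>Z. r = mdr (dual_form (Z - {p}))"
    proof (rule ballI, rule ccontr)
      fix p assume p: "p \<in> Z" and ne: "r \<noteq> mdr (dual_form (Z - {p}))"
      define k where "k = mdr (dual_form (Z - {p}))"
      have k: "k < r" using ne del(3)[OF p] by (simp add: k_def)
      obtain \<delta>2 where \<delta>2: "\<delta>2 \<noteq> 0" "\<And>m c. eval2 \<delta>2 m c \<noteq> 0 \<Longrightarrow> \<not> no_fat_at (Z - {p}) (Suc k) m c"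
        using fat_family_mdr[OF finite_Diff[OF Z] del(1)[OF p]] fat_family_imp_fat_curve[of "Z - {p}" "Suc k"]
        unfolding k_def by blast
      have "generically (\<lambda>q. \<exists>C. unexpected_curve Z (r + 1) q C \<and> \<not> irreducible C)"
      proof (rule generically_chart[of "\<delta>2 * \<delta>3"])
        show "\<delta>2 * \<delta>3 \<noteq> 0" using \<delta>2(1) \<delta>3(1) by simp
        fix q m c assume ch: "in_chart q m c" and "eval2 (\<delta>2 * \<delta>3) m c \<noteq> 0"
        then have nz: "eval2 \<delta>2 m c \<noteq> 0" "eval2 \<delta>3 m c \<noteq> 0" by (auto simp: eval2_simps)
        interpret projection Z q m c using projectionI[OF \<delta>3(2)[OF nz(2)] ch] .
        have r1: "r = Suc (r - 1)" using r(2) by simp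
        have "\<not> no_fat_at (Z - {p}) (Suc (r - 1)) m c"
          using no_fat_curve_mono[of "Z - {p}" T Sg Y "Suc (r - 1)" "Suc k"] \<delta>2(2)[OF nz(1)] k by auto
        then obtain C where "C \<in> sections_through_fat Z (Suc (Suc (r - 1))) q" "C \<noteq> 0" "\<not> irreducible C"
          using reducible_fat_section[OF p] by blast
        then show "\<exists>C. unexpected_curve Z (r + 1) q C \<and> \<not> irreducible C"
          using adm r1 by (auto simp: unexpected_curve_def)
      qed
      from generically_conj[OF gen this] have "generically (\<lambda>q. False)"
        by (rule generically_mono) blast
      then show False using generically_False by simp
    qed
  qed
qed

theorem theorem1p2:
  fixes Z :: "P2 set" and d r :: nat
  assumes "finite Z"
    and "d = card Z"
    and "r = mdr (dual_form Z)"
  shows "((\<exists>j. admits_unexpected Z j) \<longleftrightarrow>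
            max_multiplicity (dual_arrangement Z) \<le> r + 1 \<and> real (r + 1) < real d / 2)
       \<and> (max_multiplicity (dual_arrangement Z) \<le> r + 1 \<and> real (r + 1) < real d / 2 \<longrightarrow>
            (\<forall>j. admits_unexpected Z j \<longleftrightarrow> r < j \<and> int j \<le> int d - int r - 2)
          \<and> (generically (\<lambda>q. \<forall>C. unexpected_curve Z (r + 1) q C \<longrightarrow> irreducible C) \<longleftrightarrow>
               (\<forall>p\<in>Z. mdr (dual_form Z) = mdr (dual_form (Z - {p})))))"
proof (cases "Z = {}")
  case True
  then show ?thesis using assms(2) not_admits_unexpected_empty by auto
next
  case False
  note Z = assms(1) False
  let ?a = "multiplicity_index Z"
  have half: "real (r + 1) < real d / 2 \<longleftrightarrow> 2 * r + 2 < d" by linarith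
  have ar: "?a \<le> r" using multiplicity_index_family(2)[OF Z] assms(3) by simp
  have ra: "?a = r" if "2 * ?a + 2 < d"
    using multiplicity_index_family(1)[OF Z] mdr_le_fat_family[OF assms(1)] that ar assms(2,3)
    by (metis le_antisym)
  have pos: "1 \<le> n" if "concurrent_at_most Z (n + 1)" "2 < d" for n
    using concurrent_at_most_ge_2[OF that(1)] that(2) assms(2) by simp
  have first: "(\<exists>j. admits_unexpected Z j) \<longleftrightarrow> concurrent_at_most Z (r + 1) \<and> 2 * r + 2 < d"
  proof
    assume "\<exists>j. admits_unexpected Z j"
    then obtain j where j: "?a < j" "j + ?a + 1 < card Z" "concurrent_at_most Z (?a + 1)"
      unfolding admits_unexpected_iff[OF Z] by blast
    \<comment> \<open>From a + 1 \<le> j \<le> d - a - 2.\<close>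
    then have "2 * ?a + 2 < d" using assms(2) by simp
    then show "concurrent_at_most Z (r + 1) \<and> 2 * r + 2 < d" using ra j(3) by simp
  next
    assume R: "concurrent_at_most Z (r + 1) \<and> 2 * r + 2 < d"
    then have "?a = r" using ar by (intro ra) simp
    moreover have "1 \<le> r" using R by (intro pos) auto
    ultimately have "admits_unexpected Z (r + 1)"
      unfolding admits_unexpected_iff[OF Z] using R assms(2) by simp
    then show "\<exists>j. admits_unexpected Z j" by blast
  qed
  have second: "admits_unexpected Z j \<longleftrightarrow> r < j \<and> int j \<le> int d - int r - 2"
    if R: "concurrent_at_most Z (r + 1)" "2 * r + 2 < d" for j
  proof -
    have "?a = r" using ar R by (intro ra) simp
    moreover have "1 \<le> r" using R by (intro pos) auto
    ultimately show ?thesis unfolding admits_unexpected_iff[OF Z] using R assms(2) by auto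
  qed
  have third: "generically (\<lambda>q. \<forall>C. unexpected_curve Z (r + 1) q C \<longrightarrow> irreducible C) \<longleftrightarrow>
      (\<forall>p\<in>Z. mdr (dual_form Z) = mdr (dual_form (Z - {p})))"
    if R: "concurrent_at_most Z (r + 1)" "2 * r + 2 < d"
  proof -
    have "?a = r" using ar R by (intro ra) simp
    moreover have "1 \<le> r" using R by (intro pos) auto
    moreover have "admits_unexpected Z (r + 1)" unfolding second[OF R] using R(2) by auto
    ultimately show ?thesis
      using generic_irreducibility[OF assms(1,3)] R(2) assms(2,3) by simp
  qed
  show ?thesis unfolding half max_multiplicity_le_iff[OF assms(1)] using first second third by blast
qed

end
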